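(* Let $\Gamma\subset\mathbb{C}$ be a lattice, $\beta_0\in\Gamma^*$ with $\Gamma^*_{\beta_0}\ne\emptyset$, $\Delta\subseteq\Gamma^*_{\beta_0}$ a non-empty subset closed under $\gamma\mapsto-\gamma$, and $E\in\mathcal{E}_\Delta$. To the triple $(X_\Delta,\lambda,\mathcal{L}(E))$ there corresponds a based map $f:\mathbb{C}/\Gamma\to\mathbb{R}^4$, determined up to dilations and the action of $T_0$, which is a weakly conformal HSL immersion with Maslov class $\beta_0$ and for which $(X_\Delta,\lambda,\mathcal{L}(E))$ is its spectral data.
   Context: **HSL tori.** $\mathbb{R}^4$ has its standard inner product and orthonormal basis $\varepsilon_1,\dots,\varepsilon_4$. $J,L\in SO(4)$ are given by $J\varepsilon_1=\varepsilon_2$, $J\varepsilon_2=-\varepsilon_1$, $J\varepsilon_3=\varepsilon_4$, $J\varepsilon_4=-\varepsilon_3$; $L\varepsilon_1=\varepsilon_3$, $L\varepsilon_3=-\varepsilon_1$, $L\varepsilon_2=-\varepsilon_4$, $L\varepsilon_4=\varepsilon_2$, extended complex linearly to $\mathbb{C}^4$. $G_0=\{g\in SO(4):gJ=Jg,\ gL=Lg\}\simeq SU(2)$. On $\mathbb{C}$, $\langle z,w\rangle=\mathrm{Re}(z\bar w)$; $\Gamma^*=\{\gamma\in\mathbb{C}:\langle\gamma,z\rangle\in\mathbb{Z}\ \forall z\in\Gamma\}$. For $\beta_0\in\Gamma^*$ put $\beta(z)=2\pi\langle\beta_0,z\rangle$. A weakly conformal Hamiltonian stationary Lagrangian (HSL)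 immersion with Maslov class $\beta_0$ (normalised so that its Lagrangian angle $\beta$ vanishes at $0$) is a non-constant smooth $f:\mathbb{C}/\Gamma\to\mathbb{R}^4$ with $e^{J\beta}L f_z=i f_z$; it is based if $f(0)=0$. Put $v_1=\frac1{\sqrt2}(\varepsilon_1-i\varepsilon_2)$, $v_2=\frac1{\sqrt2}(\varepsilon_3-i\varepsilon_4)$, $v_3=\bar v_1$, $v_4=\bar v_2$. $T_0=\{g\in G_0: g\,\mathbb{C}v_1=\mathbb{C}v_1\}\simeq S^1$. **Frequencies.** $\Gamma^*_{\beta_0}=\{\gamma\in\Gamma^*+\frac{\beta_0}{2}:|\gamma|=\frac{|\beta_0|}2,\ \gamma\ne\pm\frac{\beta_0}2\}$. $\Delta_f\subset\Gamma^*_{\beta_0}$ is the set of frequencies $\gamma$ whose Fourier coefficient in $u=e^{-J\beta/2}f_z$ (expanded in $e^{2\pi i\langle\gamma,z\rangle}$, $\gamma\in\frac12\Gamma^*$) is non-zero. **Spectral triples.** For $\Delta$ as in the claim let $N_\Delta=\#\Delta$, $\mathfrak{S}_\Delta=\{2\gamma/\beta_0:\gamma\in\Delta\}$, $p_\Delta(\lambda)=\prod_{s\in\mathfrak{S}_\Delta}(\lambda-s)$. $X_\Delta$ is the completion by smooth points of the affine curve in $\mathbb{C}^5\setminus\{Z_5=0\}$ with equations $Z_j(Z_j-p_\Delta(Z_5))=0$, $Z_jZ_k=0$ ($1\le j\ne k\le4$), and $\lambda=Z_5$. Its components are $C_1,\dots,C_5$, where for $j\le4$ $C_j$ has affine part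 $Z_j=p_\Delta(Z_5)$, $Z_k=0$ ($k\ne j$, $k\le4$) and $C_5$ has affine part $Z_1=\dots=Z_4=0$; $\lambda$ identifies each with $\hat{\mathbb{C}}=\mathbb{C}\cup\{\infty\}$, and all meet over each point of $\mathfrak{S}_\Delta$. $P_j\in C_j$ is the point over $\lambda=0$. The antiholomorphic involution $\rho$ swaps $C_1\leftrightarrow C_3$, $C_2\leftrightarrow C_4$, preserves $C_5$, with $\lambda\circ\rho=\bar\lambda^{-1}$; the holomorphic involution $\tau$ swaps $C_1\leftrightarrow C_4$, $C_2\leftrightarrow C_3$, preserves $C_5$, with $\lambda\circ\tau=-\lambda$. $\mathcal{E}_\Delta$ is the set of effective divisors $E$ of degree $N_\Delta-1$ on $C_1\simeq\hat{\mathbb{C}}$ such that if $s\in\mathfrak{S}_\Delta$ lies in the support of $E$ then $-s$ does not. For $E\in\mathcal{E}_\Delta$ let $E'=E-\sum_{s\in\mathfrak{S}_\Delta\cap\mathrm{Supp}E}s$, $D_E=E'+\rho^*E'+\tau^*E'+(\rho\tau)^*E'+\sum_{k=1}^4P_k$, $\mathfrak{S}_1=\mathfrak{S}_\Delta\setminus\mathrm{Supp}E$, $\mathfrak{S}_2=-\mathfrak{S}_1$. Let $X_E$ be the completion by smooth points of the curve $Z_j(Z_j-p_j(Z_5))=0$, $Z_jZ_k=0$ ($1\le j\ne k\le4$) in $\mathbb{C}^5\setminus\{Z_5=0\}$ with $p_1=p_3=\prod_{s\in\mathfrak{S}_1}(\lambda-s)$, $p_2=p_4=\prod_{s\in\mathfrak{S}_2}(\lambda-s)$;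 it is a partial desingularisation of $X_\Delta$ with the same five components. $\mathcal{L}(E)$ is the direct image on $X_\Delta$ of the line bundle $\mathcal{O}_{X_E}(D_E)$ (so $\mathcal{L}(E)=\mathcal{O}_{X_\Delta}(D_E)$ if $E$ avoids $\mathfrak{S}_\Delta$). **Spectral data of $f$.** Let $f$ be a based weakly conformal HSL immersion with Maslov class $\beta_0$ and put $\Delta=\Delta_f$. There is a unique $\mathbb{C}^4$-valued $x(\lambda,z)$, polynomial in $\lambda$ with coefficients smooth in $z\in\mathbb{C}$, satisfying $dx+\frac\pi2(\lambda^{-1}\bar\beta_0dz+\lambda\beta_0d\bar z)Jx=p_\Delta(\lambda)e^{-J\beta/2}(f_zdz+\lambda f_{\bar z}d\bar z)$; it has degree at most $N_\Delta$ in $\lambda$ and vanishes at $\lambda=0$. Write $x=\sum_k\chi_kv_k$. Let $E$ be the degree $N_\Delta-1$ divisor on $\hat{\mathbb{C}}\simeq C_1$ of zeroes of $\lambda^{-1}\chi_1(\lambda,0)$, regarded as a polynomial of formal degree $N_\Delta-1$ (so $\infty$ is counted with multiplicity $N_\Delta-1$ minus its degree). The spectral data of $f$ is $(X_{\Delta_f},\lambda,\mathcal{L}(E))$. *)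

theory Defs
  imports "HOL-Analysis.Analysis" "HOL-Computational_Algebra.Polynomial"
    "HOL-Library.Multiset"
begin

section \<open>Linear algebra of real and complex four-space\<close>

text \<open>Indices range over the numeral types \<^typ>\<open>4\<close> and \<^typ>\<open>5\<close>, in which \<open>4 = 0\<close> and
  \<open>5 = 0\<close> respectively.\<close>

definition cvec :: "real ^ 'n \<Rightarrow> complex ^ 'n" where
  "cvec v = (\<chi> i. of_real (v $ i))"

definition cmat :: "real ^ 'n ^ 'm \<Rightarrow> complex ^ 'n ^ 'm" where
  "cmat A = (\<chi> i j. of_real (A $ i $ j))"

definition mexp :: "real ^ 'n ^ 'n \<Rightarrow> real ^ 'n ^ 'n" where
  "mexp A = (\<Sum>k. (1 / fact k) *\<^sub>R (((**) A) ^^ k) (mat 1))"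

definition matJ :: "real ^ 4 ^ 4" where
  "matJ = matrix (\<lambda>x. x $ 1 *\<^sub>R axis 2 1 - x $ 2 *\<^sub>R axis 1 1
                     + x $ 3 *\<^sub>R axis 4 1 - x $ 4 *\<^sub>R axis 3 1)"

definition matL :: "real ^ 4 ^ 4" where
  "matL = matrix (\<lambda>x. x $ 1 *\<^sub>R axis 3 1 - x $ 3 *\<^sub>R axis 1 1
                     - x $ 2 *\<^sub>R axis 4 1 + x $ 4 *\<^sub>R axis 2 1)"

definition vframe :: "4 \<Rightarrow> complex ^ 4" where
  "vframe k =
    (let v1 = of_real (1 / sqrt 2) *s (axis 1 1 - \<i> *s axis 2 1);
         v2 = of_real (1 / sqrt 2) *s (axis 3 1 - \<i> *s axis 4 1)
     in if k = 1 then v1 else if k = 2 then v2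
        else if k = 3 then (\<chi> i. cnj (v1 $ i)) else (\<chi> i. cnj (v2 $ i)))"

definition G0 :: "(real ^ 4 ^ 4) set" where
  "G0 = {g. orthogonal_matrix g \<and> det g = 1 \<and> g ** matJ = matJ ** g \<and> g ** matL = matL ** g}"

definition T0 :: "(real ^ 4 ^ 4) set" where
  "T0 = {g \<in> G0. (\<lambda>w. cmat g *v w) ` range (\<lambda>c. c *s vframe 1) = range (\<lambda>c. c *s vframe 1)}"


section \<open>Lattices, Fourier coefficients and smooth maps\<close>

definition lattice_basis :: "complex set \<Rightarrow> complex \<times> complex \<Rightarrow> bool" where
  "lattice_basis \<Gamma> w \<longleftrightarrow>
     fst w \<noteq> snd w \<and> independent {fst w, snd w} \<and>
     \<Gamma> = {of_int m * fst w + of_int n * snd w | m n. True}"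

definition is_lattice :: "complex set \<Rightarrow> bool" where
  "is_lattice \<Gamma> \<longleftrightarrow> (\<exists>w. lattice_basis \<Gamma> w)"

definition dual_lattice :: "complex set \<Rightarrow> complex set" where
  "dual_lattice \<Gamma> = {\<gamma>. \<forall>z\<in>\<Gamma>. inner \<gamma> z \<in> \<int>}"

definition freqs :: "complex set \<Rightarrow> complex \<Rightarrow> complex set" where
  "freqs \<Gamma> \<beta>0 =
     {\<gamma>. \<gamma> - \<beta>0 / 2 \<in> dual_lattice \<Gamma> \<and> cmod \<gamma> = cmod \<beta>0 / 2 \<and> \<gamma> \<noteq> \<beta>0 / 2 \<and> \<gamma> \<noteq> - (\<beta>0 / 2)}"

text \<open>Fourier coefficient of a function periodic under \<open>2\<Gamma>\<close> (whose dual lattice is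
  \<open>\<Gamma>\<^sup>*/2\<close>): the mean of \<open>e\<^bsup>-2\<pi>i\<langle>\<gamma>,z\<rangle>\<^esup> u(z)\<close> over a period parallelogram of \<open>2\<Gamma>\<close>. For such
  \<open>u\<close> and \<open>\<gamma>\<close> it does not depend on the chosen basis.\<close>

definition fourier_coeff ::
    "complex set \<Rightarrow> (complex \<Rightarrow> complex ^ 4) \<Rightarrow> complex \<Rightarrow> complex ^ 4" where
  "fourier_coeff \<Gamma> u \<gamma> =
     (let w = (SOME w. lattice_basis \<Gamma> w);
          Z = (\<lambda>t :: real \<times> real. 2 * (of_real (fst t) * fst w + of_real (snd t) * snd w))
      in integral (cbox (0, 0) (1, 1)) (\<lambda>t. cis (- 2 * pi * inner \<gamma> (Z t)) *s u (Z t)))"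

primrec Ck :: "nat \<Rightarrow> ('a::real_normed_vector \<Rightarrow> 'b::real_normed_vector) \<Rightarrow> bool" where
  "Ck 0 f \<longleftrightarrow> continuous_on UNIV f"
| "Ck (Suc k) f \<longleftrightarrow>
     f differentiable_on UNIV \<and> (\<forall>v. Ck k (\<lambda>x. frechet_derivative f (at x) v))"

definition smooth :: "('a::real_normed_vector \<Rightarrow> 'b::real_normed_vector) \<Rightarrow> bool" where
  "smooth f \<longleftrightarrow> (\<forall>k. Ck k f)"

definition d_z :: "(complex \<Rightarrow> real ^ 4) \<Rightarrow> complex \<Rightarrow> complex ^ 4" where
  "d_z f z = (1 / 2) *s (cvec (frechet_derivative f (at z) 1)
                          - \<i> *s cvec (frechet_derivative f (at z) \<i>))"

definition d_zbar :: "(complex \<Rightarrow> real ^ 4) \<Rightarrow> complex \<Rightarrow> complex ^ 4" where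
  "d_zbar f z = (1 / 2) *s (cvec (frechet_derivative f (at z) 1)
                             + \<i> *s cvec (frechet_derivative f (at z) \<i>))"


section \<open>Weakly conformal Hamiltonian stationary Lagrangian immersions\<close>

text \<open>Maps from the torus \<open>\<complex>/\<Gamma>\<close> are \<open>\<Gamma>\<close>-periodic maps on the plane.\<close>

definition lag_angle :: "complex \<Rightarrow> complex \<Rightarrow> real" where
  "lag_angle \<beta>0 z = 2 * pi * inner \<beta>0 z"

definition weakly_conformal_HSL ::
    "complex set \<Rightarrow> complex \<Rightarrow> (complex \<Rightarrow> real ^ 4) \<Rightarrow> bool" where
  "weakly_conformal_HSL \<Gamma> \<beta>0 f \<longleftrightarrow>
     (\<forall>z. \<forall>w\<in>\<Gamma>. f (z + w) = f z) \<and> smooth f \<and> (\<exists>z w. f z \<noteq> f w) \<and>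
     (\<forall>z. cmat (mexp (lag_angle \<beta>0 z *\<^sub>R matJ)) *v (cmat matL *v d_z f z) = \<i> *s d_z f z)"

definition based :: "(complex \<Rightarrow> real ^ 4) \<Rightarrow> bool" where
  "based f \<longleftrightarrow> f 0 = 0"

definition u_of :: "complex \<Rightarrow> (complex \<Rightarrow> real ^ 4) \<Rightarrow> complex \<Rightarrow> complex ^ 4" where
  "u_of \<beta>0 f z = cmat (mexp ((- (lag_angle \<beta>0 z / 2)) *\<^sub>R matJ)) *v d_z f z"

definition freqs_of :: "complex set \<Rightarrow> complex \<Rightarrow> (complex \<Rightarrow> real ^ 4) \<Rightarrow> complex set" where
  "freqs_of \<Gamma> \<beta>0 f = {\<gamma>. 2 * \<gamma> \<in> dual_lattice \<Gamma> \<and> fourier_coeff \<Gamma> (u_of \<beta>0 f) \<gamma> \<noteq> 0}"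


section \<open>The curves\<close>

text \<open>The curves are determined by polynomials \<open>p j\<close> for \<open>j \<noteq> 5\<close>; the value \<open>p 5\<close> is never
  used. A point of the completed curve is a point of the affine curve or one of the two points
  added on each component, over \<open>\<lambda> = 0\<close> and over \<open>\<lambda> = \<infinity>\<close>.\<close>

datatype sphere_pt = Num complex | Infty

datatype curve_pt = Aff "complex ^ 5" | Over0 5 | OverInf 5

definition affine_curve :: "(5 \<Rightarrow> complex poly) \<Rightarrow> (complex ^ 5) set" where
  "affine_curve p =
     {Z. Z $ 5 \<noteq> 0 \<and> (\<forall>j. j \<noteq> 5 \<longrightarrow> Z $ j * (Z $ j - poly (p j) (Z $ 5)) = 0) \<and>
         (\<forall>j k. j \<noteq> 5 \<longrightarrow> k \<noteq> 5 \<longrightarrow> j \<noteq> k \<longrightarrow> Z $ j * Z $ k = 0)}"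

definition curve_pts :: "(5 \<Rightarrow> complex poly) \<Rightarrow> curve_pt set" where
  "curve_pts p = Aff ` affine_curve p \<union> range Over0 \<union> range OverInf"

fun lam :: "curve_pt \<Rightarrow> sphere_pt" where
  "lam (Aff Z) = Num (Z $ 5)"
| "lam (Over0 j) = Num 0"
| "lam (OverInf j) = Infty"

text \<open>\<open>comp_pt p j a\<close> is the point of the component \<open>C\<^sub>j\<close> over \<open>a\<close>, that is, \<open>comp_pt p j\<close> is
  the inverse of \<open>\<lambda>\<close> on \<open>C\<^sub>j\<close>. For \<open>j = 5\<close> all of \<open>Z\<^sub>1, \<dots>, Z\<^sub>4\<close> vanish.\<close>

fun comp_pt :: "(5 \<Rightarrow> complex poly) \<Rightarrow> 5 \<Rightarrow> sphere_pt \<Rightarrow> curve_pt" where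
  "comp_pt p j Infty = OverInf j"
| "comp_pt p j (Num a) =
     (if a = 0 then Over0 j
      else Aff (\<chi> k. if k = 5 then a else if k = j then poly (p j) a else 0))"

definition component :: "(5 \<Rightarrow> complex poly) \<Rightarrow> 5 \<Rightarrow> curve_pt set" where
  "component p j = range (comp_pt p j)"

text \<open>Zariski topology of the curve: the closed sets are the finite unions of points and
  components.\<close>

definition zopen :: "(5 \<Rightarrow> complex poly) \<Rightarrow> curve_pt set \<Rightarrow> bool" where
  "zopen p U \<longleftrightarrow> U \<subseteq> curve_pts p \<and>
     (\<forall>j. component p j \<inter> U = {} \<or> finite (component p j - U))"

inductive_set polyfuns :: "(complex ^ 5 \<Rightarrow> complex) set" where
  const: "(\<lambda>Z. c) \<in> polyfuns"
| coord: "(\<lambda>Z. Z $ i) \<in> polyfuns"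
| add: "g \<in> polyfuns \<Longrightarrow> h \<in> polyfuns \<Longrightarrow> (\<lambda>Z. g Z + h Z) \<in> polyfuns"
| mult: "g \<in> polyfuns \<Longrightarrow> h \<in> polyfuns \<Longrightarrow> (\<lambda>Z. g Z * h Z) \<in> polyfuns"

text \<open>\<open>loc_coord x\<close> is the local coordinate \<open>\<lambda> - \<lambda>(x)\<close>, respectively \<open>1/\<lambda>\<close>, at a smooth point
  \<open>x\<close>. Its values far from \<open>x\<close> (for instance where \<open>\<lambda> = 0\<close> in the second case) are irrelevant,
  since it is used only on unspecified neighbourhoods of \<open>x\<close>.\<close>

definition loc_coord :: "curve_pt \<Rightarrow> curve_pt \<Rightarrow> complex" where
  "loc_coord x y =
     (case (lam x, lam y) of
        (Num a, Num b) \<Rightarrow> b - a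
      | (Infty, Num b) \<Rightarrow> 1 / b
      | _ \<Rightarrow> 0)"

text \<open>On a neighbourhood of the smooth point \<open>x\<close>, outside \<open>A\<close>, the function \<open>h\<close> is a rational
  function of the local coordinate without pole at \<open>x\<close>.\<close>

definition rational_near ::
    "(5 \<Rightarrow> complex poly) \<Rightarrow> curve_pt \<Rightarrow> curve_pt set \<Rightarrow> (curve_pt \<Rightarrow> complex) \<Rightarrow> bool" where
  "rational_near p x A h \<longleftrightarrow>
     (\<exists>V g k. zopen p V \<and> x \<in> V \<and> poly k 0 \<noteq> 0 \<and>
        (\<forall>y\<in>V - A. poly k (loc_coord x y) \<noteq> 0 \<and>
                    h y = poly g (loc_coord x y) / poly k (loc_coord x y)))"

text \<open>The affine curve is reduced, so that its regular functions are the functions that are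
  locally quotients of polynomials in the ambient coordinates.\<close>

definition regular_at ::
    "(5 \<Rightarrow> complex poly) \<Rightarrow> (curve_pt \<Rightarrow> complex) \<Rightarrow> curve_pt \<Rightarrow> bool" where
  "regular_at p h x \<longleftrightarrow>
     (case x of
        Aff Z \<Rightarrow> (\<exists>V. \<exists>g\<in>polyfuns. \<exists>k\<in>polyfuns. zopen p V \<and> x \<in> V \<and>
                    (\<forall>W. Aff W \<in> V \<longrightarrow> k W \<noteq> 0 \<and> h (Aff W) = g W / k W))
      | _ \<Rightarrow> rational_near p x {} h)"

text \<open>Sections over \<open>U\<close> of \<open>\<O>(D)\<close>, for an effective divisor \<open>D\<close> supported on smooth points: the
  functions regular on \<open>U\<close> outside the support of \<open>D\<close>, with at \<open>x\<close> in the support a pole of order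
  at most the multiplicity of \<open>x\<close> in \<open>D\<close>. For \<open>D = {#}\<close> this is the structure sheaf.\<close>

definition div_sections ::
    "(5 \<Rightarrow> complex poly) \<Rightarrow> curve_pt multiset \<Rightarrow> curve_pt set \<Rightarrow> (curve_pt \<Rightarrow> complex) set" where
  "div_sections p D U =
     {h \<in> extensional (U - set_mset D).
        (\<forall>x\<in>U - set_mset D. regular_at p h x) \<and>
        (\<forall>x\<in>U \<inter> set_mset D.
            rational_near p x {x} (\<lambda>y. loc_coord x y ^ count D x * h y))}"

record curve =
  points :: "curve_pt set"
  opens :: "curve_pt set set"
  reg_funs :: "curve_pt set \<Rightarrow> (curve_pt \<Rightarrow> complex) set"

definition curve_of :: "(5 \<Rightarrow> complex poly) \<Rightarrow> curve" where
  "curve_of p = \<lparr>points = curve_pts p, opens = {U. zopen p U}, reg_funs = div_sections p {#}\<rparr>"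


section \<open>Sheaves of modules\<close>

text \<open>\<open>restr V\<close> is the restriction of sections to the open set \<open>V\<close>.\<close>

record module_sheaf =
  sections :: "curve_pt set \<Rightarrow> (curve_pt \<Rightarrow> complex) set"
  sec_add :: "curve_pt set \<Rightarrow> (curve_pt \<Rightarrow> complex) \<Rightarrow> (curve_pt \<Rightarrow> complex) \<Rightarrow> curve_pt \<Rightarrow> complex"
  sec_smult :: "curve_pt set \<Rightarrow> (curve_pt \<Rightarrow> complex) \<Rightarrow> (curve_pt \<Rightarrow> complex) \<Rightarrow> curve_pt \<Rightarrow> complex"
  restr :: "curve_pt set \<Rightarrow> (curve_pt \<Rightarrow> complex) \<Rightarrow> curve_pt \<Rightarrow> complex"

definition sheaf_iso :: "curve \<Rightarrow> module_sheaf \<Rightarrow> module_sheaf \<Rightarrow> bool" where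
  "sheaf_iso X F G \<longleftrightarrow>
     (\<exists>\<phi>. \<forall>U\<in>opens X.
        bij_betw (\<phi> U) (sections F U) (sections G U) \<and>
        (\<forall>s\<in>sections F U. \<forall>t\<in>sections F U.
            \<phi> U (sec_add F U s t) = sec_add G U (\<phi> U s) (\<phi> U t)) \<and>
        (\<forall>h\<in>reg_funs X U. \<forall>s\<in>sections F U.
            \<phi> U (sec_smult F U h s) = sec_smult G U h (\<phi> U s)) \<and>
        (\<forall>V\<in>opens X. V \<subseteq> U \<longrightarrow>
            (\<forall>s\<in>sections F U. \<phi> V (restr F V s) = restr G V (\<phi> U s))))"

text \<open>Direct image, under a map \<open>\<pi>\<close> from the curve given by \<open>p\<close>, of the line bundle \<open>\<O>(D)\<close> on
  that curve.\<close>

definition direct_image ::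
    "(5 \<Rightarrow> complex poly) \<Rightarrow> (curve_pt \<Rightarrow> curve_pt) \<Rightarrow> curve_pt multiset \<Rightarrow> module_sheaf" where
  "direct_image p \<pi> D =
     (let pre = (\<lambda>U. {x \<in> curve_pts p. \<pi> x \<in> U});
          dom = (\<lambda>U. pre U - set_mset D)
      in \<lparr>sections = (\<lambda>U. div_sections p D (pre U)),
          sec_add = (\<lambda>U s t. restrict (\<lambda>x. s x + t x) (dom U)),
          sec_smult = (\<lambda>U h s. restrict (\<lambda>x. h (\<pi> x) * s x) (dom U)),
          restr = (\<lambda>V s. restrict s (dom V))\<rparr>)"


section \<open>Spectral triples\<close>

definition spec_pts :: "complex \<Rightarrow> complex set \<Rightarrow> complex set" where
  "spec_pts \<beta>0 \<Delta> = (\<lambda>\<gamma>. 2 * \<gamma> / \<beta>0) ` \<Delta>"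

definition root_poly :: "complex set \<Rightarrow> complex poly" where
  "root_poly S = (\<Prod>s\<in>S. [:- s, 1:])"

definition X_curve :: "complex \<Rightarrow> complex set \<Rightarrow> curve" where
  "X_curve \<beta>0 \<Delta> = curve_of (\<lambda>j. root_poly (spec_pts \<beta>0 \<Delta>))"

text \<open>Effective divisors on the Riemann sphere are finite multisets of points.\<close>

definition admissible_divisors :: "complex \<Rightarrow> complex set \<Rightarrow> sphere_pt multiset set" where
  "admissible_divisors \<beta>0 \<Delta> =
     {E. size E = card \<Delta> - 1 \<and>
         (\<forall>s\<in>spec_pts \<beta>0 \<Delta>. Num s \<in># E \<longrightarrow> Num (- s) \<notin># E)}"

text \<open>The involutions, on pairs \<open>(j, a)\<close> representing the point of \<open>C\<^sub>j\<close> over \<open>a\<close>.\<close>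

fun rho :: "5 \<times> sphere_pt \<Rightarrow> 5 \<times> sphere_pt" where
  "rho (j, a) =
     (if j = 1 then 3 else if j = 3 then 1 else if j = 2 then 4 else if j = 4 then 2 else j,
      case a of Infty \<Rightarrow> Num 0 | Num b \<Rightarrow> if b = 0 then Infty else Num (inverse (cnj b)))"

fun tau :: "5 \<times> sphere_pt \<Rightarrow> 5 \<times> sphere_pt" where
  "tau (j, a) =
     (if j = 1 then 4 else if j = 4 then 1 else if j = 2 then 3 else if j = 3 then 2 else j,
      case a of Infty \<Rightarrow> Infty | Num b \<Rightarrow> Num (- b))"

definition S_part :: "complex \<Rightarrow> complex set \<Rightarrow> sphere_pt multiset \<Rightarrow> 5 \<Rightarrow> complex set" where
  "S_part \<beta>0 \<Delta> E j =
     (let S1 = {s \<in> spec_pts \<beta>0 \<Delta>. Num s \<notin># E}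
      in if j = 1 \<or> j = 3 then S1 else uminus ` S1)"

definition XE_poly :: "complex \<Rightarrow> complex set \<Rightarrow> sphere_pt multiset \<Rightarrow> 5 \<Rightarrow> complex poly" where
  "XE_poly \<beta>0 \<Delta> E j = root_poly (S_part \<beta>0 \<Delta> E j)"

text \<open>The divisor \<open>D\<^sub>E\<close> on the curve \<open>X\<^sub>E\<close>; the pullback of an effective divisor by an involution
  is its image.\<close>

definition D_divisor :: "complex \<Rightarrow> complex set \<Rightarrow> sphere_pt multiset \<Rightarrow> curve_pt multiset" where
  "D_divisor \<beta>0 \<Delta> E =
     (let E' = E - mset_set (Num ` spec_pts \<beta>0 \<Delta> \<inter> set_mset E);
          F = image_mset (Pair 1) E'
      in image_mset (\<lambda>(j, a). comp_pt (XE_poly \<beta>0 \<Delta> E) j a)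
           (F + image_mset rho F + image_mset tau F + image_mset (rho \<circ> tau) F
            + {#(1, Num 0), (2, Num 0), (3, Num 0), (4, Num 0)#}))"

text \<open>The partial desingularisation from \<open>X\<^sub>E\<close> to the spectral curve, the polynomial map that is
  compatible with \<open>\<lambda>\<close> and with the components.\<close>

fun desing :: "complex \<Rightarrow> complex set \<Rightarrow> sphere_pt multiset \<Rightarrow> curve_pt \<Rightarrow> curve_pt" where
  "desing \<beta>0 \<Delta> E (Aff Z) =
     Aff (\<chi> k. if k = 5 then Z $ 5
                else poly (root_poly (spec_pts \<beta>0 \<Delta> - S_part \<beta>0 \<Delta> E k)) (Z $ 5) * Z $ k)"
| "desing \<beta>0 \<Delta> E (Over0 j) = Over0 j"
| "desing \<beta>0 \<Delta> E (OverInf j) = OverInf j"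

definition L_sheaf :: "complex \<Rightarrow> complex set \<Rightarrow> sphere_pt multiset \<Rightarrow> module_sheaf" where
  "L_sheaf \<beta>0 \<Delta> E = direct_image (XE_poly \<beta>0 \<Delta> E) (desing \<beta>0 \<Delta> E) (D_divisor \<beta>0 \<Delta> E)"

type_synonym triple = "curve \<times> (curve_pt \<Rightarrow> sphere_pt) \<times> module_sheaf"

definition spectral_triple :: "complex \<Rightarrow> complex set \<Rightarrow> sphere_pt multiset \<Rightarrow> triple" where
  "spectral_triple \<beta>0 \<Delta> E = (X_curve \<beta>0 \<Delta>, lam, L_sheaf \<beta>0 \<Delta> E)"

text \<open>Triples are compared on a fixed curve with its labelled components; sheaves are compared up
  to isomorphism of sheaves of modules over the structure sheaf of that curve.\<close>

fun same_triple :: "triple \<Rightarrow> triple \<Rightarrow> bool" where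
  "same_triple (X, l, F) (X', l', F') \<longleftrightarrow> X = X' \<and> l = l' \<and> sheaf_iso X F F'"


section \<open>Spectral data of an immersion\<close>

text \<open>The differential equation is written as a formula for \<open>dx\<close>, where \<open>dz\<close> and \<open>d\<zbar>\<close> send the
  tangent vector \<open>v\<close> to \<open>v\<close> and to its conjugate.\<close>

definition spectral_solution ::
    "complex set \<Rightarrow> complex \<Rightarrow> (complex \<Rightarrow> real ^ 4) \<Rightarrow> (complex \<Rightarrow> complex \<Rightarrow> complex ^ 4) \<Rightarrow> bool"
  where
  "spectral_solution \<Gamma> \<beta>0 f x \<longleftrightarrow>
     (\<exists>n c. (\<forall>k. smooth (c k)) \<and> (\<forall>l z. x l z = (\<Sum>k\<le>n. l ^ k *s c k z))) \<and>
     (\<forall>l z. l \<noteq> 0 \<longrightarrow>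
        (x l has_derivative
          (\<lambda>v. poly (root_poly (spec_pts \<beta>0 (freqs_of \<Gamma> \<beta>0 f))) l *s
                 (cmat (mexp ((- (lag_angle \<beta>0 z / 2)) *\<^sub>R matJ)) *v
                    (v *s d_z f z + (l * cnj v) *s d_zbar f z))
               - (of_real (pi / 2) * (inverse l * cnj \<beta>0 * v + l * \<beta>0 * cnj v)) *s
                   (cmat matJ *v x l z)))
        (at z))"

definition zero_divisor :: "nat \<Rightarrow> complex poly \<Rightarrow> sphere_pt multiset \<Rightarrow> bool" where
  "zero_divisor n q E \<longleftrightarrow> q \<noteq> 0 \<and> degree q \<le> n \<and>
     (\<forall>a. count E (Num a) = order a q) \<and> count E Infty = n - degree q"

definition spectral_divisor ::
    "complex set \<Rightarrow> complex \<Rightarrow> (complex \<Rightarrow> real ^ 4) \<Rightarrow> sphere_pt multiset \<Rightarrow> bool" where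
  "spectral_divisor \<Gamma> \<beta>0 f E \<longleftrightarrow>
     (\<exists>x \<chi>' q. spectral_solution \<Gamma> \<beta>0 f x \<and>
        (\<forall>l. x l 0 = (\<Sum>k\<in>UNIV. \<chi>' k l *s vframe k)) \<and>
        (\<forall>l. l \<noteq> 0 \<longrightarrow> poly q l = inverse l * \<chi>' 1 l) \<and>
        zero_divisor (card (freqs_of \<Gamma> \<beta>0 f) - 1) q E)"

definition has_spectral_data ::
    "complex set \<Rightarrow> complex \<Rightarrow> (complex \<Rightarrow> real ^ 4) \<Rightarrow> triple \<Rightarrow> bool" where
  "has_spectral_data \<Gamma> \<beta>0 f T \<longleftrightarrow>
     (\<exists>E. spectral_divisor \<Gamma> \<beta>0 f E \<and>
          same_triple T (spectral_triple \<beta>0 (freqs_of \<Gamma> \<beta>0 f) E))"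

end

theory Submission
  imports Defs "HOL-Computational_Algebra.Fundamental_Theorem_Algebra"
begin

text \<open>Identify \<open>\<real>\<^sup>4\<close> with \<open>\<complex>\<^sup>2\<close> through \<open>F\<^sub>1 = f\<^sub>1 + i f\<^sub>2\<close> and \<open>F\<^sub>2 = f\<^sub>3 + i f\<^sub>4\<close>, so that \<open>J\<close> is
  multiplication by \<open>i\<close>. The equation of a Hamiltonian stationary Lagrangian immersion then
  expresses the derivatives of \<open>F\<^sub>2\<close> by the conjugates of those of \<open>F\<^sub>1\<close> (\<open>hsl_equation_iff\<close>), so
  that a based immersion is determined by \<open>dF\<^sub>1\<close>. Write \<open>S\<close> for the set of the points \<open>2\<gamma>/\<beta>\<^sub>0\<close>,
  \<open>N\<close> for its cardinality, and \<open>p\<close> for the monic polynomial with simple roots in \<open>S\<close>.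

  The \<open>v\<^sub>1\<close>-component \<open>\<chi>\<^sub>1\<close> of a spectral solution satisfies a scalar equation whose inhomogeneous
  term is \<open>p\<close> times the two derivatives of \<open>F\<^sub>1\<close> (up to the factor \<open>e\<^bsup>-i\<beta>/2\<^esup>\<close>). At a root \<open>s = 2\<gamma>/\<beta>\<^sub>0\<close> of
  \<open>p\<close> the equation is homogeneous, and \<open>\<chi>\<^sub>1(s,z) = \<chi>\<^sub>1(s,0) e\<^bsup>-2\<pi>i\<langle>\<gamma>,z\<rangle>\<^esup>\<close>. Comparison of coefficients
  shows that \<open>\<chi>\<^sub>1/\<lambda>\<close> is a polynomial of degree less than \<open>N\<close>, so that its values on \<open>S\<close>
  determine it and with it \<open>dF\<^sub>1\<close> (\<open>scalar_solution_vanishes\<close>, \<open>hsl_unique\<close>). Thus the polynomial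
  \<open>Q = \<lambda>\<^sup>-\<^sup>1\<chi>\<^sub>1(\<lambda>,0)\<close> determines the immersion. This also shows that every such immersion is a
  trigonometric polynomial.

  Conversely, for each polynomial \<open>Q\<close> of degree less than \<open>N\<close>, Lagrange interpolation of the
  exponentials above gives an explicit map \<open>hsl_map\<close> and an explicit spectral solution
  \<open>hsl_solution\<close> with \<open>\<chi>\<^sub>1(\<lambda>,0) = \<lambda>Q(\<lambda>)\<close> up to the normalisation of \<open>v\<^sub>1\<close>. The Fourier coefficient
  at \<open>\<gamma>\<close> vanishes exactly if \<open>Q(s) = Q(-s) = 0\<close> for \<open>s = 2\<gamma>/\<beta>\<^sub>0\<close>; admissibility of the divisor of \<open>Q\<close>
  is the statement that this never happens on \<open>S\<close> (\<open>hsl_coeff_nz\<close>). A divisor of degree \<open>N - 1\<close>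
  determines \<open>Q\<close> up to a scalar \<open>\<kappa> \<noteq> 0\<close>, and \<open>\<kappa>Q\<close> instead of \<open>Q\<close> multiplies \<open>F\<^sub>1\<close> by \<open>\<kappa>\<close> and \<open>F\<^sub>2\<close> by
  its conjugate: a dilation by \<open>|\<kappa>|\<close> combined with an element of \<open>T\<^sub>0\<close> (\<open>hsl_map_phase\<close>).

  It remains to recover the divisor from the isomorphism class of the sheaf
  (\<open>divisor_unique_of_sheaf_iso\<close>). Let \<open>Q\<^sub>E\<close> be the monic polynomial of the finite part of \<open>E\<close>. On
  \<open>C\<^sub>1\<close> every global section of \<open>\<L>(E)\<close> has the form \<open>c + \<alpha> p/(\<lambda>Q\<^sub>E)\<close>, where \<open>c\<close> is its constant value
  on \<open>C\<^sub>5\<close>, because of the bound on its poles and of the gluing of \<open>C\<^sub>1\<close> and \<open>C\<^sub>5\<close>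
  (\<open>section_shape\<close>). Both \<open>1\<close> and the function that is \<open>p/(\<lambda>Q\<^sub>E)\<close> on \<open>C\<^sub>1\<close> and \<open>0\<close> elsewhere are
  global sections. An isomorphism respects their ratio, which is a regular function on a
  sufficiently small open set, and this forces the polynomials of the two divisors to be
  proportional.\<close>

section \<open>Polynomials determined by their values\<close>

lemma poly_eqI_cofinite:
  fixes p q :: "complex poly"
  assumes "finite F" and "\<And>b. b \<notin> F \<Longrightarrow> poly p b = poly q b"
  shows "p = q"
proof (rule ccontr)
  assume "p \<noteq> q"
  then have "finite {b. poly (p - q) b = 0}"
    by (intro poly_roots_finite) auto
  moreover have "- F \<subseteq> {b. poly (p - q) b = 0}"
    using assms(2) by auto
  ultimately show False
    using assms(1) by (metis finite_compl finite_subset infinite_UNIV_char_0)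
qed

lemma poly_root_poly_eq_0_iff:
  "finite S \<Longrightarrow> poly (root_poly S) a = 0 \<longleftrightarrow> a \<in> S"
  by (auto simp: root_poly_def poly_prod)

lemma root_poly_nz [simp]: "root_poly S \<noteq> 0"
  by (cases "finite S") (auto simp: root_poly_def)

lemma degree_root_poly: "finite S \<Longrightarrow> degree (root_poly S) = card S"
  by (simp add: root_poly_def degree_prod_eq_sum_degree)

lemma lead_coeff_root_poly: "lead_coeff (root_poly S) = 1"
  by (cases "finite S") (simp_all add: root_poly_def lead_coeff_prod)

lemma root_poly_Un:
  assumes "finite S" "A \<subseteq> S"
  shows "root_poly S = root_poly A * root_poly (S - A)"
  using assms unfolding root_poly_def by (metis mult.commute prod.subset_diff)

text \<open>An infinite \<open>S'\<close> would give the empty product \<open>1\<close>, whose degree differs from that of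
  \<open>root_poly S\<close>.\<close>

lemma root_poly_inj:
  assumes "finite S" "S \<noteq> {}" "root_poly S = root_poly S'"
  shows "S = S'"
proof -
  have fin: "finite S'"
  proof (rule ccontr)
    assume "infinite S'"
    then have "root_poly S' = 1" by (simp add: root_poly_def)
    then show False using assms degree_root_poly[of S] by simp
  qed
  then show ?thesis
    using assms poly_root_poly_eq_0_iff by (metis subsetI subset_antisym)
qed

text \<open>A representation of \<open>w\<close> as a quotient with denominator of least degree has a constant
  denominator: at a root of the denominator a second representation would allow the root to be
  cancelled. The condition at infinity bounds the degree. For a function on the Riemann sphere
  this is the fact that poles only at infinity, of order at most \<open>d\<close>, leave polynomials of degree
  at most \<open>d\<close>; exceptional finite sets are allowed because the local representations come from
  neighbourhoods that are only cofinite.\<close>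

lemma rational_without_poles:
  fixes w :: "complex \<Rightarrow> complex"
  assumes loc: "\<And>a. \<exists>G K F. finite F \<and> poly K a \<noteq> 0 \<and> (\<forall>b. b \<notin> F \<longrightarrow> w b * poly K b = poly G b)"
    and inf: "\<exists>G K F. finite F \<and> poly K 0 \<noteq> 0 \<and>
                (\<forall>b. b \<notin> F \<longrightarrow> w b * poly K (inverse b) = b ^ d * poly G (inverse b))"
  shows "\<exists>W F. degree W \<le> d \<and> finite F \<and> (\<forall>b. b \<notin> F \<longrightarrow> w b = poly W b)"
proof -
  have uniq: "G * K' = G' * K"
    if "finite F" "finite F'" "\<forall>b. b \<notin> F \<longrightarrow> w b * poly K b = poly G b"
      "\<forall>b. b \<notin> F' \<longrightarrow> w b * poly K' b = poly G' b" for G K F G' K' F'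
  proof (rule poly_eqI_cofinite[of "F \<union> F'"])
    show "finite (F \<union> F')" using that by simp
    fix b assume "b \<notin> F \<union> F'"
    then have "poly G b = w b * poly K b" "poly G' b = w b * poly K' b"
      using that(3,4) by auto
    then show "poly (G * K') b = poly (G' * K) b" by simp
  qed
  define P where "P = (\<lambda>(G, K, F). finite F \<and> K \<noteq> 0 \<and> (\<forall>b. b \<notin> F \<longrightarrow> w b * poly K b = poly G b))"
  obtain G K F where "finite F" "poly K 0 \<noteq> 0" "\<forall>b. b \<notin> F \<longrightarrow> w b * poly K b = poly G b"
    using loc[of 0] by blast
  then have "P (G, K, F)" unfolding P_def by auto
  then obtain T where T: "P T" "\<And>T'. P T' \<Longrightarrow> degree (fst (snd T)) \<le> degree (fst (snd T'))"
    using ex_has_least_nat[of P "(G, K, F)" "\<lambda>T. degree (fst (snd T))"] by blast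
  obtain G K F where TT: "T = (G, K, F)" by (cases T)
  have GK: "finite F" "K \<noteq> 0" "\<forall>b. b \<notin> F \<longrightarrow> w b * poly K b = poly G b"
    using T(1) TT by (auto simp: P_def)
  have K0: "K \<noteq> 0" using GK by auto
  have "degree K = 0"
  proof (rule ccontr)
    assume "degree K \<noteq> 0"
    then obtain a where a: "poly K a = 0"
      using fundamental_theorem_of_algebra[of K] by (auto simp: constant_degree)
    obtain G' K' F' where l: "finite F'" "poly K' a \<noteq> 0"
      "\<forall>b. b \<notin> F' \<longrightarrow> w b * poly K' b = poly G' b" using loc[of a] by blast
    have "G * K' = G' * K" by (rule uniq) (use GK l in auto)
    then have "poly G a * poly K' a = poly G' a * poly K a" by (metis poly_mult)
    then have "poly G a = 0" using a l by simp
    with a obtain G1 K1 where 1: "G = [:-a, 1:] * G1" "K = [:-a, 1:] * K1"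
      by (auto simp: poly_eq_0_iff_dvd dvd_def)
    have "w b * poly K1 b = poly G1 b" if "b \<notin> insert a F" for b
    proof -
      have "(b - a) * (w b * poly K1 b) = (b - a) * poly G1 b"
        using GK(3) that by (auto simp: 1 algebra_simps)
      then show ?thesis using that by simp
    qed
    then have "P (G1, K1, insert a F)"
      using GK(1,2) 1 by (auto simp: P_def)
    then have "degree K \<le> degree K1" using T(2)[of "(G1, K1, insert a F)"] TT by simp
    moreover have "degree K = Suc (degree K1)" using 1 K0 by (subst 1, subst degree_mult_eq) auto
    ultimately show False by simp
  qed
  then have "K dvd 1" using K0 by (simp add: is_unit_iff_degree)
  then have "K dvd G" by (rule unit_imp_dvd)
  then obtain W where W: "G = K * W" by (auto simp: dvd_def)
  define F1 where "F1 = F \<union> {b. poly K b = 0}"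
  have F1: "finite F1" unfolding F1_def using GK K0 poly_roots_finite by auto
  have wW: "w b = poly W b" if "b \<notin> F1" for b
    using that GK(3) W unfolding F1_def by auto
  obtain G' K' F' where l: "finite F'" "poly K' 0 \<noteq> 0"
     "\<forall>b. b \<notin> F' \<longrightarrow> w b * poly K' (inverse b) = b ^ d * poly G' (inverse b)"
    using inf by blast
  have "degree W \<le> d"
  proof (rule ccontr)
    assume c: "\<not> degree W \<le> d"
    have "reflect_poly W * K' = monom 1 (degree W - d) * G'"
    proof (rule poly_eqI_cofinite[of "insert 0 (inverse ` (F1 \<union> F'))"])
      show "finite (insert 0 (inverse ` (F1 \<union> F')))" using F1 l by simp
      fix y assume "y \<notin> insert 0 (inverse ` (F1 \<union> F'))"
      then have y: "y \<noteq> 0" "inverse y \<notin> F1" "inverse y \<notin> F'"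
        by (auto dest: imageI[of _ _ inverse])
      have "w (inverse y) * poly K' y = inverse y ^ d * poly G' y"
        using l(3) y by (metis inverse_inverse_eq)
      moreover have "w (inverse y) = inverse y ^ degree W * poly (reflect_poly W) y"
        using wW y poly_reflect_poly_nz[of y W] by (simp add: field_simps)
      ultimately have "inverse y ^ degree W * poly (reflect_poly W) y * poly K' y = inverse y ^ d * poly G' y"
        by simp
      then have "poly (reflect_poly W) y * poly K' y = y ^ degree W / y ^ d * poly G' y"
        using y by (simp add: field_simps)
      also have "y ^ degree W / y ^ d = y ^ (degree W - d)"
        using y c by (simp add: power_diff)
      finally show "poly (reflect_poly W * K') y = poly (monom 1 (degree W - d) * G') y"
        by (simp add: poly_monom)
    qed
    then have "poly (reflect_poly W) 0 * poly K' 0 = 0 ^ (degree W - d) * poly G' 0"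
      by (metis mult.left_neutral poly_monom poly_mult)
    moreover have "(0::complex) ^ (degree W - d) = 0" using c by (intro zero_power) auto
    ultimately have "W = 0" using l by simp
    then show False using c by simp
  qed
  then show ?thesis using F1 wW by blast
qed

section \<open>The completed curves\<close>

lemma lam_comp_pt [simp]: "lam (comp_pt p j a) = a"
  by (cases a) auto

lemma comp_pt_eq_iff: "comp_pt p j a = comp_pt p j b \<longleftrightarrow> a = b"
  by (metis lam_comp_pt)

lemma comp_pt_0 [simp]: "comp_pt p j (Num 0) = Over0 j"
  by simp

text \<open>The affine point of \<open>C\<^sub>j\<close> over \<open>b\<close>.\<close>

definition coords :: "(5 \<Rightarrow> complex poly) \<Rightarrow> 5 \<Rightarrow> complex \<Rightarrow> complex ^ 5" where
  "coords p j b = (\<chi> k. if k = 5 then b else if k = j then poly (p j) b else 0)"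

lemma comp_pt_Num: "b \<noteq> 0 \<Longrightarrow> comp_pt p j (Num b) = Aff (coords p j b)"
  by (simp add: coords_def)

(* From here on points are unfolded only through comp_pt_0 and comp_pt_Num. *)
declare comp_pt.simps(2) [simp del]

lemma coords_nth [simp]: "coords p j b $ 5 = b"
  "k \<noteq> 5 \<Longrightarrow> coords p j b $ k = (if k = j then poly (p j) b else 0)"
  by (simp_all add: coords_def)

lemma coords_in_affine: "b \<noteq> 0 \<Longrightarrow> coords p j b \<in> affine_curve p"
  by (auto simp: affine_curve_def)

lemma component_subset: "component p j \<subseteq> curve_pts p"
proof -
  have "comp_pt p j (Num b) \<in> curve_pts p" for b
    by (cases "b = 0") (auto simp: curve_pts_def comp_pt_Num coords_in_affine)
  moreover have "comp_pt p j Infty \<in> curve_pts p" by (simp add: curve_pts_def)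
  ultimately have "comp_pt p j a \<in> curve_pts p" for a by (cases a) auto
  then show ?thesis by (auto simp: component_def)
qed

lemma comp_pt_in [simp]: "comp_pt p j a \<in> curve_pts p"
  using component_subset unfolding component_def by blast

text \<open>The equations \<open>Z\<^sub>jZ\<^sub>k = 0\<close> leave at most one nonzero coordinate among the first four, and if
  it is \<open>Z\<^sub>j\<close>, then \<open>Z\<^sub>j = p\<^sub>j(Z\<^sub>5)\<close>.\<close>

lemma affine_curve_cases:
  assumes "Z \<in> affine_curve p"
  obtains j where "Z = coords p j (Z $ 5)"
proof (cases "\<exists>j. j \<noteq> 5 \<and> Z $ j \<noteq> 0")
  case True
  then obtain j where j: "j \<noteq> 5" "Z $ j \<noteq> 0" by blast
  have "Z $ j * (Z $ j - poly (p j) (Z $ 5)) = 0" "\<And>k. k \<noteq> 5 \<Longrightarrow> j \<noteq> k \<Longrightarrow> Z $ j * Z $ k = 0"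
    using assms j unfolding affine_curve_def by auto
  then have "Z = coords p j (Z $ 5)" using j by (auto simp: vec_eq_iff coords_def)
  then show ?thesis by (rule that)
next
  case False
  then have "Z = coords p 5 (Z $ 5)" by (auto simp: vec_eq_iff coords_def)
  then show ?thesis by (rule that)
qed

lemma curve_pts_cases:
  assumes "x \<in> curve_pts p"
  obtains j a where "x = comp_pt p j a"
proof -
  consider Z where "x = Aff Z" "Z \<in> affine_curve p" | j where "x = Over0 j" | j where "x = OverInf j"
    using assms by (auto simp: curve_pts_def)
  then show ?thesis
  proof cases
    case 1
    then obtain j where "Z = coords p j (Z $ 5)" by (auto elim: affine_curve_cases)
    moreover have "Z $ 5 \<noteq> 0" using 1 by (auto simp: affine_curve_def)
    ultimately have "x = comp_pt p j (Num (Z $ 5))" using 1 comp_pt_Num by metis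
    then show ?thesis by (rule that)
  next
    case 2
    then have "x = comp_pt p j (Num 0)" by simp
    then show ?thesis by (rule that)
  next
    case 3
    then have "x = comp_pt p j Infty" by simp
    then show ?thesis by (rule that)
  qed
qed

text \<open>Two components meet only where the coordinates \<open>Z\<^sub>j\<close> and \<open>Z\<^sub>k\<close> that distinguish them vanish.\<close>

lemma comp_pt_eq_diff:
  assumes "j \<noteq> k" "comp_pt p j a = comp_pt p k b"
  shows "\<exists>c. a = Num c \<and> c \<noteq> 0 \<and> (j \<noteq> 5 \<longrightarrow> poly (p j) c = 0) \<and> (k \<noteq> 5 \<longrightarrow> poly (p k) c = 0)"
proof -
  have ab: "a = b" using assms(2) by (metis lam_comp_pt)
  show ?thesis
  proof (cases a)
    case (Num c)
    have "c \<noteq> 0" using assms Num ab by (auto split: if_splits)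
    then have eq: "coords p j c = coords p k c" using assms(2) Num ab by (simp add: comp_pt_Num)
    have "poly (p j) c = 0" if "j \<noteq> 5"
      using arg_cong[OF eq, of "\<lambda>Z. Z $ j"] that assms(1) by simp
    moreover have "poly (p k) c = 0" if "k \<noteq> 5"
      using arg_cong[OF eq, of "\<lambda>Z. Z $ k"] that assms(1) by simp
    ultimately show ?thesis using Num \<open>c \<noteq> 0\<close> by blast
  qed (use assms ab in auto)
qed

lemma comp_pt_eq5:
  assumes "poly (p j) c = 0" "c \<noteq> 0"
  shows "comp_pt p j (Num c) = comp_pt p 5 (Num c)"
  using assms by (auto simp: vec_eq_iff comp_pt_Num coords_def)

abbreviation away :: "(5 \<Rightarrow> complex poly) \<Rightarrow> sphere_pt set \<Rightarrow> curve_pt set" where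
  "away p B \<equiv> {x \<in> curve_pts p. lam x \<notin> B}"

lemma zopen_lam:
  assumes "finite B"
  shows "zopen p (away p B)"
proof -
  have "component p j - (away p B) \<subseteq> comp_pt p j ` B" for j
    using component_subset by (auto simp: component_def)
  then have "finite (component p j - (away p B))" for j
    using assms finite_subset by blast
  then show ?thesis unfolding zopen_def by blast
qed

lemma zopen_minus_finite:
  assumes "zopen p U" "finite F" shows "zopen p (U - F)"
  unfolding zopen_def
proof (intro conjI allI)
  show "U - F \<subseteq> curve_pts p" using assms by (auto simp: zopen_def)
  fix j
  show "component p j \<inter> (U - F) = {} \<or> finite (component p j - (U - F))"
  proof (cases "component p j \<inter> U = {}")
    case False
    then have "finite (component p j - U)" using assms by (auto simp: zopen_def)
    then have "finite ((component p j - U) \<union> F)" using assms by simp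
    moreover have "component p j - (U - F) \<subseteq> (component p j - U) \<union> F" by auto
    ultimately show ?thesis by (meson finite_subset)
  qed auto
qed

lemma finite_comp_Int:
  assumes "j \<noteq> k" "j \<noteq> 5 \<Longrightarrow> p j \<noteq> 0" "k \<noteq> 5 \<Longrightarrow> p k \<noteq> 0"
  shows "finite (component p j \<inter> component p k)"
proof -
  define i where "i = (if j = 5 then k else j)"
  have i: "i \<noteq> 5" "p i \<noteq> 0" using assms by (auto simp: i_def)
  have "component p j \<inter> component p k \<subseteq> comp_pt p j ` (Num ` {c. poly (p i) c = 0})"
  proof
    fix x assume "x \<in> component p j \<inter> component p k"
    then obtain a b where ab: "x = comp_pt p j a" "x = comp_pt p k b"
      unfolding component_def by blast
    then obtain c where "a = Num c" "poly (p i) c = 0"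
      using comp_pt_eq_diff[OF assms(1), of p a b] assms(1) by (auto simp: i_def split: if_splits)
    then show "x \<in> comp_pt p j ` (Num ` {c. poly (p i) c = 0})" using ab by blast
  qed
  moreover have "finite (comp_pt p j ` (Num ` {c. poly (p i) c = 0}))"
    using i poly_roots_finite by blast
  ultimately show ?thesis by (rule finite_subset)
qed

text \<open>Off \<open>C\<^sub>j\<close> a function supported on \<open>C\<^sub>j\<close> is constant, and on \<open>C\<^sub>j\<close> without the other components
  a function has a single formula in \<open>\<lambda>\<close>. The openness of these two sets reduces the local
  conditions for such functions to one component.\<close>

lemma zopen_compl_component:
  assumes "\<And>k. k \<noteq> 5 \<Longrightarrow> p k \<noteq> 0"
  shows "zopen p (curve_pts p - component p j)"
  unfolding zopen_def
proof (intro conjI allI)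
  fix k
  show "component p k \<inter> (curve_pts p - component p j) = {} \<or>
        finite (component p k - (curve_pts p - component p j))"
  proof (cases "k = j")
    case False
    have "component p k - (curve_pts p - component p j) \<subseteq> component p k \<inter> component p j"
      using component_subset by auto
    then show ?thesis using finite_comp_Int[OF False] assms by (meson finite_subset)
  qed auto
qed auto

lemma zopen_only_component:
  assumes "\<And>k. k \<noteq> 5 \<Longrightarrow> p k \<noteq> 0"
  shows "zopen p (component p j - (\<Union>k\<in>-{j}. component p k))" (is "zopen p ?U")
  unfolding zopen_def
proof (intro conjI allI)
  show "?U \<subseteq> curve_pts p" using component_subset by auto
  fix k
  show "component p k \<inter> ?U = {} \<or> finite (component p k - ?U)"
  proof (cases "k = j")
    case True
    have "component p k - ?U \<subseteq> (\<Union>i\<in>-{j}. component p j \<inter> component p i)"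
      using True by auto
    moreover have "finite (\<Union>i\<in>-{j}. component p j \<inter> component p i)"
      using assms by (intro finite_UN_I finite_comp_Int) auto
    ultimately show ?thesis by (meson finite_subset)
  qed auto
qed

text \<open>This turns regularity on the curve, which speaks of the ambient coordinates, into a
  condition on rational functions of \<open>\<lambda>\<close> along each component.\<close>

lemma polyfuns_on_component:
  assumes "g \<in> polyfuns"
  shows "\<exists>G. \<forall>b. g (coords p j b) = poly G b"
  using assms
proof induction
  case (const c)
  show ?case by (rule exI[of _ "[:c:]"]) simp
next
  case (coord i)
  show ?case
    by (rule exI[of _ "if i = 5 then [:0, 1:] else if i = j then p j else 0"]) (auto simp: coords_def)
next
  case (add g h)
  then obtain G H where "\<forall>b. g (coords p j b) = poly G b" "\<forall>b. h (coords p j b) = poly H b" by blast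
  then show ?case by (intro exI[of _ "G + H"]) simp
next
  case (mult g h)
  then obtain G H where "\<forall>b. g (coords p j b) = poly G b" "\<forall>b. h (coords p j b) = poly H b" by blast
  then show ?case by (intro exI[of _ "G * H"]) simp
qed

lemma zopen_cofinite_on_component:
  assumes "zopen p V" "comp_pt p j a \<in> V"
  shows "finite {b. comp_pt p j (Num b) \<notin> V}"
proof -
  have "finite (component p j - V)" using assms unfolding zopen_def component_def by blast
  moreover have "comp_pt p j ` Num ` {b. comp_pt p j (Num b) \<notin> V} \<subseteq> component p j - V"
    by (auto simp: component_def)
  ultimately have "finite (comp_pt p j ` Num ` {b. comp_pt p j (Num b) \<notin> V})"
    by (meson finite_subset)
  then have "finite (Num ` {b. comp_pt p j (Num b) \<notin> V})"
    by (rule finite_imageD) (auto simp: inj_on_def comp_pt_eq_iff)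
  then show ?thesis by (rule finite_imageD) (auto simp: inj_on_def)
qed

text \<open>A neighbourhood of a point of \<open>C\<^sub>j\<close> contains all but finitely many points of \<open>C\<^sub>j\<close>, so a
  local condition at one point yields a formula in the global coordinate \<open>\<lambda>\<close> that holds on
  almost all of the component.\<close>

lemma rational_near_Num:
  assumes "rational_near p (comp_pt p j (Num a)) A h"
  shows "\<exists>G K F. finite F \<and> a \<notin> F \<and> poly K a \<noteq> 0 \<and>
    (\<forall>b. b \<notin> F \<longrightarrow> comp_pt p j (Num b) \<notin> A \<longrightarrow> h (comp_pt p j (Num b)) * poly K b = poly G b)"
proof -
  obtain V g k where V: "zopen p V" "comp_pt p j (Num a) \<in> V" "poly k 0 \<noteq> 0"
    and *: "\<And>y. y \<in> V - A \<Longrightarrow> poly k (loc_coord (comp_pt p j (Num a)) y) \<noteq> 0 \<and>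
       h y = poly g (loc_coord (comp_pt p j (Num a)) y) / poly k (loc_coord (comp_pt p j (Num a)) y)"
    using assms unfolding rational_near_def by blast
  define F where "F = {b. comp_pt p j (Num b) \<notin> V}"
  have "h (comp_pt p j (Num b)) * poly (pcompose k [:-a, 1:]) b = poly (pcompose g [:-a, 1:]) b"
    if "b \<notin> F" "comp_pt p j (Num b) \<notin> A" for b
    using *[of "comp_pt p j (Num b)"] that
    by (auto simp: F_def loc_coord_def poly_pcompose)
  moreover have "poly (pcompose k [:-a, 1:]) a \<noteq> 0" using V(3) by (simp add: poly_pcompose)
  moreover have "finite F" unfolding F_def using V zopen_cofinite_on_component by blast
  moreover have "a \<notin> F" using V by (simp add: F_def)
  ultimately show ?thesis by blast
qed

lemma rational_near_Infty:
  assumes "rational_near p (comp_pt p j Infty) A h"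
  shows "\<exists>G K F. finite F \<and> poly K 0 \<noteq> 0 \<and>
    (\<forall>b. b \<notin> F \<longrightarrow> comp_pt p j (Num b) \<notin> A \<longrightarrow>
       h (comp_pt p j (Num b)) * poly K (inverse b) = poly G (inverse b))"
proof -
  obtain V g k where V: "zopen p V" "comp_pt p j Infty \<in> V" "poly k 0 \<noteq> 0"
    and *: "\<And>y. y \<in> V - A \<Longrightarrow> poly k (loc_coord (comp_pt p j Infty) y) \<noteq> 0 \<and>
       h y = poly g (loc_coord (comp_pt p j Infty) y) / poly k (loc_coord (comp_pt p j Infty) y)"
    using assms unfolding rational_near_def by blast
  define F where "F = {b. comp_pt p j (Num b) \<notin> V}"
  have "h (comp_pt p j (Num b)) * poly k (inverse b) = poly g (inverse b)"
    if "b \<notin> F" "comp_pt p j (Num b) \<notin> A" for b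
    using *[of "comp_pt p j (Num b)"] that
    by (auto simp: F_def loc_coord_def inverse_eq_divide)
  moreover have "finite F" unfolding F_def using V zopen_cofinite_on_component by blast
  ultimately show ?thesis using V by blast
qed

lemma regular_at_Num:
  assumes "regular_at p h (comp_pt p j (Num a))"
  shows "\<exists>G K F. finite F \<and> a \<notin> F \<and> poly K a \<noteq> 0 \<and>
    (\<forall>b. b \<notin> F \<longrightarrow> h (comp_pt p j (Num b)) * poly K b = poly G b)"
proof (cases "a = 0")
  case True
  then have "rational_near p (comp_pt p j (Num a)) {} h"
    using assms by (simp add: regular_at_def)
  from rational_near_Num[OF this] show ?thesis by auto
next
  case False
  then have x: "comp_pt p j (Num a) = Aff (coords p j a)" by (rule comp_pt_Num)
  obtain V g k where V: "zopen p V" "Aff (coords p j a) \<in> V" "g \<in> polyfuns" "k \<in> polyfuns"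
    and *: "\<And>W. Aff W \<in> V \<Longrightarrow> k W \<noteq> 0 \<and> h (Aff W) = g W / k W"
    using assms unfolding x regular_at_def by auto
  obtain G K where GK: "\<And>b. g (coords p j b) = poly G b" "\<And>b. k (coords p j b) = poly K b"
    using V polyfuns_on_component by metis
  define F where "F = insert 0 {b. comp_pt p j (Num b) \<notin> V}"
  have "h (comp_pt p j (Num b)) * poly K b = poly G b" if "b \<notin> F" for b
    using that *[of "coords p j b"] GK by (auto simp: F_def comp_pt_Num)
  moreover have "poly K a \<noteq> 0" using * V(2) GK by metis
  moreover have "finite F" unfolding F_def using V zopen_cofinite_on_component x by (metis finite_insert)
  moreover have "a \<notin> F" using V x False by (simp add: F_def)
  ultimately show ?thesis by blast
qed

lemma regular_at_Infty:
  assumes "regular_at p h (comp_pt p j Infty)"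
  shows "\<exists>G K F. finite F \<and> poly K 0 \<noteq> 0 \<and>
    (\<forall>b. b \<notin> F \<longrightarrow> h (comp_pt p j (Num b)) * poly K (inverse b) = poly G (inverse b))"
  using rational_near_Infty[of p j "{}" h] assms by (simp add: regular_at_def)

section \<open>Divisors on the Riemann sphere and on the curves\<close>

fun linear_factor :: "sphere_pt \<Rightarrow> complex poly" where
  "linear_factor (Num a) = [:- a, 1:]"
| "linear_factor Infty = 1"

text \<open>The monic polynomial of the finite part of a divisor on the Riemann sphere; the point at
  infinity contributes the factor \<open>1\<close>.\<close>

definition div_poly :: "sphere_pt multiset \<Rightarrow> complex poly" where
  "div_poly M = prod_mset (image_mset linear_factor M)"

lemma div_poly_empty [simp]: "div_poly {#} = 1" by (simp add: div_poly_def)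
lemma div_poly_add [simp]: "div_poly (add_mset a M) = linear_factor a * div_poly M"
  by (simp add: div_poly_def)
lemma div_poly_union [simp]: "div_poly (M + N) = div_poly M * div_poly N"
  by (simp add: div_poly_def)

lemma linear_factor_nz [simp]: "linear_factor a \<noteq> 0"
  by (cases a) auto

lemma div_poly_nz [simp]: "div_poly M \<noteq> 0"
  by (induction M) auto

lemma lead_coeff_div_poly: "lead_coeff (div_poly M) = 1"
proof (induction M)
  case (add a M)
  have "lead_coeff (linear_factor a) = 1" by (cases a) auto
  then show ?case using add by (simp only: div_poly_add lead_coeff_mult mult_1)
qed simp

lemma order_div_poly: "order a (div_poly M) = count M (Num a)"
proof (induction M)
  case (add b M)
  have "order a (linear_factor b) = (if b = Num a then 1 else 0)"
  proof (cases b)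
    case (Num c)
    then show ?thesis using order_power_n_n[of a 1] by (cases "c = a") (auto intro: order_0I)
  qed auto
  moreover have "order a (div_poly (add_mset b M)) = order a (linear_factor b) + order a (div_poly M)"
    unfolding div_poly_add by (rule order_mult) simp
  ultimately show ?case using add by simp
qed simp

lemma poly_div_poly_eq_0_iff: "poly (div_poly M) a = 0 \<longleftrightarrow> Num a \<in># M"
  using order_root[of "div_poly M" a] order_div_poly[of a M] by (simp add: count_eq_zero_iff)

lemma degree_div_poly: "degree (div_poly M) + count M Infty = size M"
proof (induction M)
  case (add b M)
  have "degree (div_poly (add_mset b M)) = degree (linear_factor b) + degree (div_poly M)"
    by (simp add: degree_mult_eq)
  then show ?case using add by (cases b) auto
qed simp

lemma div_poly_mset_set: "finite S \<Longrightarrow> div_poly (mset_set (Num ` S)) = root_poly S"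
proof -
  assume "finite S"
  have "mset_set (Num ` S) = image_mset Num (mset_set S)"
    by (subst image_mset_mset_set) (auto simp: inj_on_def)
  then have "div_poly (mset_set (Num ` S)) = prod_mset (image_mset (\<lambda>s. [:-s, 1:]) (mset_set S))"
    by (simp add: div_poly_def multiset.map_comp comp_def)
  then show ?thesis by (simp add: root_poly_def prod_unfold_prod_mset)
qed

text \<open>Over the complex numbers a polynomial is its leading coefficient times the product of its
  linear factors.\<close>

lemma poly_eq_smult_of_same_order:
  fixes p q :: "complex poly"
  assumes "p \<noteq> 0" "q \<noteq> 0" "\<And>a. order a p = order a q"
  shows "\<exists>c. c \<noteq> 0 \<and> p = smult c q"
proof -
  define R where "R = (\<lambda>p :: complex poly. \<Prod>z|poly p z = 0. [:-z, 1:] ^ order z p)"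
  have "{z. poly p z = 0} = {z. poly q z = 0}"
    using assms by (auto simp: order_root)
  then have "R p = R q" unfolding R_def using assms by simp
  moreover have "p = smult (lead_coeff p) (R p)" "q = smult (lead_coeff q) (R q)"
    unfolding R_def using complex_poly_decompose by metis+
  ultimately have "p = smult (lead_coeff p / lead_coeff q) q"
    using assms(2) by (metis nonzero_divide_eq_eq leading_coeff_0_iff smult_smult)
  moreover have "lead_coeff p / lead_coeff q \<noteq> 0" using assms by simp
  ultimately show ?thesis by blast
qed

text \<open>The orders at the finite points fix the polynomial up to a scalar, and the multiplicity at
  infinity is what is left of the total degree \<open>n\<close>.\<close>

lemma zero_divisor_iff:
  "zero_divisor n q E \<longleftrightarrow> (\<exists>c. c \<noteq> 0 \<and> q = smult c (div_poly E)) \<and> size E = n"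
proof
  assume z: "zero_divisor n q E"
  then have "\<exists>c. c \<noteq> 0 \<and> q = smult c (div_poly E)"
    by (intro poly_eq_smult_of_same_order) (auto simp: zero_divisor_def order_div_poly)
  then obtain c where c: "c \<noteq> 0" "q = smult c (div_poly E)" by blast
  then have "degree q = degree (div_poly E)" by simp
  then have "size E = n"
    using z degree_div_poly[of E] by (auto simp: zero_divisor_def)
  then show "(\<exists>c. c \<noteq> 0 \<and> q = smult c (div_poly E)) \<and> size E = n" using c by blast
next
  assume "(\<exists>c. c \<noteq> 0 \<and> q = smult c (div_poly E)) \<and> size E = n"
  then obtain c where c: "c \<noteq> 0" "q = smult c (div_poly E)" "size E = n" by blast
  then show "zero_divisor n q E"
    using degree_div_poly[of E] by (auto simp: zero_divisor_def order_div_poly order_smult)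
qed

lemma eq_of_div_poly_smult:
  assumes "smult c (div_poly E) = smult d (div_poly E')" "c \<noteq> 0" "d \<noteq> 0" "size E = size E'"
  shows "E = E'"
proof (rule multiset_eqI)
  fix x
  have o: "order a (div_poly E) = order a (div_poly E')" for a
    using assms by (metis order_smult)
  have d: "degree (div_poly E) = degree (div_poly E')"
    using assms by (metis degree_smult_eq)
  show "count E x = count E' x"
  proof (cases x)
    case (Num a)
    then show ?thesis using o by (simp add: order_div_poly)
  next
    case Infty
    then show ?thesis using d degree_div_poly[of E] degree_div_poly[of E'] assms by simp
  qed
qed

text \<open>The divisor \<open>E'\<close>, and the set \<open>\<SS>\<^sub>1\<close> over which \<open>C\<^sub>1\<close> still meets \<open>C\<^sub>5\<close> on the partial
  desingularisation.\<close>

definition reduced_div :: "complex set \<Rightarrow> sphere_pt multiset \<Rightarrow> sphere_pt multiset" where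
  "reduced_div S E = E - mset_set (Num ` S \<inter> set_mset E)"

definition free_pts :: "complex set \<Rightarrow> sphere_pt multiset \<Rightarrow> complex set" where
  "free_pts S E = {s \<in> S. Num s \<notin># E}"

lemma free_pts_subset: "free_pts S E \<subseteq> S" by (auto simp: free_pts_def)

lemma reduced_div_split:
  assumes "finite S"
  shows "E = reduced_div S E + mset_set (Num ` (S - free_pts S E))"
proof -
  have "Num ` S \<inter> set_mset E = Num ` (S - free_pts S E)" by (auto simp: free_pts_def)
  moreover have "mset_set (Num ` S \<inter> set_mset E) \<subseteq># E"
    using assms by (intro mset_subset_eqI) (auto simp: count_mset_set' Suc_le_eq)
  ultimately show ?thesis unfolding reduced_div_def by simp
qed

lemma size_reduced_div:
  assumes "finite S" "size E = card S - 1"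
  shows "Suc (size (reduced_div S E)) = card (free_pts S E) \<or> S = {}"
proof (cases "S = {}")
  case False
  have "size E = size (reduced_div S E) + card (S - free_pts S E)"
    using arg_cong[OF reduced_div_split[OF assms(1), of E], of size]
    by (simp add: card_image inj_on_def)
  moreover have "card (S - free_pts S E) = card S - card (free_pts S E)"
    using assms free_pts_subset by (meson card_Diff_subset finite_subset)
  moreover have "card (free_pts S E) \<le> card S" using assms free_pts_subset by (meson card_mono)
  moreover have "card S > 0" using False assms by (simp add: card_gt_0_iff)
  ultimately show ?thesis using assms by linarith
qed auto

text \<open>The points of \<open>S\<close> removed from \<open>E\<close> are those at which the curve is desingularised. Hence
  \<open>Q\<^sub>E\<close> and \<open>p\<close> differ from the polynomials of \<open>E'\<close> and \<open>\<SS>\<^sub>1\<close> by the same factor, and the quotient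
  \<open>p/Q\<^sub>E\<close> is \<open>p\<^sub>1/q\<^sub>1\<close>.\<close>

lemma div_poly_reduced:
  assumes "finite S"
  shows "div_poly E = div_poly (reduced_div S E) * root_poly (S - free_pts S E)"
  using arg_cong[OF reduced_div_split[OF assms, of E], of div_poly] assms
  by (simp add: div_poly_mset_set)

lemma reduced_div_avoids: "x \<in># reduced_div S E \<Longrightarrow> x \<notin> Num ` free_pts S E"
  by (auto simp: reduced_div_def free_pts_def dest: in_diffD)

lemma S_part_eq: "S_part \<beta>0 \<Delta> E j =
  (if j = 1 \<or> j = 3 then free_pts (spec_pts \<beta>0 \<Delta>) E else uminus ` free_pts (spec_pts \<beta>0 \<Delta>) E)"
  by (simp add: S_part_def free_pts_def)

text \<open>The divisor \<open>D\<^sub>E\<close> as pairs of a component and a value of \<open>\<lambda>\<close>, before the pairs are placed on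
  the curve, where pairs over an intersection point coincide.\<close>

definition frame_divisor :: "complex set \<Rightarrow> sphere_pt multiset \<Rightarrow> (5 \<times> sphere_pt) multiset" where
  "frame_divisor S E = (let F = image_mset (Pair 1) (reduced_div S E) in
     F + image_mset rho F + image_mset tau F + image_mset (rho \<circ> tau) F
            + {#(1, Num 0), (2, Num 0), (3, Num 0), (4, Num 0)#})"

lemma D_divisor_eq: "D_divisor \<beta>0 \<Delta> E =
  image_mset (\<lambda>(j, a). comp_pt (XE_poly \<beta>0 \<Delta> E) j a) (frame_divisor (spec_pts \<beta>0 \<Delta>) E)"
  by (simp add: D_divisor_def frame_divisor_def reduced_div_def Let_def)

text \<open>A point of \<open>E'\<close> over \<open>\<SS>\<^sub>1\<close> would lie in the support of \<open>E\<close>. The involution \<open>\<rho>\<close> fixes the unit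
  circle, hence \<open>\<SS>\<^sub>1\<close>, pointwise, and \<open>\<tau>\<close> maps \<open>\<SS>\<^sub>1\<close> to \<open>\<SS>\<^sub>2 = -\<SS>\<^sub>1\<close>. So \<open>D\<^sub>E\<close> consists of smooth points
  of \<open>X\<^sub>E\<close>, at which a pair is determined by its point.\<close>

lemma frame_divisor_smooth:
  assumes S: "S \<subseteq> {s. cmod s = 1}" and S': "S' = free_pts S E"
    and x: "(j, a) \<in># frame_divisor S E"
  shows "j \<noteq> 5" "a \<notin> Num ` (if j = 1 \<or> j = 3 then S' else uminus ` S')"
proof -
  have unit: "cmod s = 1" "s \<noteq> 0" "inverse (cnj s) = s" if "s \<in> S'" for s
  proof -
    show 1: "cmod s = 1" using S S' free_pts_subset that by blast
    then show "s \<noteq> 0" by auto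
    have "s * cnj s = 1" using 1 by (simp add: complex_norm_square[symmetric])
    then show "inverse (cnj s) = s" by (metis inverse_unique mult.commute)
  qed
  have inv: "b \<in> S'" if "inverse (cnj b) = s" "s \<in> S'" for b s
    using unit[OF that(2)] that by (metis complex_cnj_cnj complex_cnj_inverse inverse_inverse_eq)
  have zero: "0 \<notin> S'" using unit by blast
  have av: "b \<in># reduced_div S E \<Longrightarrow> b \<notin> Num ` S'" for b using reduced_div_avoids S' by blast
  consider (one) "j = 1" "a \<in># reduced_div S E"
    | (rho) b where "(j, a) = rho (1, b)" "b \<in># reduced_div S E"
    | (tau) b where "(j, a) = tau (1, b)" "b \<in># reduced_div S E"
    | (rhotau) b where "(j, a) = rho (tau (1, b))" "b \<in># reduced_div S E"
    | (zero) "j = 1 \<or> j = 2 \<or> j = 3 \<or> j = 4" "a = Num 0"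
    using x unfolding frame_divisor_def Let_def by auto
  then have "j \<noteq> 5 \<and> a \<notin> Num ` (if j = 1 \<or> j = 3 then S' else uminus ` S')"
  proof cases
    case one
    then show ?thesis using av by auto
  next
    case rho
    then have "j = 3" by simp
    moreover have "a \<notin> Num ` S'"
      using rho av[of b] inv zero by (cases b) (auto split: if_splits)
    ultimately show ?thesis by simp
  next
    case tau
    then have "j = 4" by simp
    moreover have "a \<notin> Num ` (uminus ` S')"
      using tau av[of b] by (cases b) auto
    ultimately show ?thesis by simp
  next
    case rhotau
    then have "j = 2" by simp
    moreover have "a \<notin> Num ` (uminus ` S')"
      using rhotau av[of b] inv zero by (cases b) (auto split: if_splits)
    ultimately show ?thesis by simp
  next
    case zero
    then show ?thesis using \<open>0 \<notin> S'\<close> by auto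
  qed
  then show "j \<noteq> 5" "a \<notin> Num ` (if j = 1 \<or> j = 3 then S' else uminus ` S')" by auto
qed

lemma count_frame_divisor_1:
  "count (frame_divisor S E) (1, a) = count (reduced_div S E) a + (if a = Num 0 then 1 else 0)"
proof -
  define F where "F = image_mset (Pair (1::5)) (reduced_div S E)"
  have "count (image_mset (Pair (1::5)) M) (1, a) = count M a" for M
    by (induction M) auto
  then have 1: "count F (1, a) = count (reduced_div S E) a" unfolding F_def by blast
  have z: "(1, a) \<notin># image_mset rho F" "(1, a) \<notin># image_mset tau F" "(1, a) \<notin># image_mset (rho \<circ> tau) F"
    unfolding F_def by auto
  show ?thesis using 1 z unfolding frame_divisor_def Let_def F_def[symmetric]
    by (auto simp: count_eq_zero_iff not_in_iff)
qed

section \<open>Global sections of the direct image\<close>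

lemma regular_at_AffI:
  assumes "zopen p V" "Aff Z \<in> V" "g \<in> polyfuns" "k \<in> polyfuns"
    and "\<And>W. Aff W \<in> V \<Longrightarrow> k W \<noteq> 0 \<and> h (Aff W) = g W / k W"
  shows "regular_at p h (Aff Z)"
  unfolding regular_at_def curve_pt.case using assms by blast

text \<open>Near every point the section \<open>1\<close> and, off \<open>C\<^sub>1\<close>, the section built below are constant; at a
  point of the divisor the power of the local coordinate is then itself a polynomial.\<close>

lemma regular_at_const:
  assumes "zopen p V" "x \<in> V" "\<And>y. y \<in> V \<Longrightarrow> h y = c"
  shows "regular_at p h x"
proof (cases x)
  case (Aff Z)
  have "\<exists>V. \<exists>g\<in>polyfuns. \<exists>k\<in>polyfuns. zopen p V \<and> Aff Z \<in> V \<and>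
      (\<forall>W. Aff W \<in> V \<longrightarrow> k W \<noteq> 0 \<and> h (Aff W) = g W / k W)"
    using assms Aff
    by (intro exI[of _ V] bexI[of _ "\<lambda>_. c"] bexI[of _ "\<lambda>_. 1"]) (auto intro: polyfuns.const)
  then show ?thesis using Aff by (simp add: regular_at_def)
next
  case (Over0 j)
  have "rational_near p x {} h" unfolding rational_near_def
    by (intro exI[of _ V] exI[of _ "[:c:]"] exI[of _ "1"]) (use assms in auto)
  then show ?thesis using Over0 by (simp add: regular_at_def)
next
  case (OverInf j)
  have "rational_near p x {} h" unfolding rational_near_def
    by (intro exI[of _ V] exI[of _ "[:c:]"] exI[of _ "1"]) (use assms in auto)
  then show ?thesis using OverInf by (simp add: regular_at_def)
qed

lemma rational_near_const_pole:
  assumes "zopen p V" "x \<in> V" "\<And>y. y \<in> V - {x} \<Longrightarrow> h y = c"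
  shows "rational_near p x {x} (\<lambda>y. loc_coord x y ^ m * h y)"
  unfolding rational_near_def
  by (intro exI[of _ V] exI[of _ "monom c m"] exI[of _ "1"]) (use assms in \<open>auto simp: poly_monom\<close>)

lemma polyfuns_poly: "(\<lambda>Z. poly q (Z $ 5)) \<in> polyfuns"
proof (induction q)
  case 0
  show ?case using polyfuns.const[of 0] by simp
next
  case (pCons a q)
  have "(\<lambda>Z. a + Z $ 5 * poly q (Z $ 5)) \<in> polyfuns"
    by (intro polyfuns.intros pCons)
  then show ?case by simp
qed

text \<open>The function that is \<open>p\<^sub>1/(\<lambda>q)\<close> on \<open>C\<^sub>1\<close> and \<open>0\<close> on the other components, written with the
  coordinate \<open>Z\<^sub>1\<close>, which is \<open>p\<^sub>1\<close> on \<open>C\<^sub>1\<close> and vanishes elsewhere. The value \<open>1\<close> at the point of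
  \<open>C\<^sub>1\<close> over infinity is the limit when that point is outside the divisor, since numerator and
  denominator are then monic of the same degree.\<close>

definition component_bump :: "complex poly \<Rightarrow> curve_pt \<Rightarrow> complex" where
  "component_bump q y = (case y of Aff Z \<Rightarrow> Z $ 1 / (Z $ 5 * poly q (Z $ 5))
     | Over0 j \<Rightarrow> 0 | OverInf j \<Rightarrow> if j = 1 then 1 else 0)"

lemma component_bump_other: "j \<noteq> 1 \<Longrightarrow> component_bump q (comp_pt p j a) = 0"
proof (cases a)
  case (Num b)
  assume "j \<noteq> 1"
  then show ?thesis using Num
    by (cases "b = 0") (auto simp: component_bump_def comp_pt_Num)
qed (auto simp: component_bump_def)

lemma component_bump_off:
  "y \<in> curve_pts p \<Longrightarrow> y \<notin> component p 1 \<Longrightarrow> component_bump q y = 0"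
  by (metis component_bump_other component_def curve_pts_cases rangeI)

lemma poly_via_reflect:
  fixes P :: "complex poly"
  shows "b \<noteq> 0 \<Longrightarrow> poly P b = b ^ degree P * poly (reflect_poly P) (inverse b)"
  by (simp add: poly_reflect_poly_nz power_inverse)

lemma component_bump_1:
  "b \<noteq> 0 \<Longrightarrow> component_bump q (comp_pt p 1 (Num b)) = poly (p 1) b / (b * poly q b)"
  by (simp add: component_bump_def comp_pt_Num)

locale unit_divisor =
  fixes \<beta>0 :: complex and \<Delta> :: "complex set" and E :: "sphere_pt multiset"
  assumes finite_S: "finite (spec_pts \<beta>0 \<Delta>)" and S_nonempty: "spec_pts \<beta>0 \<Delta> \<noteq> {}"
    and S_unit: "spec_pts \<beta>0 \<Delta> \<subseteq> {s. cmod s = 1}"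
    and S_symmetric: "uminus ` spec_pts \<beta>0 \<Delta> = spec_pts \<beta>0 \<Delta>"
    and size_E: "size E = card (spec_pts \<beta>0 \<Delta>) - 1"
begin

abbreviation "S \<equiv> spec_pts \<beta>0 \<Delta>"
abbreviation "S1 \<equiv> free_pts S E"
abbreviation "p \<equiv> XE_poly \<beta>0 \<Delta> E"
abbreviation "D \<equiv> D_divisor \<beta>0 \<Delta> E"
abbreviation "E' \<equiv> reduced_div S E"
abbreviation "q1 \<equiv> div_poly E'"

definition "den = [:0, 1:] * q1"

lemma S_nz: "s \<in> S \<Longrightarrow> s \<noteq> 0" using S_unit by force

lemma finite_S1: "finite S1" using finite_S free_pts_subset by (meson finite_subset)

lemma finite_S_part: "finite (S_part \<beta>0 \<Delta> E j)"
  using finite_S1 by (simp add: S_part_eq)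

lemma S_part_subset: "S_part \<beta>0 \<Delta> E j \<subseteq> S"
  using S_symmetric free_pts_subset[of S E] unfolding S_part_eq by auto

lemma p_eq_0_iff: "poly (p j) c = 0 \<longleftrightarrow> c \<in> S_part \<beta>0 \<Delta> E j"
  by (simp add: XE_poly_def poly_root_poly_eq_0_iff finite_S_part)

lemma p_nz [simp]: "p k \<noteq> 0" by (simp add: XE_poly_def)

lemma p_1: "p 1 = root_poly S1" by (simp add: XE_poly_def S_part_eq)

lemma D_cases:
  assumes "x \<in># D"
  obtains j a where "x = comp_pt p j a" "(j, a) \<in># frame_divisor S E" "j \<noteq> 5"
    "a \<notin> Num ` S_part \<beta>0 \<Delta> E j"
proof -
  obtain j a where ja: "x = comp_pt p j a" "(j, a) \<in># frame_divisor S E"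
    using assms by (auto simp: D_divisor_eq)
  show ?thesis using that[OF ja] frame_divisor_smooth[OF S_unit refl ja(2)] by (simp add: S_part_eq)
qed

lemma smooth_pt_unique:
  assumes "j \<noteq> 5" "a \<notin> Num ` S_part \<beta>0 \<Delta> E j" "comp_pt p j a = comp_pt p k b"
  shows "j = k \<and> a = b"
proof -
  have "j = k"
  proof (rule ccontr)
    assume "j \<noteq> k"
    from comp_pt_eq_diff[OF this assms(3)] assms(1) obtain c where "a = Num c" "poly (p j) c = 0" by blast
    then show False using assms(2) by (auto simp: p_eq_0_iff)
  qed
  then show ?thesis using assms(3) by (simp add: comp_pt_eq_iff)
qed

lemma D_not_5: "comp_pt p 5 a \<notin># D"
proof
  assume "comp_pt p 5 a \<in># D"
  then show False by (elim D_cases) (metis smooth_pt_unique)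
qed

lemma D_1: "comp_pt p 1 a \<in># D \<Longrightarrow> a \<notin> Num ` S1"
proof -
  assume "comp_pt p 1 a \<in># D"
  then obtain j b where *: "comp_pt p 1 a = comp_pt p j b" "j \<noteq> 5" "b \<notin> Num ` S_part \<beta>0 \<Delta> E j"
    by (elim D_cases)
  then have "j = 1 \<and> b = a" using smooth_pt_unique by metis
  then show ?thesis using * by (simp add: S_part_eq)
qed

text \<open>The involutions move \<open>E'\<close> off \<open>C\<^sub>1\<close>, so the part of \<open>D\<^sub>E\<close> on \<open>C\<^sub>1\<close> is \<open>E' + P\<^sub>1\<close>.\<close>

lemma count_D_1:
  assumes "a \<notin> Num ` S1"
  shows "count D (comp_pt p 1 a) = count E' a + (if a = Num 0 then 1 else 0)"
proof -
  define M where "M = frame_divisor S E"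
  have "(\<lambda>(j, a). comp_pt p j a) -` {comp_pt p 1 a} \<inter> set_mset M = {(1, a)} \<inter> set_mset M"
  proof -
    have "j = 1 \<and> b = a" if "comp_pt p j b = comp_pt p 1 a" for j b
      using smooth_pt_unique[of 1 a j b] that assms by (simp add: S_part_eq)
    then show ?thesis by auto
  qed
  then have "count D (comp_pt p 1 a) = (\<Sum>y\<in>{(1, a)} \<inter> set_mset M. count M y)"
    unfolding D_divisor_eq count_image_mset M_def by simp
  also have "\<dots> = count M (1, a)"
    by (cases "(1, a) \<in># M") (auto simp: not_in_iff)
  finally show ?thesis unfolding M_def count_frame_divisor_1 .
qed

lemma den_nz [simp]: "den \<noteq> 0"
  by (simp add: den_def del: mult_pCons_left)

lemma order_den: "order a den = count E' (Num a) + (if a = 0 then 1 else 0)"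
proof -
  have "order a [:0, 1::complex:] = (if a = 0 then 1 else 0)"
    using order_power_n_n[of 0 1] by (cases "a = 0") (auto intro: order_0I)
  moreover have "order a den = order a [:0, 1:] + order a q1"
    unfolding den_def by (rule order_mult) (simp del: mult_pCons_left)
  ultimately show ?thesis by (simp add: order_div_poly)
qed

lemma degree_den: "degree den + count E' Infty = card S1"
proof -
  have "degree den = degree [:0, 1::complex:] + degree q1"
    unfolding den_def by (rule degree_mult_eq) auto
  then have "degree den = Suc (degree q1)" by simp
  then show ?thesis
    using degree_div_poly[of E'] size_reduced_div[OF finite_S size_E] S_nonempty by simp
qed

lemma lead_coeff_den: "lead_coeff den = 1"
  unfolding den_def lead_coeff_mult by (simp add: lead_coeff_div_poly)

lemma poly_den: "poly den b = b * poly q1 b" by (simp add: den_def)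

lemma count_D_1_Num: "a \<notin> S1 \<Longrightarrow> count D (comp_pt p 1 (Num a)) = order a den"
  by (subst count_D_1) (auto simp: order_den)

lemma zopen_whole: "zopen p (curve_pts p)"
  using zopen_lam[of "{}" p] by simp

lemma one_section: "restrict (\<lambda>_. 1) (curve_pts p - set_mset D) \<in> div_sections p D (curve_pts p)"
  (is "?h \<in> _")
proof -
  have "regular_at p ?h x" if "x \<in> curve_pts p - set_mset D" for x
    using that
    by (intro regular_at_const[of p "curve_pts p - set_mset D" x ?h 1] zopen_minus_finite zopen_whole) auto
  moreover have "rational_near p x {x} (\<lambda>y. loc_coord x y ^ count D x * ?h y)"
    if "x \<in> curve_pts p \<inter> set_mset D" for x
    using that
    by (intro rational_near_const_pole[of p "curve_pts p - (set_mset D - {x})" x ?h 1]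
        zopen_minus_finite zopen_whole) auto
  ultimately show ?thesis by (simp add: div_sections_def)
qed

text \<open>The zeros of \<open>p\<^sub>1\<close> over \<open>\<SS>\<^sub>1\<close> are the points where \<open>C\<^sub>1\<close> meets \<open>C\<^sub>5\<close>, so the function extends by
  zero to the other components, and \<open>D\<^sub>E\<close> allows the poles of \<open>1/(\<lambda>q\<^sub>1)\<close>. At infinity the degrees
  match: \<open>\<lambda>q\<^sub>1\<close> has degree \<open>|\<SS>\<^sub>1|\<close> minus the multiplicity of infinity in \<open>E'\<close>.\<close>

lemma bump_section:
  "restrict (component_bump q1) (curve_pts p - set_mset D) \<in> div_sections p D (curve_pts p)"
  (is "?h \<in> _")
proof -
  let ?B = "component_bump q1"
  have h: "?h y = ?B y" if "y \<in> curve_pts p" "y \<notin># D" for y using that by simp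
  have off: "regular_at p ?h x" if x: "x \<in> curve_pts p" "x \<notin> component p 1" "x \<notin># D" for x
  proof (rule regular_at_const)
    show "zopen p (curve_pts p - component p 1 - set_mset D)"
      by (intro zopen_minus_finite zopen_compl_component) auto
    show "?h y = 0" if "y \<in> curve_pts p - component p 1 - set_mset D" for y
      using that h[of y] component_bump_off[of y p] by auto
  qed (use x in auto)
  have off_pole: "rational_near p x {x} (\<lambda>y. loc_coord x y ^ m * ?h y)"
    if x: "x \<in> curve_pts p" "x \<notin> component p 1" for x m
  proof (rule rational_near_const_pole)
    show "zopen p (curve_pts p - component p 1 - (set_mset D - {x}))"
      by (intro zopen_minus_finite zopen_compl_component) auto
    show "?h y = 0" if "y \<in> curve_pts p - component p 1 - (set_mset D - {x}) - {x}" for y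
      using that h[of y] component_bump_off[of y p] by auto
  qed (use x in auto)
  have on: "regular_at p ?h (comp_pt p 1 (Num a))" if nD: "comp_pt p 1 (Num a) \<notin># D" for a
  proof -
    have "0 \<notin> S1" using S_nz free_pts_subset by blast
    then have "comp_pt p 1 (Num 0) \<in># D"
      using count_D_1[of "Num 0"] by (intro count_inI) auto
    then have a: "a \<noteq> 0" using nD by metis
    have qa: "poly q1 a \<noteq> 0"
    proof (cases "a \<in> S1")
      case True
      then show ?thesis using reduced_div_avoids[of "Num a" S E] by (auto simp: poly_div_poly_eq_0_iff)
    next
      case False
      then show ?thesis using nD count_D_1[of "Num a"] by (auto simp: poly_div_poly_eq_0_iff not_in_iff)
    qed
    define V where "V = {y \<in> curve_pts p. lam y \<notin> Num ` {b. poly q1 b = 0}} - set_mset D"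
    have "zopen p V" unfolding V_def
      by (intro zopen_minus_finite zopen_lam finite_imageI poly_roots_finite) auto
    moreover have "Aff (coords p 1 a) \<in> V"
      using a nD qa comp_pt_in[of p 1 "Num a"] unfolding V_def by (auto simp: comp_pt_Num)
    moreover have "(\<lambda>Z. Z $ 1) \<in> polyfuns" "(\<lambda>Z. Z $ 5 * poly q1 (Z $ 5)) \<in> polyfuns"
      by (intro polyfuns.intros polyfuns_poly)+
    moreover have "W $ 5 * poly q1 (W $ 5) \<noteq> 0 \<and> ?h (Aff W) = W $ 1 / (W $ 5 * poly q1 (W $ 5))"
      if "Aff W \<in> V" for W
      using that unfolding V_def
      by (auto simp: curve_pts_def affine_curve_def component_bump_def)
    ultimately show ?thesis unfolding comp_pt_Num[OF a] by (rule regular_at_AffI)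
  qed
  have on_pole: "rational_near p x {x} (\<lambda>y. loc_coord x y ^ count D x * ?h y)"
    if x: "x = comp_pt p 1 (Num a)" and D: "x \<in># D" for x a
  proof -
    have a: "a \<notin> S1" using D_1 D x by auto
    define m where "m = order a den"
    have m: "count D x = m" using count_D_1_Num[OF a] x by (simp add: m_def)
    obtain R where R: "den = [:-a, 1:] ^ m * R" "poly R a \<noteq> 0"
      using order_decomp[of den a] den_nz unfolding m_def by (metis poly_eq_0_iff_dvd)
    have "R \<noteq> 0" using R by auto
    define V where "V = component p 1 - (\<Union>k\<in>-{1}. component p k) - (set_mset D - {x})
        - (comp_pt p 1 ` Num ` {b. poly R b = 0} \<union> ({comp_pt p 1 Infty, comp_pt p 1 (Num 0)} - {x}))"
    have "zopen p V" unfolding V_def using \<open>R \<noteq> 0\<close>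
      by (intro zopen_minus_finite zopen_only_component finite_UnI finite_imageI poly_roots_finite) auto
    moreover have "x \<in> V"
    proof -
      have "x \<notin> component p k" if "k \<noteq> 1" for k
        using smooth_pt_unique[of 1 "Num a" k] that a x by (auto simp: S_part_eq component_def)
      moreover have "x \<notin> comp_pt p 1 ` Num ` {b. poly R b = 0}"
        using R x by (auto simp: comp_pt_eq_iff)
      ultimately show ?thesis using x unfolding V_def by (auto simp: component_def)
    qed
    moreover have "poly (pcompose R [:a, 1:]) (loc_coord x y) \<noteq> 0 \<and>
       loc_coord x y ^ m * ?h y = poly (pcompose (p 1) [:a, 1:]) (loc_coord x y) / poly (pcompose R [:a, 1:]) (loc_coord x y)"
      if y: "y \<in> V - {x}" for y
    proof -
      obtain c where c: "y = comp_pt p 1 c" using y by (auto simp: V_def component_def)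
      obtain b where b: "y = comp_pt p 1 (Num b)" using y c by (cases c) (auto simp: V_def)
      have b0: "b \<noteq> 0" "b \<noteq> a" "poly R b \<noteq> 0" "y \<notin># D" using y b x by (auto simp: V_def)
      have l: "loc_coord x y = b - a" using x b by (simp add: loc_coord_def)
      have "?h y = poly (p 1) b / poly den b"
        using b b0 component_bump_1[OF b0(1)] by (subst h) (auto simp: poly_den)
      then show ?thesis using b0 unfolding l R by (auto simp: poly_pcompose poly_power)
    qed
    moreover have "poly (pcompose R [:a, 1:]) 0 \<noteq> 0" using R by (simp add: poly_pcompose)
    ultimately show ?thesis unfolding rational_near_def m by blast
  qed
  have inf: "rational_near p x A (\<lambda>y. loc_coord x y ^ m * ?h y)"
    if x: "x = comp_pt p 1 Infty" and m: "m = count D x" and A: "A = (if m = 0 then {} else {x})" for x m A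
  proof -
    have m': "m = count E' Infty" using count_D_1[of Infty] m x by auto
    define V where "V = component p 1 - (\<Union>k\<in>-{1}. component p k) - (set_mset D - {x})
        - (comp_pt p 1 ` Num ` {b. poly den b = 0})"
    have "zopen p V" unfolding V_def
      by (intro zopen_minus_finite zopen_only_component finite_UnI finite_imageI poly_roots_finite) auto
    moreover have "x \<in> V"
    proof -
      have "x \<notin> component p k" if "k \<noteq> 1" for k
        using smooth_pt_unique[of 1 "Infty" k] that x by (auto simp: S_part_eq component_def)
      then show ?thesis using x unfolding V_def by (auto simp: component_def comp_pt_eq_iff simp del: comp_pt.simps)
    qed
    moreover have "poly (reflect_poly den) (loc_coord x y) \<noteq> 0 \<and>
       loc_coord x y ^ m * ?h y = poly (reflect_poly (p 1)) (loc_coord x y) / poly (reflect_poly den) (loc_coord x y)"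
      if y: "y \<in> V - A" for y
    proof (cases "y = x")
      case True
      have "m = 0" using y True A by (auto split: if_splits)
      then have "?h y = 1" using True x m comp_pt_in[of p 1 Infty]
        by (subst h) (auto simp: component_bump_def not_in_iff)
      moreover have "lead_coeff (p 1) = 1" by (simp add: p_1 lead_coeff_root_poly)
      ultimately show ?thesis using \<open>m = 0\<close> True x lead_coeff_den by (simp add: loc_coord_def)
    next
      case False
      obtain c where c: "y = comp_pt p 1 c" using y by (auto simp: V_def component_def)
      obtain b where b: "y = comp_pt p 1 (Num b)" using y c False x by (cases c) (auto simp: V_def)
      have db: "poly den b \<noteq> 0" "y \<notin># D" using y b x False by (auto simp: V_def)
      then have b0: "b \<noteq> 0" by (auto simp: poly_den)
      have l: "loc_coord x y = inverse b" using x b by (simp add: loc_coord_def inverse_eq_divide)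
      have hy: "?h y = poly (p 1) b / poly den b"
        using b b0 db component_bump_1[OF b0] by (subst h) (auto simp: poly_den)
      have r1: "poly den b = b ^ degree den * poly (reflect_poly den) (inverse b)"
        using b0 by (rule poly_via_reflect)
      have r2: "poly (p 1) b = b ^ degree (p 1) * poly (reflect_poly (p 1)) (inverse b)"
        using b0 by (rule poly_via_reflect)
      have "degree (p 1) = degree den + m"
        using degree_den degree_root_poly[OF finite_S1] m' by (simp add: p_1)
      then have r2': "poly (p 1) b = b ^ degree den * b ^ m * poly (reflect_poly (p 1)) (inverse b)"
        using r2 by (simp add: power_add)
      show ?thesis using db(1) b0 unfolding l hy r2' unfolding r1 by (simp add: field_simps)
    qed
    moreover have "poly (reflect_poly den) 0 \<noteq> 0" using lead_coeff_den by simp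
    ultimately show ?thesis unfolding rational_near_def by blast
  qed
  have "regular_at p ?h x" if x: "x \<in> curve_pts p" "x \<notin># D" for x
  proof (cases "x \<in> component p 1")
    case True
    then obtain c where c: "x = comp_pt p 1 c" by (auto simp: component_def)
    show ?thesis
    proof (cases c)
      case Infty
      have "rational_near p x {} (\<lambda>y. loc_coord x y ^ 0 * ?h y)"
        by (rule inf) (use Infty c x in \<open>auto simp: not_in_iff\<close>)
      then have "rational_near p x {} ?h" by (simp only: power_0 mult_1)
      then show ?thesis using Infty c by (simp add: regular_at_def del: restrict_apply)
    qed (use on c x in auto)
  qed (use off x in auto)
  moreover have "rational_near p x {x} (\<lambda>y. loc_coord x y ^ count D x * ?h y)"
    if x: "x \<in> curve_pts p" "x \<in># D" for x
  proof (cases "x \<in> component p 1")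
    case True
    then obtain c where c: "x = comp_pt p 1 c" by (auto simp: component_def)
    show ?thesis
    proof (cases c)
      case Infty
      then show ?thesis using inf[of x "count D x" "{x}"] c x by auto
    qed (use on_pole c x in auto)
  qed (use off_pole x in auto)
  ultimately show ?thesis by (simp add: div_sections_def)
qed

text \<open>On \<open>C\<^sub>5\<close>, which \<open>D\<^sub>E\<close> avoids, a global section is a constant \<open>c\<close>. On \<open>C\<^sub>1\<close> its product with
  \<open>\<lambda>q\<^sub>1\<close> is a polynomial of degree at most \<open>|\<SS>\<^sub>1|\<close>. At the points of \<open>\<SS>\<^sub>1\<close>, where the components
  meet, it takes the values of \<open>c\<lambda>q\<^sub>1\<close>; so the difference is a multiple of \<open>p\<^sub>1\<close>.\<close>

lemma section_shape:
  assumes t: "t \<in> div_sections p D (curve_pts p)"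
  shows "\<exists>c \<alpha> F. finite F \<and> (\<forall>b. b \<notin> F \<longrightarrow> t (comp_pt p 5 (Num b)) = c \<and>
           t (comp_pt p 1 (Num b)) * poly den b = c * poly den b + \<alpha> * poly (p 1) b)"
proof -
  have reg: "regular_at p t x" if "x \<in> curve_pts p" "x \<notin># D" for x
    using t that by (simp add: div_sections_def)
  have pole: "rational_near p x {x} (\<lambda>y. loc_coord x y ^ count D x * t y)"
    if "x \<in> curve_pts p" "x \<in># D" for x
    using t that by (simp add: div_sections_def)
  define w5 where "w5 = (\<lambda>b. t (comp_pt p 5 (Num b)))"
  have "\<exists>W F. degree W \<le> 0 \<and> finite F \<and> (\<forall>b. b \<notin> F \<longrightarrow> w5 b = poly W b)"
  proof (rule rational_without_poles)
    show "\<exists>G K F. finite F \<and> poly K a \<noteq> 0 \<and> (\<forall>b. b \<notin> F \<longrightarrow> w5 b * poly K b = poly G b)" for a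
      using regular_at_Num[OF reg[OF comp_pt_in D_not_5], of a] unfolding w5_def by blast
    show "\<exists>G K F. finite F \<and> poly K 0 \<noteq> 0 \<and>
        (\<forall>b. b \<notin> F \<longrightarrow> w5 b * poly K (inverse b) = b ^ 0 * poly G (inverse b))"
      using regular_at_Infty[OF reg[OF comp_pt_in D_not_5]] unfolding w5_def power_0 mult_1 by blast
  qed
  then obtain W5 F5 where W5: "degree W5 = 0" "finite F5" "\<And>b. b \<notin> F5 \<Longrightarrow> w5 b = poly W5 b" by auto
  obtain c where c: "W5 = [:c:]" using W5(1) by (auto elim: degree_eq_zeroE)
  have w5: "w5 b = c" if "b \<notin> F5" for b using W5 c that by simp
  \<comment> \<open>The cofinite formula \<open>w5 = c\<close> may miss the points of \<open>\<SS>\<^sub>1\<close>; regularity there extends it to them.\<close>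
  have w5_S1: "w5 s = c" if "s \<in> S1" for s
  proof -
    obtain G K F where GK: "finite F" "s \<notin> F" "poly K s \<noteq> 0" "\<And>b. b \<notin> F \<Longrightarrow> w5 b * poly K b = poly G b"
      using regular_at_Num[OF reg[OF comp_pt_in D_not_5], of s] unfolding w5_def by blast
    have "smult c K = G"
    proof (rule poly_eqI_cofinite[of "F5 \<union> F"])
      fix b assume "b \<notin> F5 \<union> F"
      then show "poly (smult c K) b = poly G b" using GK(4)[of b] w5[of b] by simp
    qed (use W5 GK in auto)
    then show ?thesis using GK(3) GK(4)[OF GK(2)] by auto
  qed
  define w where "w = (\<lambda>b. t (comp_pt p 1 (Num b)) * poly den b)"
  have "\<exists>W F. degree W \<le> card S1 \<and> finite F \<and> (\<forall>b. b \<notin> F \<longrightarrow> w b = poly W b)"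
  proof (rule rational_without_poles)
    fix a
    show "\<exists>G K F. finite F \<and> poly K a \<noteq> 0 \<and> (\<forall>b. b \<notin> F \<longrightarrow> w b * poly K b = poly G b)"
    proof (cases "comp_pt p 1 (Num a) \<in># D")
      case False
      then obtain G K F where GK: "finite F" "a \<notin> F" "poly K a \<noteq> 0"
        "\<And>b. b \<notin> F \<Longrightarrow> t (comp_pt p 1 (Num b)) * poly K b = poly G b"
        using regular_at_Num[OF reg[OF comp_pt_in False]] by blast
      have "w b * poly K b = poly (G * den) b" if "b \<notin> F" for b
        using GK(4)[OF that] by (simp add: w_def algebra_simps)
      then show ?thesis using GK by blast
    next
      case True
      define m where "m = order a den"
      have m: "count D (comp_pt p 1 (Num a)) = m"
        unfolding m_def using D_1[OF True] by (intro count_D_1_Num) auto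
      obtain R where R: "den = [:-a, 1:] ^ m * R" using order_1[of a den] unfolding m_def by (auto simp: dvd_def)
      obtain G K F where GK: "finite F" "poly K a \<noteq> 0"
        "\<And>b. b \<notin> F \<Longrightarrow> comp_pt p 1 (Num b) \<notin> {comp_pt p 1 (Num a)} \<Longrightarrow>
           loc_coord (comp_pt p 1 (Num a)) (comp_pt p 1 (Num b)) ^ m * t (comp_pt p 1 (Num b)) * poly K b = poly G b"
        using rational_near_Num[OF pole[OF comp_pt_in True]] unfolding m by blast
      have "w b * poly K b = poly (G * R) b" if "b \<notin> insert a F" for b
      proof -
        have "(b - a) ^ m * t (comp_pt p 1 (Num b)) * poly K b = poly G b"
          using GK(3)[of b] that by (simp add: comp_pt_eq_iff loc_coord_def)
        then show ?thesis unfolding w_def R by (simp add: poly_power algebra_simps)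
      qed
      then show ?thesis using GK by (metis finite_insert)
    qed
  next
    define m where "m = count E' Infty"
    have m: "count D (comp_pt p 1 Infty) = m"
      unfolding m_def by (subst count_D_1) auto
    have "\<exists>G K F. finite F \<and> poly K 0 \<noteq> 0 \<and> (\<forall>b. b \<notin> F \<longrightarrow>
        inverse b ^ m * t (comp_pt p 1 (Num b)) * poly K (inverse b) = poly G (inverse b))"
    proof (cases "comp_pt p 1 Infty \<in># D")
      case False
      then have "m = 0" using m by (simp add: not_in_iff)
      then show ?thesis using regular_at_Infty[OF reg[OF comp_pt_in False]] unfolding \<open>m = 0\<close> power_0 mult_1 by blast
    next
      case True
      have "comp_pt p 1 (Num b) \<noteq> comp_pt p 1 Infty" for b by (simp add: comp_pt_eq_iff del: comp_pt.simps)
      moreover have "loc_coord (comp_pt p 1 Infty) (comp_pt p 1 (Num b)) = inverse b" for b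
        unfolding loc_coord_def by (simp add: inverse_eq_divide)
      ultimately show ?thesis
        using rational_near_Infty[OF pole[OF comp_pt_in True]] unfolding m
        by (metis singletonD)
    qed
    then obtain G K F where GK: "finite F" "poly K 0 \<noteq> 0" "\<And>b. b \<notin> F \<Longrightarrow>
        inverse b ^ m * t (comp_pt p 1 (Num b)) * poly K (inverse b) = poly G (inverse b)" by blast
    have "w b * poly K (inverse b) = b ^ card S1 * poly (G * reflect_poly den) (inverse b)"
      if "b \<notin> insert 0 F" for b
    proof -
      have b: "b \<noteq> 0" "b \<notin> F" using that by auto
      have d: "poly den b = b ^ degree den * poly (reflect_poly den) (inverse b)"
        using b by (rule_tac poly_via_reflect) simp
      have "t (comp_pt p 1 (Num b)) * poly K (inverse b) = b ^ m * poly G (inverse b)"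
        using GK(3)[OF b(2)] b(1) by (simp add: field_simps)
      then have "w b * poly K (inverse b) = b ^ m * poly G (inverse b) * poly den b"
        unfolding w_def by (simp add: algebra_simps)
      then show ?thesis unfolding d degree_den[symmetric] m_def[symmetric]
        by (simp add: power_add algebra_simps)
    qed
    then show "\<exists>G K F. finite F \<and> poly K 0 \<noteq> 0 \<and>
        (\<forall>b. b \<notin> F \<longrightarrow> w b * poly K (inverse b) = b ^ card S1 * poly G (inverse b))"
      using GK by (metis finite_insert)
  qed
  then obtain W F where W: "degree W \<le> card S1" "finite F" "\<And>b. b \<notin> F \<Longrightarrow> w b = poly W b" by blast
  have W_S1: "poly W s = c * poly den s" if s: "s \<in> S1" for s
  proof -
    have same: "comp_pt p 1 (Num s) = comp_pt p 5 (Num s)"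
      using s free_pts_subset S_nz by (intro comp_pt_eq5) (auto simp: p_eq_0_iff S_part_eq)
    then have nD: "comp_pt p 1 (Num s) \<notin># D" using D_not_5 by simp
    obtain G K F' where GK: "finite F'" "s \<notin> F'" "poly K s \<noteq> 0"
        "\<And>b. b \<notin> F' \<Longrightarrow> t (comp_pt p 1 (Num b)) * poly K b = poly G b"
      using regular_at_Num[OF reg[OF comp_pt_in nD]] by blast
    have "W * K = G * den"
    proof (rule poly_eqI_cofinite[of "F \<union> F'"])
      fix b assume b: "b \<notin> F \<union> F'"
      then have "poly W b = t (comp_pt p 1 (Num b)) * poly den b" using W(3)[of b] by (simp add: w_def)
      then show "poly (W * K) b = poly (G * den) b" using GK(4)[of b] b by (simp add: algebra_simps)
    qed (use W GK in auto)
    then have "poly W s * poly K s = poly G s * poly den s" by (metis poly_mult)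
    moreover have "poly G s = c * poly K s" using GK(4)[OF GK(2)] w5_S1[OF s] same by (simp add: w5_def)
    ultimately show ?thesis using GK(3) by simp
  qed
  define \<alpha> where "\<alpha> = coeff (W - smult c den) (card S1)"
  have "W - smult c den = smult \<alpha> (p 1)"
  proof (rule poly_eqI_degree_lead_coeff[of _ "card S1" _ S1])
    have "coeff (p 1) (card S1) = 1"
      using lead_coeff_root_poly[of S1] degree_root_poly[OF finite_S1] by (simp add: p_1)
    then show "coeff (W - smult c den) (card S1) = coeff (smult \<alpha> (p 1)) (card S1)" by (simp add: \<alpha>_def)
    have "degree (smult c den) \<le> card S1" using degree_den by (metis degree_smult_le le_add1 le_trans)
    then show "degree (W - smult c den) \<le> card S1" using W(1) by (intro degree_diff_le) auto
    show "degree (smult \<alpha> (p 1)) \<le> card S1"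
      using degree_root_poly[OF finite_S1] by (metis degree_smult_le p_1)
    fix s assume "s \<in> S1"
    then show "poly (W - smult c den) s = poly (smult \<alpha> (p 1)) s"
      using W_S1 by (simp add: p_1 poly_root_poly_eq_0_iff finite_S1)
  qed auto
  then have W': "W = smult c den + smult \<alpha> (p 1)" by (simp add: algebra_simps)
  have "t (comp_pt p 5 (Num b)) = c \<and>
           t (comp_pt p 1 (Num b)) * poly den b = c * poly den b + \<alpha> * poly (p 1) b"
    if "b \<notin> F5 \<union> F" for b
    using w5[of b] W(3)[of b] that unfolding W' by (simp add: w_def w5_def)
  then show ?thesis using W5(2) W(2) by (meson finite_UnI)
qed

end

section \<open>Isomorphic sheaves have the same divisor\<close>

text \<open>The value \<open>0\<close> at the points over \<open>0\<close> and \<open>\<infinity>\<close> is a default; the function is used away from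
  these points.\<close>

definition quotient :: "(complex ^ 5 \<Rightarrow> complex) \<Rightarrow> (complex ^ 5 \<Rightarrow> complex) \<Rightarrow> curve_pt \<Rightarrow> complex" where
  "quotient g k y = (case y of Aff W \<Rightarrow> g W / k W | _ \<Rightarrow> 0)"

lemma lam_generic:
  assumes "x \<in> curve_pts p" "Num 0 \<in> B" "Infty \<in> B" "lam x \<notin> B"
  obtains j b where "x = comp_pt p j (Num b)" "b \<noteq> 0" "Num b \<notin> B"
    "x = Aff (coords p j b)"
proof -
  obtain j a where "x = comp_pt p j a" using assms(1) by (rule curve_pts_cases)
  then show ?thesis using that assms by (cases a) (auto simp: comp_pt_Num, metis comp_pt_Num)
qed

lemma quotient_section:
  assumes B: "finite B" "Num 0 \<in> B" "Infty \<in> B" "lam ` set_mset D \<subseteq> B"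
    and gk: "g \<in> polyfuns" "k \<in> polyfuns"
    and k: "\<And>W. W \<in> affine_curve p \<Longrightarrow> Num (W $ 5) \<notin> B \<Longrightarrow> k W \<noteq> 0"
  shows "restrict (quotient g k) (away p B) \<in> div_sections p D (away p B)"
    (is "?h \<in> div_sections p D ?V")
proof -
  have D: "?V \<inter> set_mset D = {}" using B(4) by auto
  have "regular_at p ?h x" if x: "x \<in> ?V" for x
  proof -
    have "x \<in> curve_pts p" "lam x \<notin> B" using x by auto
    then obtain Z where Z: "x = Aff Z" using B lam_generic[of x p B] by metis
    have V: "zopen p ?V" using B by (intro zopen_lam)
    have "k W \<noteq> 0 \<and> ?h (Aff W) = g W / k W" if "Aff W \<in> ?V" for W
      using that k[of W] by (auto simp: quotient_def curve_pts_def)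
    then show ?thesis using V x gk unfolding Z by (intro regular_at_AffI[of p ?V Z g k]) auto
  qed
  moreover have "?V - set_mset D = ?V" using D by blast
  ultimately show ?thesis using D by (auto simp: div_sections_def)
qed

context unit_divisor
begin

abbreviation "whole \<equiv> (\<lambda>j::5. root_poly S)"
abbreviation "L \<equiv> L_sheaf \<beta>0 \<Delta> E"

definition "rest = root_poly (S - S1)"

lemma rest_p: "rest * p 1 = root_poly S"
  using root_poly_Un[OF finite_S free_pts_subset[of S E]] by (simp add: rest_def p_1 mult.commute)

lemma div_poly_E: "div_poly E = rest * q1"
  using div_poly_reduced[OF finite_S, of E] by (simp add: rest_def mult.commute)

text \<open>Since \<open>p\<close> is \<open>p\<^sub>j\<close> times the polynomial of the remaining points, the desingularisation map
  is the identity in the coordinate \<open>\<lambda>\<close> of each component.\<close>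

lemma desing_comp_pt: "desing \<beta>0 \<Delta> E (comp_pt p j a) = comp_pt whole j a"
proof (cases a)
  case (Num b)
  show ?thesis
  proof (cases "b = 0")
    case False
    have "root_poly S = p j * root_poly (S - S_part \<beta>0 \<Delta> E j)"
      using root_poly_Un[OF finite_S S_part_subset[of j]] by (simp add: XE_poly_def)
    then have "poly (root_poly S) b = poly (root_poly (S - S_part \<beta>0 \<Delta> E j)) b * poly (p j) b" by simp
    then show ?thesis using False Num by (simp add: comp_pt_Num vec_eq_iff)
  qed (simp add: Num)
qed simp

text \<open>Preimages under the desingularisation of open sets cut out by conditions on \<open>\<lambda>\<close> are cut out
  by the same conditions.\<close>

lemma pre_whole: "{x \<in> curve_pts p. desing \<beta>0 \<Delta> E x \<in> curve_pts whole} = curve_pts p"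
  by (auto elim!: curve_pts_cases simp: desing_comp_pt)

lemma pre_lam: "{x \<in> curve_pts p. desing \<beta>0 \<Delta> E x \<in> curve_pts whole \<and> lam (desing \<beta>0 \<Delta> E x) \<notin> B}
   = away p B"
  by (auto elim!: curve_pts_cases simp: desing_comp_pt)

lemma L_sections: "sections L (curve_pts whole) = div_sections p D (curve_pts p)"
  "sections L (away whole B) = div_sections p D (away p B)"
  by (simp_all add: L_sheaf_def direct_image_def Let_def pre_whole pre_lam)

lemma L_ops:
  assumes "lam ` set_mset D \<subseteq> B"
  shows "restr L (away whole B) s = restrict s (away p B)"
    "sec_smult L (away whole B) h s =
       restrict (\<lambda>x. h (desing \<beta>0 \<Delta> E x) * s x) (away p B)"
proof -
  have "(away p B) - set_mset D = away p B"
    using assms by auto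
  then show "restr L (away whole B) s = restrict s (away p B)"
    "sec_smult L (away whole B) h s =
       restrict (\<lambda>x. h (desing \<beta>0 \<Delta> E x) * s x) (away p B)"
    by (simp_all add: L_sheaf_def direct_image_def Let_def pre_lam)
qed

end

text \<open>Let \<open>t\<^sub>1\<close> and \<open>t\<psi>\<close> be the images of the sections \<open>1\<close> and \<open>\<psi> = p/(\<lambda>Q\<^sub>E)\<close> on \<open>C\<^sub>1\<close>. On a small open
  set \<open>\<psi>\<close> is a regular function \<open>h\<close> times \<open>1\<close>, hence \<open>t\<psi> = h t\<^sub>1\<close>. In particular \<open>t\<psi>\<close> vanishes on \<open>C\<^sub>5\<close>, and
  \<open>section_shape\<close> gives \<open>t\<psi> = \<alpha>\<psi> p/(\<lambda>Q)\<close> and \<open>t\<^sub>1 = c\<^sub>1 + \<alpha>\<^sub>1 p/(\<lambda>Q)\<close> on \<open>C\<^sub>1\<close>, where \<open>Q\<close> is the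
  polynomial of the second divisor. Clearing denominators in \<open>t\<psi> = h t\<^sub>1\<close> yields
  \<open>\<alpha>\<psi> \<lambda>Q\<^sub>E = c\<^sub>1 \<lambda>Q + \<alpha>\<^sub>1 p\<close>; at \<open>\<lambda> = 0\<close> this shows \<open>\<alpha>\<^sub>1 = 0\<close>, and \<open>Q\<^sub>E\<close> and \<open>Q\<close> are proportional.\<close>

lemma divisor_unique_of_sheaf_iso:
  assumes "unit_divisor \<beta>0 \<Delta> E" and "unit_divisor \<beta>0 \<Delta> E2"
    and iso: "sheaf_iso (X_curve \<beta>0 \<Delta>) (L_sheaf \<beta>0 \<Delta> E) (L_sheaf \<beta>0 \<Delta> E2)"
  shows "E = E2"
proof -
  interpret A: unit_divisor \<beta>0 \<Delta> E by fact
  interpret B: unit_divisor \<beta>0 \<Delta> E2 by fact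
  obtain \<phi> where raw: "\<forall>U\<in>opens (X_curve \<beta>0 \<Delta>).
        bij_betw (\<phi> U) (sections A.L U) (sections B.L U) \<and>
        (\<forall>s\<in>sections A.L U. \<forall>t\<in>sections A.L U.
            \<phi> U (sec_add A.L U s t) = sec_add B.L U (\<phi> U s) (\<phi> U t)) \<and>
        (\<forall>h\<in>reg_funs (X_curve \<beta>0 \<Delta>) U. \<forall>s\<in>sections A.L U.
            \<phi> U (sec_smult A.L U h s) = sec_smult B.L U h (\<phi> U s)) \<and>
        (\<forall>V\<in>opens (X_curve \<beta>0 \<Delta>). V \<subseteq> U \<longrightarrow>
            (\<forall>s\<in>sections A.L U. \<phi> V (restr A.L V s) = restr B.L V (\<phi> U s)))"
    using iso unfolding sheaf_iso_def by (elim exE)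
  have X: "U \<in> opens (X_curve \<beta>0 \<Delta>) \<longleftrightarrow> zopen A.whole U"
    "reg_funs (X_curve \<beta>0 \<Delta>) = div_sections A.whole {#}" for U
    by (simp_all add: X_curve_def curve_of_def)
  have bij: "bij_betw (\<phi> U) (sections A.L U) (sections B.L U)" if "zopen A.whole U" for U
    using raw that X(1) by blast
  have smult: "\<phi> U (sec_smult A.L U h s) = sec_smult B.L U h (\<phi> U s)"
    if "zopen A.whole U" "h \<in> div_sections A.whole {#} U" "s \<in> sections A.L U" for U h s
    using raw[unfolded X(2)] that X(1) by blast
  have restr: "\<phi> V (restr A.L V s) = restr B.L V (\<phi> U s)"
    if "zopen A.whole U" "zopen A.whole V" "V \<subseteq> U" "s \<in> sections A.L U" for U V s
    using raw that X(1) by blast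
  define U where "U = curve_pts A.whole"
  have U: "zopen A.whole U" unfolding U_def using zopen_lam[of "{}" A.whole] by simp
  define one where "one = restrict (\<lambda>_. 1::complex) (curve_pts A.p - set_mset A.D)"
  define bump where "bump = restrict (component_bump A.q1) (curve_pts A.p - set_mset A.D)"
  have secA: "one \<in> sections A.L U" "bump \<in> sections A.L U"
    using A.one_section A.bump_section by (simp_all add: U_def A.L_sections one_def bump_def)
  define t1 t\<psi> where "t1 = \<phi> U one" and "t\<psi> = \<phi> U bump"
  have "t1 \<in> sections B.L U" "t\<psi> \<in> sections B.L U"
    using bij[OF U] secA unfolding t1_def t\<psi>_def bij_betw_def by blast+
  then have secB: "t1 \<in> div_sections B.p B.D (curve_pts B.p)" "t\<psi> \<in> div_sections B.p B.D (curve_pts B.p)"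
    by (simp_all add: U_def B.L_sections)
  obtain c1 \<alpha>1 F1 where s1: "finite F1" "\<And>b. b \<notin> F1 \<Longrightarrow>
      t1 (comp_pt B.p 1 (Num b)) * poly B.den b = c1 * poly B.den b + \<alpha>1 * poly (B.p 1) b"
    using B.section_shape[OF secB(1)] by blast
  obtain c\<psi> \<alpha>\<psi> F\<psi> where s\<psi>: "finite F\<psi>" "\<And>b. b \<notin> F\<psi> \<Longrightarrow> t\<psi> (comp_pt B.p 5 (Num b)) = c\<psi>"
      "\<And>b. b \<notin> F\<psi> \<Longrightarrow> t\<psi> (comp_pt B.p 1 (Num b)) * poly B.den b = c\<psi> * poly B.den b + \<alpha>\<psi> * poly (B.p 1) b"
    using B.section_shape[OF secB(2)] by blast
  define F where "F = insert 0 (F1 \<union> F\<psi> \<union> A.S \<union> {b. poly A.q1 b = 0} \<union> {b. poly B.den b = 0})"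
  have F: "finite F"
    unfolding F_def using s1 s\<psi> A.finite_S by (simp add: poly_roots_finite)
  \<comment> \<open>Outside \<open>B\<close> all denominators are nonzero, both desingularisations are isomorphisms,
    both divisors are absent, and the formulas for \<open>t1\<close> and \<open>t\<psi>\<close> hold.\<close>
  define B where "B = insert Infty (Num ` F \<union> lam ` set_mset A.D \<union> lam ` set_mset B.D)"
  have B: "finite B" "Num 0 \<in> B" "Infty \<in> B" "lam ` set_mset A.D \<subseteq> B" "lam ` set_mset B.D \<subseteq> B"
    unfolding B_def using F by (auto simp: F_def)
  have BF: "b \<notin> F" if "Num b \<notin> B" for b using that by (auto simp: B_def)
  define FB where "FB = {b. Num b \<in> B}"
  have FB: "finite FB"
    unfolding FB_def using finite_vimageI[OF B(1), of Num] by (simp add: vimage_def inj_def)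
  have FB': "Num b \<notin> B" if "b \<notin> FB" for b using that by (simp add: FB_def)
  obtain b0 where b0: "b0 \<notin> FB" using FB by (metis ex_new_if_finite infinite_UNIV_char_0)
  define V where "V = away A.whole B"
  have V: "zopen A.whole V" "V \<subseteq> U" unfolding V_def U_def using zopen_lam[OF B(1)] by auto
  define VA VB where "VA = away A.p B" and "VB = away B.p B"
  have opsA: "restr A.L V s = restrict s VA"
    "sec_smult A.L V h s = restrict (\<lambda>x. h (desing \<beta>0 \<Delta> E x) * s x) VA" for h s
    unfolding V_def VA_def by (rule A.L_ops[OF B(4)])+
  have opsB: "restr B.L V s = restrict s VB"
    "sec_smult B.L V h s = restrict (\<lambda>x. h (desing \<beta>0 \<Delta> E2 x) * s x) VB" for h s
    unfolding V_def VB_def by (rule B.L_ops[OF B(5)])+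
  have secV: "sections A.L V = div_sections A.p A.D VA"
    unfolding V_def VA_def by (rule A.L_sections)
  have genA: "x \<in> VA \<Longrightarrow> \<exists>j b. x = comp_pt A.p j (Num b) \<and> b \<notin> FB \<and> b \<noteq> 0 \<and> x = Aff (coords A.p j b)" for x
    unfolding VA_def FB_def using lam_generic[of x A.p B] B by blast
  have genB: "x \<in> VB \<Longrightarrow> \<exists>j b. x = comp_pt B.p j (Num b) \<and> b \<notin> FB \<and> b \<noteq> 0" for x
    unfolding VB_def FB_def using lam_generic[of x B.p B] B by blast
  have inA: "comp_pt A.p j (Num b) \<in> VA" if "b \<notin> FB" for j b
    using that by (simp add: VA_def FB_def)
  have inB: "comp_pt B.p j (Num b) \<in> VB" if "b \<notin> FB" for j b
    using that by (simp add: VB_def FB_def)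
  have generic: "b \<noteq> 0" "b \<notin> F1" "b \<notin> F\<psi>" "poly (root_poly A.S) b \<noteq> 0" "poly A.q1 b \<noteq> 0" "poly B.den b \<noteq> 0"
    if "b \<notin> FB" for b
    using BF[OF FB'[OF that]] by (auto simp: F_def poly_root_poly_eq_0_iff A.finite_S)
  have restnz: "poly A.rest b \<noteq> 0" if "b \<notin> FB" for b
    using generic(4)[OF that] A.rest_p by (metis mult_zero_left poly_mult)
  have p1nz: "poly (A.p 1) b \<noteq> 0" if "b \<notin> FB" for b
    using generic(4)[OF that] A.rest_p by (metis mult_zero_right poly_mult)
  define g k where "g = (\<lambda>W :: complex ^ 5. W $ 1)" and
    "k = (\<lambda>W :: complex ^ 5. poly A.rest (W $ 5) * (W $ 5 * poly A.q1 (W $ 5)))"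
  define h where "h = restrict (quotient g k) V"
  define z where "z = restrict (quotient (\<lambda>_. 0) (\<lambda>_. 1)) V"
  have "g \<in> polyfuns" "k \<in> polyfuns"
    unfolding g_def k_def by (intro polyfuns.intros polyfuns_poly)+
  then have hreg: "h \<in> div_sections A.whole {#} V"
    unfolding h_def V_def using B
    by (intro quotient_section) (auto simp: k_def generic restnz FB_def)
  have zreg: "z \<in> div_sections A.whole {#} V"
    unfolding z_def V_def using B by (intro quotient_section polyfuns.intros) auto
  have h_val: "h (comp_pt A.whole j (Num b)) =
      (if j = 1 then poly (root_poly A.S) b / (poly A.rest b * poly A.den b) else 0)" if "b \<notin> FB" for j b
    using generic(1)[OF that] FB'[OF that] comp_pt_in[of A.whole j "Num b"]
    by (auto simp: h_def V_def comp_pt_Num quotient_def g_def k_def A.poly_den)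
  have z_val: "z (comp_pt A.whole j (Num b)) = 0" if "b \<notin> FB" for j b
    using generic(1)[OF that] FB'[OF that] comp_pt_in[of A.whole j "Num b"]
    by (auto simp: z_def V_def comp_pt_Num quotient_def)
  have VA_D: "x \<in> VA \<Longrightarrow> x \<in> curve_pts A.p \<and> x \<notin># A.D" for x
    using B(4) by (auto simp: VA_def)
  define one0 where "one0 = restr A.L V one"
  define bump0 where "bump0 = restr A.L V bump"
  have one0: "one0 = restrict (\<lambda>_. 1) VA"
    unfolding one0_def opsA one_def by (rule ext) (use VA_D in auto)
  have bump0: "bump0 = restrict (component_bump A.q1) VA"
    unfolding bump0_def opsA bump_def by (rule ext) (use VA_D in auto)
  have "restrict (quotient (\<lambda>_. 1) (\<lambda>_. 1)) VA \<in> div_sections A.p A.D VA"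
    unfolding VA_def using B by (intro quotient_section polyfuns.intros) auto
  moreover have "restrict (quotient (\<lambda>_. 1) (\<lambda>_. 1)) VA = one0"
    unfolding one0 by (rule restrict_ext) (use genA in \<open>force simp: quotient_def\<close>)
  ultimately have one0_sec: "one0 \<in> sections A.L V" by (simp add: secV)
  have "restrict (quotient (\<lambda>W. W $ 1) (\<lambda>W. W $ 5 * poly A.q1 (W $ 5))) VA \<in> div_sections A.p A.D VA"
    unfolding VA_def using B
    by (intro quotient_section polyfuns.intros polyfuns_poly) (auto simp: generic FB_def)
  moreover have "restrict (quotient (\<lambda>W. W $ 1) (\<lambda>W. W $ 5 * poly A.q1 (W $ 5))) VA = bump0"
    unfolding bump0 by (rule restrict_ext) (use genA in \<open>fastforce simp: quotient_def component_bump_def\<close>)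
  ultimately have bump0_sec: "bump0 \<in> sections A.L V" by (simp add: secV)
  have zero0_sec: "restrict (\<lambda>_. 0) VA \<in> sections A.L V"
  proof -
    have "restrict (quotient (\<lambda>_. 0) (\<lambda>_. 1)) VA \<in> div_sections A.p A.D VA"
      unfolding VA_def using B by (intro quotient_section polyfuns.intros) auto
    moreover have "restrict (quotient (\<lambda>_. 0) (\<lambda>_. 1)) VA = restrict (\<lambda>_. 0) VA"
      by (rule restrict_ext) (use genA in \<open>force simp: quotient_def\<close>)
    ultimately show ?thesis by (simp add: secV)
  qed
  have bump0_smult: "bump0 = sec_smult A.L V h one0"
    unfolding bump0 opsA one0
  proof (rule restrict_ext)
    fix x assume x: "x \<in> VA"
    then obtain j b where jb: "x = comp_pt A.p j (Num b)" "b \<notin> FB" using genA by blast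
    show "component_bump A.q1 x = h (desing \<beta>0 \<Delta> E x) * restrict (\<lambda>_. 1) VA x"
    proof (cases "j = 1")
      case True
      have "poly (root_poly A.S) b = poly A.rest b * poly (A.p 1) b" by (metis A.rest_p poly_mult)
      then show ?thesis
        using jb x True generic[OF jb(2)] restnz[OF jb(2)]
        by (simp add: A.desing_comp_pt h_val component_bump_1 A.poly_den)
    next
      case False
      then show ?thesis using jb x by (simp add: A.desing_comp_pt h_val component_bump_other)
    qed
  qed
  have \<phi>V: "\<phi> V bump0 = restrict t\<psi> VB" "\<phi> V one0 = restrict t1 VB"
    using restr[OF U V] secA unfolding bump0_def one0_def t\<psi>_def t1_def opsB(1)[symmetric] by blast+
  have "\<phi> V bump0 = sec_smult B.L V h (\<phi> V one0)"
    unfolding bump0_smult by (rule smult[OF V(1) hreg one0_sec])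
  then have rel: "restrict t\<psi> VB = restrict (\<lambda>x. h (desing \<beta>0 \<Delta> E2 x) * restrict t1 VB x) VB"
    by (simp add: \<phi>V opsB)
  have val: "t\<psi> (comp_pt B.p j (Num b)) =
      (if j = 1 then poly (root_poly A.S) b / (poly A.rest b * poly A.den b) * t1 (comp_pt B.p 1 (Num b)) else 0)"
    if "b \<notin> FB" for j b
    using fun_cong[OF rel, of "comp_pt B.p j (Num b)"] inB[OF that, of j] that
    by (simp add: B.desing_comp_pt h_val)
  have c\<psi>: "c\<psi> = 0" using val[OF b0, of 5] s\<psi>(2)[OF generic(3)[OF b0]] by simp
  have "smult \<alpha>\<psi> (A.rest * A.den) = smult c1 (B.rest * B.den) + smult \<alpha>1 (root_poly A.S)"
  proof (rule poly_eqI_cofinite[OF FB])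
    fix b assume b: "b \<notin> FB"
    define x where "x = t1 (comp_pt B.p 1 (Num b))"
    have P: "poly (root_poly A.S) b = poly B.rest b * poly (B.p 1) b" by (metis B.rest_p poly_mult)
    have 1: "x * poly B.den b = c1 * poly B.den b + \<alpha>1 * poly (B.p 1) b"
      using s1(2)[OF generic(2)[OF b]] unfolding x_def .
    have 2: "poly (root_poly A.S) b / (poly A.rest b * poly A.den b) * x * poly B.den b = \<alpha>\<psi> * poly (B.p 1) b"
      using s\<psi>(3)[OF generic(3)[OF b]] val[OF b, of 1] c\<psi> unfolding x_def by simp
    have nz: "poly A.rest b \<noteq> 0" "poly A.den b \<noteq> 0" "poly (B.p 1) b \<noteq> 0"
      using restnz[OF b] generic[OF b] P by (auto simp: A.poly_den)
    have "poly B.rest b * poly (B.p 1) b * (x * poly B.den b) =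
        \<alpha>\<psi> * poly (B.p 1) b * (poly A.rest b * poly A.den b)"
      using 2 nz unfolding P by (simp add: field_simps)
    then have "poly B.rest b * (x * poly B.den b) = \<alpha>\<psi> * (poly A.rest b * poly A.den b)"
      using nz by (simp add: field_simps)
    then show "poly (smult \<alpha>\<psi> (A.rest * A.den)) b =
        poly (smult c1 (B.rest * B.den) + smult \<alpha>1 (root_poly A.S)) b"
      unfolding 1 by (simp add: P algebra_simps)
  qed
  then have eq: "smult \<alpha>\<psi> ([:0, 1:] * div_poly E) = smult c1 ([:0, 1:] * div_poly E2) + smult \<alpha>1 (root_poly A.S)"
    by (simp add: A.den_def B.den_def A.div_poly_E B.div_poly_E mult.left_commute)
  have "poly (root_poly A.S) 0 \<noteq> 0"
    using A.S_nz by (auto simp: poly_root_poly_eq_0_iff A.finite_S)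
  then have "\<alpha>1 = 0" using arg_cong[OF eq, of "\<lambda>q. poly q 0"] by simp
  then have "[:0, 1:] * smult \<alpha>\<psi> (div_poly E) = [:0, 1:] * smult c1 (div_poly E2)" using eq by simp
  then have eq': "smult \<alpha>\<psi> (div_poly E) = smult c1 (div_poly E2)"
    using mult_left_cancel[of "[:0, 1:]" "smult \<alpha>\<psi> (div_poly E)" "smult c1 (div_poly E2)"] by simp
  \<comment> \<open>If \<open>c1\<close> were zero, \<open>t\<psi>\<close> would vanish on the small open set, contrary to injectivity there.\<close>
  have "c1 \<noteq> 0"
  proof
    assume "c1 = 0"
    then have "\<alpha>\<psi> = 0" using eq' by simp
    have "t\<psi> x = 0" if x: "x \<in> VB" for x
    proof -
      obtain j b where jb: "x = comp_pt B.p j (Num b)" "b \<notin> FB" using genB[OF x] by blast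
      show ?thesis
      proof (cases "j = 1")
        case True
        then show ?thesis using s\<psi>(3)[OF generic(3)[OF jb(2)]] generic(6)[OF jb(2)] jb c\<psi> \<open>\<alpha>\<psi> = 0\<close> by simp
      next
        case False
        then show ?thesis using val[OF jb(2), of j] jb by simp
      qed
    qed
    then have 1: "\<phi> V bump0 = restrict (\<lambda>_. 0) VB" unfolding \<phi>V by (intro restrict_ext) auto
    have "sec_smult A.L V z one0 = restrict (\<lambda>_. 0) VA"
      unfolding opsA by (rule restrict_ext) (use genA A.desing_comp_pt z_val in \<open>metis mult_zero_left\<close>)
    moreover have "sec_smult B.L V z (\<phi> V one0) = restrict (\<lambda>_. 0) VB"
      unfolding opsB by (rule restrict_ext) (use genB B.desing_comp_pt z_val in \<open>metis mult_zero_left\<close>)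
    moreover have "\<phi> V (sec_smult A.L V z one0) = sec_smult B.L V z (\<phi> V one0)"
      by (rule smult[OF V(1) zreg one0_sec])
    ultimately have "\<phi> V (restrict (\<lambda>_. 0) VA) = \<phi> V bump0" using 1 by simp
    moreover have "inj_on (\<phi> V) (sections A.L V)" using bij[OF V(1)] unfolding bij_betw_def by blast
    ultimately have "restrict (\<lambda>_. 0) VA = bump0" using bump0_sec zero0_sec by (meson inj_onD)
    from fun_cong[OF this, of "comp_pt A.p 1 (Num b0)"]
    have "component_bump A.q1 (comp_pt A.p 1 (Num b0)) = 0"
      using inA[OF b0] by (simp add: bump0)
    then show False
      using component_bump_1[OF generic(1)[OF b0], of A.q1 A.p] generic[OF b0] p1nz[OF b0] by simp
  qed
  moreover have "\<alpha>\<psi> \<noteq> 0" using eq' \<open>c1 \<noteq> 0\<close> by (metis div_poly_nz smult_0_left smult_eq_0_iff)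
  ultimately show ?thesis using eq_of_div_poly_smult[OF eq'] A.size_E B.size_E by simp
qed

section \<open>Complex coordinates of four-space\<close>

text \<open>For \<open>\<sigma> = i\<close> and \<open>\<sigma> = -i\<close> these are coordinates of \<open>\<complex>\<^sup>4\<close> in which \<open>J\<close> is multiplication by \<open>\<sigma>\<close>. Up
  to the factor \<open>\<surd>2\<close> they are the coefficients with respect to \<open>v\<^sub>1, v\<^sub>2\<close> (\<open>\<sigma> = i\<close>, \<open>b\<close> false and
  true) and \<open>v\<^sub>3, v\<^sub>4\<close> (\<open>\<sigma> = -i\<close>). Treating both signs at once halves the computations below.\<close>

definition chi :: "complex \<Rightarrow> bool \<Rightarrow> complex ^ 4 \<Rightarrow> complex" where
  "chi \<sigma> b w = (if b then w $ 3 + \<sigma> * w $ 4 else w $ 1 + \<sigma> * w $ 2)"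

definition cplx :: "bool \<Rightarrow> real ^ 4 \<Rightarrow> complex" where
  "cplx b x = (if b then Complex (x $ 3) (x $ 4) else Complex (x $ 1) (x $ 2))"

definition of_cplx :: "(bool \<Rightarrow> complex) \<Rightarrow> real ^ 4" where
  "of_cplx F = (\<chi> i. if i = 1 then Re (F False) else if i = 2 then Im (F False)
                  else if i = 3 then Re (F True) else Im (F True))"

text \<open>The inverse of the passage to the coordinates \<open>chi\<close>. Only the values of \<open>X\<close> at \<open>i\<close> and \<open>-i\<close>
  enter.\<close>

definition of_chi :: "(complex \<Rightarrow> bool \<Rightarrow> complex) \<Rightarrow> complex ^ 4" where
  "of_chi X = (\<chi> i. if i = 1 then (X \<i> False + X (-\<i>) False) / 2
                   else if i = 2 then (X \<i> False - X (-\<i>) False) / (2 * \<i>)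
                   else if i = 3 then (X \<i> True + X (-\<i>) True) / 2
                   else (X \<i> True - X (-\<i>) True) / (2 * \<i>))"

lemma cplx_of_cplx [simp]: "cplx b (of_cplx F) = F b"
  by (cases b) (simp_all add: cplx_def of_cplx_def complex_eq_iff)

lemma cplx_eqI: "(\<And>b. cplx b x = cplx b y) \<Longrightarrow> x = y"
proof -
  assume *: "\<And>b. cplx b x = cplx b y"
  show "x = y" using *[of True] *[of False] by (simp add: cplx_def vec_eq_iff forall_4)
qed

lemma chi_of_chi [simp]: "chi \<i> b (of_chi X) = X \<i> b" "chi (-\<i>) b (of_chi X) = X (-\<i>) b"
  by (cases b; simp add: chi_def of_chi_def field_simps)+

lemma chi_eqI:
  assumes "\<And>b. chi \<i> b w = chi \<i> b w'" "\<And>b. chi (-\<i>) b w = chi (-\<i>) b w'"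
  shows "w = w'"
proof -
  have "w $ 1 = w' $ 1 \<and> w $ 2 = w' $ 2"
    using assms(1)[of False] assms(2)[of False] by (simp add: chi_def complex_eq_iff)
  moreover have "w $ 3 = w' $ 3 \<and> w $ 4 = w' $ 4"
    using assms(1)[of True] assms(2)[of True] by (simp add: chi_def complex_eq_iff)
  ultimately show ?thesis by (simp add: vec_eq_iff forall_4)
qed

lemma chi_linear [simp]:
  "chi \<sigma> b (v + w) = chi \<sigma> b v + chi \<sigma> b w" "chi \<sigma> b (v - w) = chi \<sigma> b v - chi \<sigma> b w"
  "chi \<sigma> b (c *s w) = c * chi \<sigma> b w" "chi \<sigma> b (r *\<^sub>R w) = r *\<^sub>R chi \<sigma> b w" "chi \<sigma> b 0 = 0"
  by (auto simp: chi_def algebra_simps scaleR_conv_of_real[where 'a=complex])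

lemma chi_sum [simp]: "chi \<sigma> b (sum f A) = (\<Sum>x\<in>A. chi \<sigma> b (f x))"
  by (induction A rule: infinite_finite_induct) auto

lemma bounded_linear_chi: "bounded_linear (chi \<sigma> b)"
  by (rule linear_conv_bounded_linear[THEN iffD1]) (intro linearI; simp)

lemma cplx_linear [simp]:
  "cplx b (x + y) = cplx b x + cplx b y" "cplx b (x - y) = cplx b x - cplx b y"
  "cplx b (r *\<^sub>R x) = r *\<^sub>R cplx b x" "cplx b 0 = 0"
  by (auto simp: cplx_def complex_eq_iff)

lemma bounded_linear_cplx: "bounded_linear (cplx b)"
  by (rule linear_conv_bounded_linear[THEN iffD1]) (intro linearI; simp)

lemma chi_cvec [simp]: "chi \<i> b (cvec x) = cplx b x" "chi (-\<i>) b (cvec x) = cnj (cplx b x)"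
  by (auto simp: chi_def cvec_def cplx_def complex_eq_iff)

lemma matJ_entries: "matJ $ i $ j = (if i = 1 \<and> j = 2 \<or> i = 3 \<and> j = 4 then -1 else
   if i = 2 \<and> j = 1 \<or> i = 4 \<and> j = 3 then 1 else 0)"
proof -
  have "\<forall>i j. matJ $ i $ j = (if i = 1 \<and> j = 2 \<or> i = 3 \<and> j = 4 then -1 else
   if i = 2 \<and> j = 1 \<or> i = 4 \<and> j = 3 then 1 else 0)"
    unfolding matJ_def matrix_def forall_4 by (simp add: axis_def)
  then show ?thesis by blast
qed

lemma matL_entries: "matL $ i $ j = (if i = 1 \<and> j = 3 \<or> i = 4 \<and> j = 2 then -1 else
   if i = 2 \<and> j = 4 \<or> i = 3 \<and> j = 1 then 1 else 0)"
proof -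
  have "\<forall>i j. matL $ i $ j = (if i = 1 \<and> j = 3 \<or> i = 4 \<and> j = 2 then -1 else
   if i = 2 \<and> j = 4 \<or> i = 3 \<and> j = 1 then 1 else 0)"
    unfolding matL_def matrix_def forall_4 by (simp add: axis_def)
  then show ?thesis by blast
qed

lemma cmat_mult: "cmat A *v w = (\<chi> i. \<Sum>j\<in>UNIV. of_real (A $ i $ j) * w $ j)"
  by (simp add: cmat_def matrix_vector_mult_def)

lemma chi_J:
  assumes "\<sigma> * \<sigma> = -1"
  shows "chi \<sigma> b (cmat matJ *v w) = \<sigma> * chi \<sigma> b w"
proof -
  have sq: "\<sigma> * (\<sigma> * x) = - x" for x using assms by (metis mult.assoc mult_minus1)
  show ?thesis
    by (simp add: chi_def cmat_mult sum_4 matJ_entries distrib_left sq)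
qed

lemma chi_L:
  assumes "\<sigma> * \<sigma> = -1"
  shows "chi \<sigma> False (cmat matL *v w) = - chi (-\<sigma>) True w"
    "chi \<sigma> True (cmat matL *v w) = chi (-\<sigma>) False w"
  by (simp_all add: chi_def cmat_mult sum_4 matL_entries algebra_simps)

lemma matJ_square: "matJ ** matJ = - mat 1"
proof -
  have "\<forall>i j. (matJ ** matJ) $ i $ j = (- mat 1 :: real^4^4) $ i $ j"
    unfolding forall_4 by (simp add: matrix_matrix_mult_def sum_4 matJ_entries mat_def)
  then show ?thesis by (simp add: vec_eq_iff)
qed

lemma matJ_powers:
  "(((**) (t *\<^sub>R matJ)) ^^ k) (mat 1) =
     t ^ k *\<^sub>R (if even k then (-1) ^ (k div 2) *\<^sub>R mat 1 else (-1) ^ (k div 2) *\<^sub>R matJ)"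
proof (induction k)
  case (Suc k)
  have s: "(t *\<^sub>R matJ) ** (c *\<^sub>R A) = (t * c) *\<^sub>R (matJ ** A)" for c and A :: "real^4^4"
    by (simp add: vec_eq_iff matrix_matrix_mult_def sum_distrib_left algebra_simps)
  have n: "matJ ** (c *\<^sub>R A) = c *\<^sub>R (matJ ** A)" for c and A :: "real^4^4"
    by (simp add: vec_eq_iff matrix_matrix_mult_def sum_distrib_left algebra_simps)
  show ?case
    by (cases "even k") (auto simp: Suc s n matJ_square elim!: evenE oddE)
qed simp

lemma mexp_J: "mexp (t *\<^sub>R matJ) = cos t *\<^sub>R mat 1 + sin t *\<^sub>R matJ"
proof -
  have "(\<lambda>k. (cos_coeff k *\<^sub>R t ^ k) *\<^sub>R (mat 1 :: real^4^4) + (sin_coeff k *\<^sub>R t ^ k) *\<^sub>R matJ) sums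
     (cos t *\<^sub>R mat 1 + sin t *\<^sub>R matJ)"
    by (intro sums_add bounded_linear.sums[OF bounded_linear_scaleR_left] cos_converges sin_converges)
  moreover have "(cos_coeff k *\<^sub>R t ^ k) *\<^sub>R (mat 1 :: real^4^4) + (sin_coeff k *\<^sub>R t ^ k) *\<^sub>R matJ
     = (1 / fact k) *\<^sub>R (((**) (t *\<^sub>R matJ)) ^^ k) (mat 1)" for k
    unfolding matJ_powers by (cases "even k") (auto simp: cos_coeff_def sin_coeff_def elim!: oddE)
  ultimately show ?thesis unfolding mexp_def by (simp add: sums_iff)
qed

text \<open>\<open>J\<^sup>2 = -1\<close>, so that \<open>e\<^bsup>tJ\<^esup> = cos t + sin t J\<close>, and \<open>J\<close> acts as \<open>\<sigma>\<close>.\<close>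

lemma chi_mexp:
  assumes "\<sigma> = \<i> \<or> \<sigma> = -\<i>"
  shows "chi \<sigma> b (cmat (mexp (t *\<^sub>R matJ)) *v w) = exp (\<sigma> * t) * chi \<sigma> b w"
proof -
  have "\<sigma> * \<sigma> = -1" using assms by auto
  have c: "cmat (cos t *\<^sub>R mat 1 + sin t *\<^sub>R matJ) *v w = of_real (cos t) *s w + of_real (sin t) *s (cmat matJ *v w)"
    by (simp add: vec_eq_iff cmat_mult mat_def algebra_simps sum.distrib sum_distrib_left
        if_distrib[of "\<lambda>x. _ * x"] if_distrib[of of_real] if_distrib[of "\<lambda>x. x * _"] cong: if_cong)
  have "exp (\<sigma> * t) = of_real (cos t) + \<sigma> * of_real (sin t)"
    using assms by (auto simp: complex_eq_iff Re_exp Im_exp)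
  then show ?thesis unfolding mexp_J c
    by (simp add: chi_J[OF \<open>\<sigma> * \<sigma> = -1\<close>] algebra_simps)
qed

section \<open>Derivatives and the scalar spectral equation\<close>

text \<open>The coefficients of \<open>v\<close> and of its conjugate are the two Wirtinger derivatives when \<open>D\<close> is a
  derivative.\<close>

lemma real_linear_complex:
  assumes "bounded_linear D"
  shows "D v = (D 1 - \<i> * D \<i>) / 2 * v + (D 1 + \<i> * D \<i>) / 2 * cnj v"
proof -
  interpret bounded_linear D by fact
  have "v = Re v *\<^sub>R 1 + Im v *\<^sub>R \<i>" by (simp add: complex_eq_iff)
  then have "D v = D (Re v *\<^sub>R 1 + Im v *\<^sub>R \<i>)" by (rule arg_cong)
  also have "\<dots> = Re v *\<^sub>R D 1 + Im v *\<^sub>R D \<i>" by (simp only: add scaleR)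
  also have "\<dots> = (D 1 - \<i> * D \<i>) / 2 * v + (D 1 + \<i> * D \<i>) / 2 * cnj v"
    by (simp add: complex_eq_iff field_simps)
  finally show ?thesis .
qed

lemma chi_d_z:
  "chi \<i> b (d_z f z) = (cplx b (frechet_derivative f (at z) 1) - \<i> * cplx b (frechet_derivative f (at z) \<i>)) / 2"
  "chi (-\<i>) b (d_z f z) = cnj ((cplx b (frechet_derivative f (at z) 1) + \<i> * cplx b (frechet_derivative f (at z) \<i>)) / 2)"
  "chi \<i> b (d_zbar f z) = (cplx b (frechet_derivative f (at z) 1) + \<i> * cplx b (frechet_derivative f (at z) \<i>)) / 2"
  "chi (-\<i>) b (d_zbar f z) = cnj ((cplx b (frechet_derivative f (at z) 1) - \<i> * cplx b (frechet_derivative f (at z) \<i>)) / 2)"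
  by (simp_all add: d_z_def d_zbar_def)

lemma chi_d_zbar: "chi \<i> b (d_zbar f z) = cnj (chi (-\<i>) b (d_z f z))"
  "chi (-\<i>) b (d_zbar f z) = cnj (chi \<i> b (d_z f z))"
  by (simp_all add: chi_d_z)

lemma cplx_has_derivative:
  assumes "f differentiable (at z)"
  shows "((\<lambda>z. cplx b (f z)) has_derivative
     (\<lambda>v. chi \<i> b (d_z f z) * v + cnj (chi (-\<i>) b (d_z f z)) * cnj v)) (at z)"
proof -
  define D where "D = (\<lambda>v. cplx b (frechet_derivative f (at z) v))"
  have "((\<lambda>z. cplx b (f z)) has_derivative D) (at z)"
    unfolding D_def using assms
    by (intro bounded_linear.has_derivative[OF bounded_linear_cplx]) (simp add: frechet_derivative_works)
  moreover from this have "bounded_linear D" by (rule has_derivative_bounded_linear)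
  then have "D v = chi \<i> b (d_z f z) * v + cnj (chi (-\<i>) b (d_z f z)) * cnj v" for v
    by (subst real_linear_complex) (simp_all add: chi_d_z D_def)
  then have "D = (\<lambda>v. chi \<i> b (d_z f z) * v + cnj (chi (-\<i>) b (d_z f z)) * cnj v)" by (rule ext)
  ultimately show ?thesis by simp
qed

text \<open>A map with values in \<open>\<real>\<^sup>4\<close> is real, so the coordinates with \<open>\<sigma> = -i\<close> of \<open>f\<^sub>z\<close> are the
  conjugates of the derivatives of its complex coordinates with respect to the conjugate variable.\<close>

lemma d_z_of_cplx:
  assumes "\<And>b. ((\<lambda>z. cplx b (f z)) has_derivative (\<lambda>v. A b * v + B b * cnj v)) (at z)"
    and "f differentiable (at z)"
  shows "chi \<i> b (d_z f z) = A b" "chi (-\<i>) b (d_z f z) = cnj (B b)"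
proof -
  have eq: "(\<lambda>v. A b * v + B b * cnj v) = (\<lambda>v. chi \<i> b (d_z f z) * v + cnj (chi (-\<i>) b (d_z f z)) * cnj v)"
    by (rule has_derivative_unique[OF assms(1) cplx_has_derivative[OF assms(2)]])
  have 1: "A b + B b = chi \<i> b (d_z f z) + cnj (chi (-\<i>) b (d_z f z))"
    using fun_cong[OF eq, of 1] by simp
  have "A b * \<i> - B b * \<i> = chi \<i> b (d_z f z) * \<i> - cnj (chi (-\<i>) b (d_z f z)) * \<i>"
    using fun_cong[OF eq, of \<i>] by simp
  then have "(A b - B b) * \<i> = (chi \<i> b (d_z f z) - cnj (chi (-\<i>) b (d_z f z))) * \<i>"
    by (simp add: algebra_simps)
  then have 2: "A b - B b = chi \<i> b (d_z f z) - cnj (chi (-\<i>) b (d_z f z))" by simp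
  from 1 2 show "chi \<i> b (d_z f z) = A b" by (simp add: complex_eq_iff)
  from 1 2 have "cnj (chi (-\<i>) b (d_z f z)) = B b" by (simp add: complex_eq_iff)
  then show "chi (-\<i>) b (d_z f z) = cnj (B b)" by (metis complex_cnj_cnj)
qed

lemma differentiable_of_cplx:
  assumes "\<And>b. (\<lambda>z. cplx b (f z)) differentiable (at z)"
  shows "f differentiable (at z)"
proof -
  have f: "f = (\<lambda>z. Re (cplx False (f z)) *\<^sub>R axis 1 1 + Im (cplx False (f z)) *\<^sub>R axis 2 1 +
     Re (cplx True (f z)) *\<^sub>R axis 3 1 + Im (cplx True (f z)) *\<^sub>R axis 4 1)"
    by (rule ext) (simp add: cplx_def vec_eq_iff forall_4 axis_def)
  have lin: "(\<lambda>z. g (cplx b (f z)) *\<^sub>R w) differentiable (at z)"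
    if "bounded_linear g" for g b and w :: "real^4"
  proof -
    obtain D where "((\<lambda>z. cplx b (f z)) has_derivative D) (at z)"
      using assms by (auto simp: differentiable_def)
    from bounded_linear.has_derivative[OF that this]
    have "((\<lambda>z. g (cplx b (f z))) has_derivative (\<lambda>v. g (D v))) (at z)" .
    from has_derivative_scaleR_left[OF this, of w] show ?thesis by (auto simp: differentiable_def)
  qed
  show ?thesis
    by (subst f) (intro differentiable_add lin bounded_linear_Re bounded_linear_Im)
qed

lemma Ck_const: "Ck n (\<lambda>_. c)"
  by (induction n arbitrary: c) (auto simp: differentiable_on_def)

lemma Ck_linear:
  assumes L: "bounded_linear L"
  shows "Ck n f \<Longrightarrow> Ck n (\<lambda>x. L (f x))"
proof (induction n arbitrary: f)
  case 0
  then show ?case using bounded_linear.continuous_on[OF L] by simp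
next
  case (Suc n)
  have D: "((\<lambda>x. L (f x)) has_derivative (\<lambda>v. L (frechet_derivative f (at x) v))) (at x)" for x
    using Suc.prems by (intro bounded_linear.has_derivative[OF L])
      (simp add: differentiable_on_def frechet_derivative_works)
  have "(\<lambda>x. L (f x)) differentiable_on UNIV"
    using D by (auto simp: differentiable_on_def differentiable_def)
  moreover have "frechet_derivative (\<lambda>x. L (f x)) (at x) = (\<lambda>v. L (frechet_derivative f (at x) v))" for x
    using frechet_derivative_at[OF D] by simp
  ultimately show ?case using Suc by simp
qed

lemma Ck_add: "Ck n f \<Longrightarrow> Ck n g \<Longrightarrow> Ck n (\<lambda>x. f x + g x)"
proof (induction n arbitrary: f g)
  case 0
  then show ?case by (simp add: continuous_on_add)
next
  case (Suc n)
  have D: "((\<lambda>x. f x + g x) has_derivative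
      (\<lambda>v. frechet_derivative f (at x) v + frechet_derivative g (at x) v)) (at x)" for x
    using Suc.prems by (intro has_derivative_add) (simp_all add: differentiable_on_def frechet_derivative_works)
  have "(\<lambda>x. f x + g x) differentiable_on UNIV"
    using D by (auto simp: differentiable_on_def differentiable_def)
  moreover have "frechet_derivative (\<lambda>x. f x + g x) (at x) =
      (\<lambda>v. frechet_derivative f (at x) v + frechet_derivative g (at x) v)" for x
    using frechet_derivative_at[OF D] by simp
  ultimately show ?case using Suc by simp
qed

lemma exp_inner_derivative:
  "((\<lambda>z. exp (\<sigma> * of_real (r * inner \<delta> z))) has_derivative
      (\<lambda>v. \<sigma> * of_real (r * inner \<delta> v) * exp (\<sigma> * of_real (r * inner \<delta> z)))) (at z)"
  for \<sigma> :: complex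
proof -
  have "((\<lambda>z. \<sigma> * of_real (r * inner \<delta> z)) has_derivative (\<lambda>v. \<sigma> * of_real (r * inner \<delta> v))) (at z)"
    by (intro has_derivative_mult_right has_derivative_of_real has_derivative_inner_right has_derivative_ident)
  from has_derivative_compose[OF this has_field_derivative_imp_has_derivative[OF DERIV_exp]]
  show ?thesis by (simp add: mult.commute)
qed

lemma cis_inner_derivative:
  "((\<lambda>z. k * cis (inner \<delta> z)) has_derivative (\<lambda>v. (k * \<i> * of_real (inner \<delta> v)) * cis (inner \<delta> z))) (at z)"
proof -
  have "((\<lambda>z. k * exp (\<i> * of_real (1 * inner \<delta> z))) has_derivative
      (\<lambda>v. k * (\<i> * of_real (1 * inner \<delta> v) * exp (\<i> * of_real (1 * inner \<delta> z))))) (at z)"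
    by (intro has_derivative_mult_right exp_inner_derivative)
  then show ?thesis by (simp add: cis_conv_exp mult_ac)
qed

lemma Ck_cis: "Ck n (\<lambda>z. k * cis (inner \<delta> z))"
proof (induction n arbitrary: k)
  case 0
  show ?case by (simp add: cis_conv_exp) (intro continuous_intros)
next
  case (Suc n)
  have "(\<lambda>z. k * cis (inner \<delta> z)) differentiable_on UNIV"
    using cis_inner_derivative by (auto simp: differentiable_on_def differentiable_def)
  moreover have "frechet_derivative (\<lambda>z. k * cis (inner \<delta> z)) (at z) =
     (\<lambda>v. (k * \<i> * of_real (inner \<delta> v)) * cis (inner \<delta> z))" for z
    by (rule frechet_derivative_at[OF cis_inner_derivative, symmetric])
  ultimately show ?case using Suc by simp
qed

lemma smooth_const: "smooth (\<lambda>_. c)" by (simp add: smooth_def Ck_const)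
lemma smooth_linear: "bounded_linear L \<Longrightarrow> smooth f \<Longrightarrow> smooth (\<lambda>x. L (f x))"
  by (simp add: smooth_def Ck_linear)
lemma smooth_add: "smooth f \<Longrightarrow> smooth g \<Longrightarrow> smooth (\<lambda>x. f x + g x)"
  by (simp add: smooth_def Ck_add)
lemma smooth_cis: "smooth (\<lambda>z. k * cis (inner \<delta> z))" by (simp add: smooth_def Ck_cis)
lemma smooth_sum: "(\<And>i. i \<in> A \<Longrightarrow> smooth (f i)) \<Longrightarrow> smooth (\<lambda>x. \<Sum>i\<in>A. f i x)"
  by (induction A rule: infinite_finite_induct) (auto intro: smooth_const smooth_add)
lemma smooth_differentiable: "smooth f \<Longrightarrow> f differentiable (at z)"
proof -
  assume "smooth f"
  then have "Ck (Suc 0) f" by (simp only: smooth_def)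
  then show ?thesis by (simp add: differentiable_on_def)
qed

text \<open>One coordinate \<open>y = chi \<sigma> b x\<close> of the equation for the spectral solution: \<open>a\<close> and \<open>b\<close> are the
  corresponding coordinates of \<open>e\<^bsup>-J\<beta>/2\<^esup>f\<^sub>z\<close> and of the derivative with respect to the conjugate
  variable.\<close>

definition component_flow :: "complex \<Rightarrow> complex \<Rightarrow> complex set \<Rightarrow> complex \<Rightarrow> complex \<Rightarrow> complex \<Rightarrow> complex \<Rightarrow> complex \<Rightarrow> complex" where
  "component_flow \<sigma> \<beta>0 S l a b y v = poly (root_poly S) l * (v * a + l * cnj v * b)
     - (of_real (pi / 2) * (inverse l * cnj \<beta>0 * v + l * \<beta>0 * cnj v)) * (\<sigma> * y)"

lemma complex_inner_eq: "of_real (inner a v) = (a * cnj v + cnj a * v) / 2"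
  by (simp add: complex_eq_iff inner_complex_def)

lemma cnj_unit: "cmod s = 1 \<Longrightarrow> cnj s = inverse s"
  using complex_norm_square[of s] by (simp add: inverse_unique[symmetric])

text \<open>At a root of \<open>p\<close> the inhomogeneous term disappears, and on the unit circle the remaining
  one-form \<open>\<pi>/2 (\<lambda>\<^sup>-\<^sup>1 cnj \<beta>\<^sub>0 dz + \<lambda>\<beta>\<^sub>0 cnj dz)\<close> is the differential of the real function
  \<open>\<pi>\<langle>\<beta>\<^sub>0s,z\<rangle>\<close>.\<close>

lemma component_flow_at_root:
  assumes S: "finite S" "s \<in> S" "cmod s = 1"
    and ode: "\<And>z. (y has_derivative component_flow \<sigma> \<beta>0 S s (a z) (b z) (y z)) (at z)"
  shows "y z = y 0 * exp (- \<sigma> * of_real (pi * inner (\<beta>0 * s) z))"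
proof -
  have p: "poly (root_poly S) s = 0" using S by (simp add: poly_root_poly_eq_0_iff)
  define e where "e = (\<lambda>z. exp (\<sigma> * of_real (pi * inner (\<beta>0 * s) z)))"
  have e: "(e has_derivative (\<lambda>v. \<sigma> * of_real (pi * inner (\<beta>0 * s) v) * e z)) (at z)" for z
    unfolding e_def by (rule exp_inner_derivative)
  have k: "of_real (pi / 2) * (inverse s * cnj \<beta>0 * v + s * \<beta>0 * cnj v) = (of_real (pi * inner (\<beta>0 * s) v) :: complex)" for v
    using cnj_unit[OF S(3)] by (simp add: complex_inner_eq field_simps)
  have "((\<lambda>z. y z * e z) has_derivative (\<lambda>v. 0)) (at z)" for z
  proof -
    have "((\<lambda>z. y z * e z) has_derivative (\<lambda>v. y z * (\<sigma> * of_real (pi * inner (\<beta>0 * s) v) * e z) +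
        component_flow \<sigma> \<beta>0 S s (a z) (b z) (y z) v * e z)) (at z)"
      by (rule has_derivative_mult[OF ode e])
    moreover have "y z * (\<sigma> * of_real (pi * inner (\<beta>0 * s) v) * e z) +
        component_flow \<sigma> \<beta>0 S s (a z) (b z) (y z) v * e z = 0" for v
      unfolding component_flow_def k p by (simp add: algebra_simps)
    ultimately show ?thesis by simp
  qed
  then have "\<exists>c. \<forall>z\<in>UNIV. y z * e z = c"
    by (intro has_derivative_zero_constant) (auto intro: has_derivative_at_withinI)
  then have "y z * e z = y 0 * e 0" by auto
  then have "y z * e z * exp (- \<sigma> * of_real (pi * inner (\<beta>0 * s) z)) = y 0 * exp (- \<sigma> * of_real (pi * inner (\<beta>0 * s) z))"
    by (simp add: e_def)
  then show ?thesis by (simp add: e_def mult.assoc exp_add[symmetric])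
qed

lemma double_half: "2 * ((x::complex) / 2) = x" by simp

lemma double_cancel: "2 * (x::complex) = 2 * y \<Longrightarrow> x = y" by simp

text \<open>Solutions of the scalar equation that are polynomial in \<open>\<lambda>\<close>. The
  coefficients are differentiated once, when powers of \<open>\<lambda>\<close> are compared.\<close>

definition scalar_solution :: "complex \<Rightarrow> complex \<Rightarrow> complex set \<Rightarrow> (complex \<Rightarrow> complex \<Rightarrow> complex)
    \<Rightarrow> (complex \<Rightarrow> complex) \<Rightarrow> (complex \<Rightarrow> complex) \<Rightarrow> bool" where
  "scalar_solution \<sigma> \<beta>0 S w a b \<longleftrightarrow>
     (\<exists>n c. (\<forall>k z. (c k :: complex \<Rightarrow> complex) differentiable (at z)) \<and>
        (\<forall>l z. w l z = (\<Sum>k\<le>n. l ^ k * c k z))) \<and>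
     (\<forall>l z. l \<noteq> 0 \<longrightarrow> (w l has_derivative component_flow \<sigma> \<beta>0 S l (a z) (b z) (w l z)) (at z))"

text \<open>A solution \<open>w\<close> that vanishes at \<open>z = 0\<close> vanishes for all \<open>z\<close> at the roots of \<open>p\<close>. The lowest
  coefficient of the \<open>dz\<close>-part of the equation shows \<open>w = 0\<close> at \<open>\<lambda> = 0\<close>, and the coefficients of
  the other part above degree \<open>N\<close> show inductively, from the top, that \<open>w\<close> has degree at most
  \<open>N\<close> in \<open>\<lambda>\<close>. A polynomial of degree at most \<open>N\<close> with these \<open>N + 1\<close> roots is zero.\<close>

lemma scalar_solution_vanishes:
  assumes S: "finite S" "S \<subseteq> {s. cmod s = 1}" and \<beta>0: "\<beta>0 \<noteq> 0" and \<sigma>: "\<sigma> \<noteq> 0"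
    and sol: "scalar_solution \<sigma> \<beta>0 S w a b"
    and init: "\<And>l. l \<noteq> 0 \<Longrightarrow> w l 0 = 0"
  shows "a z = 0 \<and> b z = 0"
proof -
  obtain n and c :: "nat \<Rightarrow> complex \<Rightarrow> complex" where c: "\<And>k z. c k differentiable (at z)"
    and w: "\<And>l z. w l z = (\<Sum>k\<le>n. l ^ k * c k z)"
    using sol unfolding scalar_solution_def by blast
  have ode: "(w l has_derivative component_flow \<sigma> \<beta>0 S l (a z) (b z) (w l z)) (at z)" if "l \<noteq> 0" for l z
    using sol that unfolding scalar_solution_def by blast
  define N where "N = card S"
  define p where "p = root_poly S"
  have deg_p: "degree p = N" and p0: "p \<noteq> 0" unfolding p_def N_def using S by (simp_all add: degree_root_poly)
  have S0: "s \<noteq> 0" if "s \<in> S" for s using S that by force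
  have van: "w s z = 0" if "s \<in> S" for s z
    using component_flow_at_root[OF S(1) that _ ode[OF S0[OF that]]] S(2) that init[OF S0[OF that]] by force
  define d where "d = (\<lambda>k z. frechet_derivative (c k) (at z))"
  define C where "C = (\<lambda>z. \<Sum>k\<le>n. monom (c k z) k)"
  define dz where "dz = (\<lambda>k z. (d k z 1 - \<i> * d k z \<i>) / 2)"
  define dzb where "dzb = (\<lambda>k z. (d k z 1 + \<i> * d k z \<i>) / 2)"
  define Cz where "Cz = (\<lambda>z. \<Sum>k\<le>n. monom (dz k z) k)"
  define Czb where "Czb = (\<lambda>z. \<Sum>k\<le>n. monom (dzb k z) k)"
  define m where "m = of_real (pi / 2) * \<sigma>"
  have m0: "m \<noteq> 0" using \<sigma> by (simp add: m_def)
  have pC: "poly (C z) l = w l z" for l z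
    by (simp add: C_def w poly_sum poly_monom mult.commute)
  have cC: "coeff (C z) k = (if k \<le> n then c k z else 0)" for k z
    by (simp add: C_def coeff_sum sum.delta)
  have cCzb: "coeff (Czb z) k = (if k \<le> n then dzb k z else 0)" for k z
    by (simp add: Czb_def coeff_sum sum.delta)
  have D: "(\<Sum>k\<le>n. l ^ k * d k z v) = component_flow \<sigma> \<beta>0 S l (a z) (b z) (w l z) v" if "l \<noteq> 0" for l z v
  proof -
    have "((\<lambda>z. \<Sum>k\<le>n. l ^ k * c k z) has_derivative (\<lambda>v. \<Sum>k\<le>n. l ^ k * d k z v)) (at z)"
      unfolding d_def using c by (intro has_derivative_sum has_derivative_mult_right) (simp add: frechet_derivative_works)
    moreover have "w l = (\<lambda>z. \<Sum>k\<le>n. l ^ k * c k z)" by (rule ext) (rule w)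
    ultimately show ?thesis using has_derivative_unique[OF ode[OF that]] by (metis (no_types, lifting))
  qed
  have flow: "component_flow \<sigma> \<beta>0 S l a b y v =
      poly p l * (v * a + l * cnj v * b) - m * (inverse l * cnj \<beta>0 * v + l * \<beta>0 * cnj v) * y" for l a b y v
    by (simp add: component_flow_def p_def m_def mult_ac)
  have pz: "l * poly (Cz z) l = l * (poly p l * a z) - m * cnj \<beta>0 * w l z" if "l \<noteq> 0" for l z
  proof -
    have "2 * poly (Cz z) l = (\<Sum>k\<le>n. l ^ k * d k z 1) - \<i> * (\<Sum>k\<le>n. l ^ k * d k z \<i>)"
    proof -
      have "2 * poly (Cz z) l = (\<Sum>k\<le>n. l ^ k * (2 * dz k z))"
        by (simp add: Cz_def poly_sum poly_monom sum_distrib_left mult_ac)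
      also have "\<dots> = (\<Sum>k\<le>n. l ^ k * (d k z 1 - \<i> * d k z \<i>))" by (simp only: dz_def double_half)
      also have "\<dots> = (\<Sum>k\<le>n. l ^ k * d k z 1) - \<i> * (\<Sum>k\<le>n. l ^ k * d k z \<i>)"
        by (simp add: right_diff_distrib sum_subtractf sum_distrib_left mult_ac)
      finally show ?thesis .
    qed
    also have "\<dots> = 2 * (poly p l * a z - m * (inverse l * cnj \<beta>0) * w l z)"
      unfolding D[OF that] flow by (simp add: algebra_simps)
    finally have "poly (Cz z) l = poly p l * a z - m * (inverse l * cnj \<beta>0) * w l z"
      by (rule double_cancel)
    moreover have "l * (m * (inverse l * cnj \<beta>0) * w l z) = m * cnj \<beta>0 * w l z" using that by simp
    ultimately show ?thesis by (simp only: right_diff_distrib)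
  qed
  have pzb: "poly (Czb z) l = l * (poly p l * b z) - m * \<beta>0 * l * w l z" if "l \<noteq> 0" for l z
  proof -
    have "2 * poly (Czb z) l = (\<Sum>k\<le>n. l ^ k * d k z 1) + \<i> * (\<Sum>k\<le>n. l ^ k * d k z \<i>)"
    proof -
      have "2 * poly (Czb z) l = (\<Sum>k\<le>n. l ^ k * (2 * dzb k z))"
        by (simp add: Czb_def poly_sum poly_monom sum_distrib_left mult_ac)
      also have "\<dots> = (\<Sum>k\<le>n. l ^ k * (d k z 1 + \<i> * d k z \<i>))" by (simp only: dzb_def double_half)
      also have "\<dots> = (\<Sum>k\<le>n. l ^ k * d k z 1) + \<i> * (\<Sum>k\<le>n. l ^ k * d k z \<i>)"
        by (simp add: distrib_left sum.distrib sum_distrib_left mult_ac)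
      finally show ?thesis .
    qed
    also have "\<dots> = 2 * (l * (poly p l * b z) - m * \<beta>0 * l * w l z)"
      unfolding D[OF that] flow by (simp add: algebra_simps)
    finally show ?thesis by (rule double_cancel)
  qed
  \<comment> \<open>For fixed \<open>z\<close> the two parts of the equation, the first one multiplied by \<open>\<lambda>\<close>, are
    identities of polynomials in \<open>\<lambda>\<close>; they extend to \<open>\<lambda> = 0\<close>.\<close>
  have id1: "pCons 0 (Cz z) = pCons 0 (smult (a z) p) - smult (m * cnj \<beta>0) (C z)" for z
    by (rule poly_eqI_cofinite[of "{0}"]) (use pz in \<open>auto simp: pC mult_ac\<close>)
  have id2: "Czb z = pCons 0 (smult (b z) p - smult (m * \<beta>0) (C z))" for z
    by (rule poly_eqI_cofinite[of "{0}"]) (use pzb in \<open>auto simp: pC algebra_simps\<close>)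
  have C0: "poly (C z) 0 = 0" for z
    using arg_cong[OF id1[of z], of "\<lambda>q. poly q 0"] m0 \<beta>0 by simp
  \<comment> \<open>Descending induction: the coefficient of \<open>\<lambda>\<^bsup>k+1\<^esup>\<close> in \<open>id2\<close> involves only
    the coefficients \<open>k\<close> and \<open>k + 1\<close> of \<open>w\<close> once \<open>k > N\<close>.\<close>
  have high: "coeff (C z) k = 0" if "N < k" for k z
    using that
  proof (induction "Suc n - k" arbitrary: k z rule: less_induct)
    case less
    show ?case
    proof (cases "k \<le> n")
      case True
      have "coeff (C z) (Suc k) = 0" for z using less True by (intro less.hyps) auto
      then have "c (Suc k) = (\<lambda>_. 0)" if "Suc k \<le> n" using that by (auto simp: cC fun_eq_iff)
      then have "coeff (Czb z) (Suc k) = 0"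
        by (simp add: cCzb dzb_def d_def frechet_derivative_const)
      moreover have "coeff p k = 0" using less deg_p by (simp add: coeff_eq_0)
      ultimately show ?thesis using m0 \<beta>0 unfolding id2 by simp
    qed (simp add: cC)
  qed
  have C_0: "C z = 0" for z
  proof (rule poly_eqI_degree[of "insert 0 S"])
    have "degree (C z) \<le> N" using high by (intro degree_le) auto
    moreover have "card (insert 0 S) = Suc N" using S S0 by (auto simp: N_def card_insert_if)
    ultimately show "degree (C z) < card (insert 0 S)" "degree 0 < card (insert 0 S)" by auto
    show "poly (C z) x = poly 0 x" if "x \<in> insert 0 S" for x
      using that C0 van by (auto simp: pC)
  qed
  have "c k = (\<lambda>_. 0)" if "k \<le> n" for k using C_0 cC[of _ k] that by (auto simp: fun_eq_iff)
  then have "Cz z = 0" "Czb z = 0"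
    by (simp_all add: Cz_def Czb_def dz_def dzb_def d_def frechet_derivative_const)
  then show ?thesis using id1[of z] id2[of z] C_0 p0 by simp
qed

lemma component_flow_diff:
  "component_flow \<sigma> \<beta>0 S l a b y v - component_flow \<sigma> \<beta>0 S l a' b' y' v =
     component_flow \<sigma> \<beta>0 S l (a - a') (b - b') (y - y') v"
proof -
  have "P * (v * a + q * b) - k * (\<sigma> * y) - (P * (v * a' + q * b') - k * (\<sigma> * y')) =
     P * (v * (a - a') + q * (b - b')) - k * (\<sigma> * (y - y'))" for P q k
    by (simp add: algebra_simps)
  then show ?thesis unfolding component_flow_def .
qed

lemma scalar_solution_diff:
  assumes "scalar_solution \<sigma> \<beta>0 S w a b" "scalar_solution \<sigma> \<beta>0 S w' a' b'"
  shows "scalar_solution \<sigma> \<beta>0 S (\<lambda>l z. w l z - w' l z) (\<lambda>z. a z - a' z) (\<lambda>z. b z - b' z)"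
  unfolding scalar_solution_def
proof (intro conjI allI impI)
  obtain n and c :: "nat \<Rightarrow> complex \<Rightarrow> complex" where c: "\<And>k z. c k differentiable (at z)"
    "\<And>l z. w l z = (\<Sum>k\<le>n. l ^ k * c k z)"
    using assms(1) unfolding scalar_solution_def by blast
  obtain n' and c' :: "nat \<Rightarrow> complex \<Rightarrow> complex" where c': "\<And>k z. c' k differentiable (at z)"
    "\<And>l z. w' l z = (\<Sum>k\<le>n'. l ^ k * c' k z)"
    using assms(2) unfolding scalar_solution_def by blast
  define C where "C = (\<lambda>k z. (if k \<le> n then c k z else 0) - (if k \<le> n' then c' k z else 0))"
  have e: "(\<Sum>k\<le>max n n'. l ^ k * (if k \<le> i then f k else 0)) = (\<Sum>k\<le>i. l ^ k * f k)"
    if "i \<le> max n n'" for i l and f :: "nat \<Rightarrow> complex"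
    using that by (intro sum.mono_neutral_cong_right) auto
  have "C k differentiable (at z)" for k z
    unfolding C_def using c c' by (cases "k \<le> n"; cases "k \<le> n'") (auto intro!: derivative_intros)
  moreover have "w l z - w' l z = (\<Sum>k\<le>max n n'. l ^ k * C k z)" for l z
    using e[of n l "\<lambda>k. c k z"] e[of n' l "\<lambda>k. c' k z"]
    by (simp add: C_def c c' right_diff_distrib sum_subtractf)
  ultimately show "\<exists>n C. (\<forall>k z. (C k :: complex \<Rightarrow> complex) differentiable (at z)) \<and>
      (\<forall>l z. w l z - w' l z = (\<Sum>k\<le>n. l ^ k * C k z))" by blast
  fix l z :: complex assume l: "l \<noteq> 0"
  have D: "(w l has_derivative component_flow \<sigma> \<beta>0 S l (a z) (b z) (w l z)) (at z)"
    "(w' l has_derivative component_flow \<sigma> \<beta>0 S l (a' z) (b' z) (w' l z)) (at z)"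
    using assms l unfolding scalar_solution_def by blast+
  show "((\<lambda>z. w l z - w' l z) has_derivative
      component_flow \<sigma> \<beta>0 S l (a z - a' z) (b z - b' z) (w l z - w' l z)) (at z)"
    using has_derivative_diff[OF D] by (simp add: component_flow_diff)
qed

lemma scalar_solution_unique:
  assumes "finite S" "S \<subseteq> {s. cmod s = 1}" "\<beta>0 \<noteq> 0" "\<sigma> \<noteq> 0"
    and sol: "scalar_solution \<sigma> \<beta>0 S w a b" "scalar_solution \<sigma> \<beta>0 S w' a' b'"
    and init: "\<And>l. l \<noteq> 0 \<Longrightarrow> w l 0 = w' l 0"
  shows "a z = a' z" "b z = b' z"
  using scalar_solution_vanishes[OF assms(1-4) scalar_solution_diff[OF sol], of z] init by auto

section \<open>The immersion attached to a polynomial\<close>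

text \<open>The exponential \<open>e\<^bsup>\<mp>2\<pi>i\<langle>\<gamma>,z\<rangle>\<^esup>\<close> with \<open>\<gamma> = \<beta>\<^sub>0s/2\<close> that solves the equation at the root \<open>s\<close>.\<close>

definition expmode :: "complex \<Rightarrow> complex \<Rightarrow> complex \<Rightarrow> complex \<Rightarrow> complex" where
  "expmode \<beta>0 \<sigma> s z = exp (- \<sigma> * of_real (pi * inner (\<beta>0 * s) z))"

text \<open>This is \<open>p'(s)\<close>.\<close>

definition root_weight :: "complex set \<Rightarrow> complex \<Rightarrow> complex" where
  "root_weight S s = poly (root_poly (S - {s})) s"

definition lagrange_basis :: "complex set \<Rightarrow> complex \<Rightarrow> complex poly" where
  "lagrange_basis S s = smult (1 / root_weight S s) (root_poly (S - {s}))"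

text \<open>The solution of the scalar equation with value \<open>s W(s)\<close> at \<open>\<lambda> = s\<close>, \<open>z = 0\<close>, and the two
  functions \<open>a\<close> and \<open>b\<close> that belong to it, which are its lowest and its highest coefficient in \<open>\<lambda>\<close>
  up to constant factors.\<close>

definition spectral_mode where
  "spectral_mode \<beta>0 S \<sigma> W l z = l * (\<Sum>s\<in>S. W s * poly (lagrange_basis S s) l * expmode \<beta>0 \<sigma> s z)"

definition hol_part where
  "hol_part \<beta>0 S \<sigma> W z = - \<sigma> * of_real (pi / 2) * cnj \<beta>0 * (\<Sum>s\<in>S. W s / (s * root_weight S s) * expmode \<beta>0 \<sigma> s z)"

definition antihol_part where
  "antihol_part \<beta>0 S \<sigma> W z = \<sigma> * of_real (pi / 2) * \<beta>0 * (\<Sum>s\<in>S. W s / root_weight S s * expmode \<beta>0 \<sigma> s z)"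

text \<open>The effect on the weights of complex conjugation of the solutions, and of the substitution
  \<open>s \<mapsto> -s\<close>, which exchanges the exponentials for \<open>\<sigma> = i\<close> and \<open>\<sigma> = -i\<close>.\<close>

definition conj_weights :: "complex set \<Rightarrow> (complex \<Rightarrow> complex) \<Rightarrow> complex \<Rightarrow> complex" where
  "conj_weights S W s = - s * root_weight S s * cnj (W s / root_weight S s)"

definition flip_weights :: "complex set \<Rightarrow> (complex \<Rightarrow> complex) \<Rightarrow> complex \<Rightarrow> complex" where
  "flip_weights S W s = W (- s) * root_weight S s / root_weight S (- s)"

text \<open>The weights of \<open>F\<^sub>1\<close> are free; those of \<open>F\<^sub>2\<close> are forced by the equation of a Hamiltonian
  stationary Lagrangian immersion (\<open>hsl_relations\<close>).\<close>

definition weights :: "complex set \<Rightarrow> (complex \<Rightarrow> complex) \<Rightarrow> bool \<Rightarrow> complex \<Rightarrow> complex" where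
  "weights S Q b s = (if b then - \<i> * flip_weights S (conj_weights S Q) s else Q s)"

text \<open>Up to a constant factor this is \<open>e\<^bsup>i\<beta>/2\<^esup>\<close> times the spectral mode at \<open>\<lambda> = 1\<close>: there the
  equation for the spectral solution says that \<open>e\<^bsup>J\<beta>/2\<^esup>x\<close> is a primitive of \<open>p(1)df\<close>.\<close>

definition primitive where
  "primitive \<beta>0 S W z = (\<Sum>s\<in>S. W s / (root_weight S s * (1 - s)) * cis (inner (of_real pi * (\<beta>0 - \<beta>0 * s)) z))"

definition hsl_map :: "complex \<Rightarrow> complex set \<Rightarrow> (complex \<Rightarrow> complex) \<Rightarrow> complex \<Rightarrow> real ^ 4" where
  "hsl_map \<beta>0 S Q z = of_cplx (\<lambda>b. primitive \<beta>0 S (weights S Q b) z - primitive \<beta>0 S (weights S Q b) 0)"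

definition hsl_solution :: "complex \<Rightarrow> complex set \<Rightarrow> (complex \<Rightarrow> complex) \<Rightarrow> complex \<Rightarrow> complex \<Rightarrow> complex ^ 4" where
  "hsl_solution \<beta>0 S Q l z = of_chi (\<lambda>\<sigma> b.
     spectral_mode \<beta>0 S \<sigma> (if \<sigma> = \<i> then weights S Q b else conj_weights S (weights S Q b)) l z)"

text \<open>Each summand of the next two derivative computations is a ring identity. With the inverses
  as separate variables no division remains.\<close>

lemma mode_term_identity:
  fixes s si w wi l li L v v' \<sigma> c B B' W e :: complex
  assumes "s * si = 1" "w * wi = 1" "l * li = 1"
  shows "(l - s) * w * L * (v * (- \<sigma> * c * B' * (W * si * wi * e)) + l * v' * (\<sigma> * c * B * (W * wi * e)))
      - c * (li * B' * v + l * B * v') * (\<sigma> * (l * (W * L * e)))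
    = l * (W * L * (- \<sigma> * (c * (B * s * v' + B' * v * si)) * e))"
proof -
  define x where "x = \<sigma> * c * W * L * e"
  have "(l - s) * w * L * (v * (- \<sigma> * c * B' * (W * si * wi * e)) + l * v' * (\<sigma> * c * B * (W * wi * e)))
      - c * (li * B' * v + l * B * v') * (\<sigma> * (l * (W * L * e)))
    = x * (w * wi) * (B' * v * (s * si - l * si) + (l - s) * l * v' * B) - x * (B' * v * (l * li) + l * l * B * v')"
    unfolding x_def by (simp add: algebra_simps)
  also have "\<dots> = l * (W * L * (- \<sigma> * (c * (B * s * v' + B' * v * si)) * e))"
    unfolding assms x_def by (simp add: algebra_simps)
  finally show ?thesis .
qed

lemma primitive_term_identity:
  fixes s si wi ui v v' c B B' W e h j :: complex
  assumes "s * si = 1" "(1 - s) * ui = 1"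
  shows "h * (- j * c * B' * (W * si * wi * e)) * v + h * (j * c * B * (W * wi * e)) * v'
    = (W * (wi * ui) * j * (c * (B * (1 - s) * v' + B' * (1 - si) * v))) * (h * e)"
proof -
  define x where "x = j * c * W * wi * h * e"
  have "(W * (wi * ui) * j * (c * (B * (1 - s) * v' + B' * (1 - si) * v))) * (h * e) =
    x * (B * v' * ((1 - s) * ui) + B' * v * (ui - si * ui))"
    unfolding x_def by (simp add: algebra_simps)
  also have "ui - si * ui = - si * ((1 - s) * ui)"
  proof -
    have "- si * ((1 - s) * ui) = (s * si) * ui - si * ui" by (simp add: algebra_simps)
    then show ?thesis unfolding assms(1) by simp
  qed
  also have "x * (B * v' * ((1 - s) * ui) + B' * v * (- si * ((1 - s) * ui))) =
    h * (- j * c * B' * (W * si * wi * e)) * v + h * (j * c * B * (W * wi * e)) * v'"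
    unfolding assms x_def by (simp add: algebra_simps)
  finally show ?thesis by simp
qed

lemma sum_collect:
  fixes X Y Z :: "complex \<Rightarrow> complex"
  shows "P * (v * (A * (\<Sum>s\<in>S. X s)) + q * (B * (\<Sum>s\<in>S. Y s))) - k * (\<sigma> * (l * (\<Sum>s\<in>S. Z s))) =
    (\<Sum>s\<in>S. P * (v * (A * X s) + q * (B * Y s)) - k * (\<sigma> * (l * Z s)))"
  by (simp add: sum_distrib_left sum.distrib sum_subtractf distrib_left)

text \<open>The properties of \<open>\<SS>\<^sub>\<Delta>\<close> used for the explicit solutions. The point \<open>1\<close> is excluded because the
  immersion is obtained by evaluation at \<open>\<lambda> = 1\<close>.\<close>

locale unit_roots =
  fixes \<beta>0 :: complex and S :: "complex set"
  assumes \<beta>0: "\<beta>0 \<noteq> 0" and finS: "finite S" and neS: "S \<noteq> {}"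
    and unitS: "S \<subseteq> {s. cmod s = 1}" and symS: "uminus ` S = S" and one_notin: "1 \<notin> S"
begin

lemma S_nz: "s \<in> S \<Longrightarrow> s \<noteq> 0" using unitS by force
lemma S_minus: "s \<in> S \<Longrightarrow> - s \<in> S" using symS by blast
lemma S_cnj: "s \<in> S \<Longrightarrow> cnj s = inverse s" using unitS by (auto intro: cnj_unit)

lemma root_weight_nz: "s \<in> S \<Longrightarrow> root_weight S s \<noteq> 0"
  using finS by (simp add: root_weight_def poly_root_poly_eq_0_iff)

lemma root_poly_at:
  assumes "s \<in> S" shows "poly (root_poly S) l = (l - s) * root_weight S s * poly (lagrange_basis S s) l"
proof -
  have "root_poly S = root_poly {s} * root_poly (S - {s})"
    using assms finS by (intro root_poly_Un) auto
  moreover have "poly (root_poly {s}) l = l - s" by (simp add: root_poly_def)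
  ultimately show ?thesis using root_weight_nz[OF assms] by (simp add: lagrange_basis_def)
qed

lemma lagrange_basis_at: "s \<in> S \<Longrightarrow> t \<in> S \<Longrightarrow> poly (lagrange_basis S s) t = (if s = t then 1 else 0)"
  using finS root_weight_nz[of s] by (auto simp: lagrange_basis_def root_weight_def poly_root_poly_eq_0_iff)

lemma degree_lagrange_basis: "s \<in> S \<Longrightarrow> degree (lagrange_basis S s) < card S"
proof -
  assume s: "s \<in> S"
  have "degree (lagrange_basis S s) \<le> card (S - {s})"
    using finS unfolding lagrange_basis_def by (metis degree_root_poly degree_smult_le finite_Diff)
  also have "\<dots> < card S" using s finS by (rule card_Diff1_less[rotated])
  finally show ?thesis .
qed

lemma lagrange:
  assumes "degree q < card S"
  shows "(\<Sum>s\<in>S. poly q s * poly (lagrange_basis S s) l) = poly q l"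
proof -
  have "(\<Sum>s\<in>S. smult (poly q s) (lagrange_basis S s)) = q"
  proof (rule poly_eqI_degree[of S])
    have "degree (\<Sum>s\<in>S. smult (poly q s) (lagrange_basis S s)) \<le> card S - 1"
    proof (rule degree_sum_le[OF finS])
      fix s assume "s \<in> S"
      then show "degree (smult (poly q s) (lagrange_basis S s)) \<le> card S - 1"
        using degree_lagrange_basis[of s] degree_smult_le[of "poly q s" "lagrange_basis S s"] by linarith
    qed
    then show "degree (\<Sum>s\<in>S. smult (poly q s) (lagrange_basis S s)) < card S"
      using assms by linarith
    fix t assume t: "t \<in> S"
    have "poly (\<Sum>s\<in>S. smult (poly q s) (lagrange_basis S s)) t = (\<Sum>s\<in>S. poly q s * (if s = t then 1 else 0))"
      unfolding poly_sum using t by (intro sum.cong) (auto simp: lagrange_basis_at)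
    then show "poly (\<Sum>s\<in>S. smult (poly q s) (lagrange_basis S s)) t = poly q t"
      using t finS by (simp add: if_distrib[of "\<lambda>x. _ * x"] cong: if_cong)
  qed (rule assms)
  from arg_cong[OF this, of "\<lambda>r. poly r l"] show ?thesis by (simp add: poly_sum)
qed

lemma expmode_derivative:
  "(expmode \<beta>0 \<sigma> s has_derivative (\<lambda>v. - \<sigma> * of_real (pi * inner (\<beta>0 * s) v) * expmode \<beta>0 \<sigma> s z)) (at z)"
  unfolding expmode_def by (rule exp_inner_derivative)

lemma inner_S: "s \<in> S \<Longrightarrow> of_real (inner (\<beta>0 * s) v) = (\<beta>0 * s * cnj v + cnj \<beta>0 * v * inverse s) / 2"
  by (simp add: complex_inner_eq S_cnj mult_ac)

lemma spectral_mode_flow: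
  assumes l: "l \<noteq> 0"
  shows "(spectral_mode \<beta>0 S \<sigma> W l has_derivative
     component_flow \<sigma> \<beta>0 S l (hol_part \<beta>0 S \<sigma> W z) (antihol_part \<beta>0 S \<sigma> W z) (spectral_mode \<beta>0 S \<sigma> W l z)) (at z)"
proof -
  define e where "e = (\<lambda>s. expmode \<beta>0 \<sigma> s z)"
  have D: "(spectral_mode \<beta>0 S \<sigma> W l has_derivative
     (\<lambda>v. l * (\<Sum>s\<in>S. W s * poly (lagrange_basis S s) l * (- \<sigma> * of_real (pi * inner (\<beta>0 * s) v) * e s)))) (at z)"
    unfolding spectral_mode_def[abs_def] e_def by (intro has_derivative_mult_right has_derivative_sum expmode_derivative)
  have eq: "l * (\<Sum>s\<in>S. W s * poly (lagrange_basis S s) l * (- \<sigma> * of_real (pi * inner (\<beta>0 * s) v) * e s)) =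
     component_flow \<sigma> \<beta>0 S l (hol_part \<beta>0 S \<sigma> W z) (antihol_part \<beta>0 S \<sigma> W z) (spectral_mode \<beta>0 S \<sigma> W l z) v" for v
  proof -
    define c where "c = (of_real (pi / 2) :: complex)"
    have "component_flow \<sigma> \<beta>0 S l (hol_part \<beta>0 S \<sigma> W z) (antihol_part \<beta>0 S \<sigma> W z) (spectral_mode \<beta>0 S \<sigma> W l z) v =
      (\<Sum>s\<in>S. poly (root_poly S) l * (v * (- \<sigma> * c * cnj \<beta>0 * (W s / (s * root_weight S s) * e s)) +
         l * cnj v * (\<sigma> * c * \<beta>0 * (W s / root_weight S s * e s))) -
         c * (inverse l * cnj \<beta>0 * v + l * \<beta>0 * cnj v) * (\<sigma> * (l * (W s * poly (lagrange_basis S s) l * e s))))"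
      unfolding component_flow_def hol_part_def antihol_part_def spectral_mode_def e_def c_def
      by (rule sum_collect)
    also have "\<dots> = (\<Sum>s\<in>S. l * (W s * poly (lagrange_basis S s) l * (- \<sigma> * of_real (pi * inner (\<beta>0 * s) v) * e s)))"
    proof (rule sum.cong[OF refl])
      fix s assume s: "s \<in> S"
      have pin: "of_real (pi * inner (\<beta>0 * s) v) = c * (\<beta>0 * s * cnj v + cnj \<beta>0 * v * inverse s)"
        using inner_S[OF s, of v] by (simp add: c_def)
      have q: "W s / (s * root_weight S s) = W s * inverse s * inverse (root_weight S s)" "W s / root_weight S s = W s * inverse (root_weight S s)"
        by (simp_all add: divide_inverse)
      show "poly (root_poly S) l * (v * (- \<sigma> * c * cnj \<beta>0 * (W s / (s * root_weight S s) * e s)) +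
         l * cnj v * (\<sigma> * c * \<beta>0 * (W s / root_weight S s * e s))) -
         c * (inverse l * cnj \<beta>0 * v + l * \<beta>0 * cnj v) * (\<sigma> * (l * (W s * poly (lagrange_basis S s) l * e s))) =
         l * (W s * poly (lagrange_basis S s) l * (- \<sigma> * of_real (pi * inner (\<beta>0 * s) v) * e s))"
        unfolding root_poly_at[OF s] pin q
        by (rule mode_term_identity) (use S_nz[OF s] root_weight_nz[OF s] l in auto)
    qed
    finally show ?thesis by (simp add: sum_distrib_left)
  qed
  show ?thesis by (rule has_derivative_eq_rhs[OF D ext]) (rule eq)
qed

lemma cnj_expmode: "cnj (expmode \<beta>0 \<i> s z) = expmode \<beta>0 (-\<i>) s z"
  by (simp add: expmode_def exp_cnj)

lemma cnj_antihol: "cnj (antihol_part \<beta>0 S \<i> W z) = hol_part \<beta>0 S (-\<i>) (conj_weights S W) z"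
proof -
  have "cnj (W s / root_weight S s * expmode \<beta>0 \<i> s z) =
      - (conj_weights S W s / (s * root_weight S s) * expmode \<beta>0 (-\<i>) s z)" if "s \<in> S" for s
    using S_nz[OF that] root_weight_nz[OF that] by (simp add: conj_weights_def cnj_expmode)
  then have "cnj (\<Sum>s\<in>S. W s / root_weight S s * expmode \<beta>0 \<i> s z) =
      - (\<Sum>s\<in>S. conj_weights S W s / (s * root_weight S s) * expmode \<beta>0 (-\<i>) s z)"
    unfolding cnj_sum sum_negf[symmetric] by (intro sum.cong) auto
  then show ?thesis unfolding antihol_part_def hol_part_def by simp
qed

lemma cnj_hol: "cnj (hol_part \<beta>0 S \<i> W z) = antihol_part \<beta>0 S (-\<i>) (conj_weights S W) z"
proof -
  have "cnj (W s / (s * root_weight S s) * expmode \<beta>0 \<i> s z) =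
      - (conj_weights S W s / root_weight S s * expmode \<beta>0 (-\<i>) s z)" if "s \<in> S" for s
    using S_nz[OF that] root_weight_nz[OF that] S_cnj[OF that] by (simp add: conj_weights_def cnj_expmode field_simps)
  then have "cnj (\<Sum>s\<in>S. W s / (s * root_weight S s) * expmode \<beta>0 \<i> s z) =
      - (\<Sum>s\<in>S. conj_weights S W s / root_weight S s * expmode \<beta>0 (-\<i>) s z)"
    unfolding cnj_sum sum_negf[symmetric] by (intro sum.cong) auto
  then show ?thesis unfolding antihol_part_def hol_part_def by simp
qed

lemma sum_flip: "(\<Sum>s\<in>S. g s) = (\<Sum>s\<in>S. g (- s))" for g :: "complex \<Rightarrow> complex"
  by (rule sum.reindex_bij_witness[of _ uminus uminus]) (auto simp: S_minus)

lemma expmode_flip: "expmode \<beta>0 (-\<i>) (- s) z = expmode \<beta>0 \<i> s z"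
  by (simp add: expmode_def)

lemma hol_flip: "hol_part \<beta>0 S (-\<i>) W z = hol_part \<beta>0 S \<i> (flip_weights S W) z"
proof -
  have "W (- s) / (- s * root_weight S (- s)) * expmode \<beta>0 (-\<i>) (- s) z =
      - (flip_weights S W s / (s * root_weight S s) * expmode \<beta>0 \<i> s z)" if "s \<in> S" for s
    using root_weight_nz[OF that] by (simp add: flip_weights_def expmode_flip)
  then have "(\<Sum>s\<in>S. W s / (s * root_weight S s) * expmode \<beta>0 (-\<i>) s z) =
      - (\<Sum>s\<in>S. flip_weights S W s / (s * root_weight S s) * expmode \<beta>0 \<i> s z)"
    unfolding sum_negf[symmetric] by (subst sum_flip) (intro sum.cong; simp)
  then show ?thesis unfolding hol_part_def by simp
qed

lemma antihol_flip: "antihol_part \<beta>0 S (-\<i>) W z = - antihol_part \<beta>0 S \<i> (flip_weights S W) z"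
proof -
  have "W (- s) / root_weight S (- s) * expmode \<beta>0 (-\<i>) (- s) z =
      flip_weights S W s / root_weight S s * expmode \<beta>0 \<i> s z" if "s \<in> S" for s
    using root_weight_nz[OF that] by (simp add: flip_weights_def expmode_flip)
  then have "(\<Sum>s\<in>S. W s / root_weight S s * expmode \<beta>0 (-\<i>) s z) =
      (\<Sum>s\<in>S. flip_weights S W s / root_weight S s * expmode \<beta>0 \<i> s z)"
    by (subst sum_flip) (intro sum.cong; simp)
  then show ?thesis unfolding antihol_part_def by simp
qed

lemma hol_scale: "hol_part \<beta>0 S \<sigma> (\<lambda>s. c * W s) z = c * hol_part \<beta>0 S \<sigma> W z"
  by (simp add: hol_part_def sum_distrib_left mult_ac)

lemma antihol_scale: "antihol_part \<beta>0 S \<sigma> (\<lambda>s. c * W s) z = c * antihol_part \<beta>0 S \<sigma> W z"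
  by (simp add: antihol_part_def sum_distrib_left mult_ac)

lemma weights_True: "weights S Q True = (\<lambda>s. - \<i> * flip_weights S (conj_weights S Q) s)"
  and weights_False: "weights S Q False = Q"
  by (simp_all add: weights_def fun_eq_iff)

text \<open>Conjugation and the flip \<open>s \<mapsto> -s\<close> turn the derivatives of \<open>F\<^sub>1\<close> into those of \<open>F\<^sub>2\<close>.\<close>

lemma hsl_relations:
  "cnj (antihol_part \<beta>0 S \<i> (weights S Q False) z) = \<i> * hol_part \<beta>0 S \<i> (weights S Q True) z"
  "cnj (antihol_part \<beta>0 S \<i> (weights S Q True) z) = - \<i> * hol_part \<beta>0 S \<i> (weights S Q False) z"
proof -
  show "cnj (antihol_part \<beta>0 S \<i> (weights S Q False) z) = \<i> * hol_part \<beta>0 S \<i> (weights S Q True) z"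
    unfolding weights_True hol_scale weights_False by (simp add: cnj_antihol hol_flip)
  have "cnj (hol_part \<beta>0 S \<i> Q z) = - antihol_part \<beta>0 S \<i> (flip_weights S (conj_weights S Q)) z"
    by (simp add: cnj_hol antihol_flip)
  also have "\<dots> = - \<i> * antihol_part \<beta>0 S \<i> (weights S Q True) z"
    unfolding weights_True antihol_scale by simp
  finally have "cnj (cnj (hol_part \<beta>0 S \<i> Q z)) = cnj (- \<i> * antihol_part \<beta>0 S \<i> (weights S Q True) z)" by simp
  then show "cnj (antihol_part \<beta>0 S \<i> (weights S Q True) z) = - \<i> * hol_part \<beta>0 S \<i> (weights S Q False) z"
    by (simp add: weights_False)
qed

definition half_angle where "half_angle z = exp (\<i> * of_real (pi * inner \<beta>0 z))"

lemma primitive_derivative: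
  "(primitive \<beta>0 S W has_derivative (\<lambda>v. half_angle z * hol_part \<beta>0 S \<i> W z * v
     + half_angle z * antihol_part \<beta>0 S \<i> W z * cnj v)) (at z)"
proof -
  define e where "e = (\<lambda>s. expmode \<beta>0 \<i> s z)"
  define h where "h = half_angle z"
  define c where "c = (of_real (pi / 2) :: complex)"
  define \<delta> where "\<delta> = (\<lambda>s. of_real pi * (\<beta>0 - \<beta>0 * s))"
  have D: "(primitive \<beta>0 S W has_derivative (\<lambda>v. \<Sum>s\<in>S. (W s / (root_weight S s * (1 - s)) * \<i> * of_real (inner (\<delta> s) v)) * cis (inner (\<delta> s) z))) (at z)"
    unfolding primitive_def[abs_def] \<delta>_def by (intro has_derivative_sum cis_inner_derivative)
  have eq: "(\<Sum>s\<in>S. (W s / (root_weight S s * (1 - s)) * \<i> * of_real (inner (\<delta> s) v)) * cis (inner (\<delta> s) z)) =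
     h * hol_part \<beta>0 S \<i> W z * v + h * antihol_part \<beta>0 S \<i> W z * cnj v" for v
  proof -
    have coll: "h * (A * (\<Sum>s\<in>S. X s)) * v + h * (B * (\<Sum>s\<in>S. Y s)) * v' =
      (\<Sum>s\<in>S. h * (A * X s) * v + h * (B * Y s) * v')" for A B v v' and X Y :: "complex \<Rightarrow> complex"
      by (simp add: sum_distrib_left sum_distrib_right sum.distrib)
    have "h * hol_part \<beta>0 S \<i> W z * v + h * antihol_part \<beta>0 S \<i> W z * cnj v =
      (\<Sum>s\<in>S. h * (- \<i> * c * cnj \<beta>0 * (W s / (s * root_weight S s) * e s)) * v + h * (\<i> * c * \<beta>0 * (W s / root_weight S s * e s)) * cnj v)"
      unfolding hol_part_def antihol_part_def e_def c_def by (rule coll)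
    also have "\<dots> = (\<Sum>s\<in>S. (W s / (root_weight S s * (1 - s)) * \<i> * of_real (inner (\<delta> s) v)) * cis (inner (\<delta> s) z))"
    proof (rule sum.cong[OF refl])
      fix s assume s: "s \<in> S"
      have s1: "1 - s \<noteq> 0" using one_notin s by auto
      have q: "W s / (s * root_weight S s) = W s * inverse s * inverse (root_weight S s)" "W s / root_weight S s = W s * inverse (root_weight S s)"
        "W s / (root_weight S s * (1 - s)) = W s * (inverse (root_weight S s) * inverse (1 - s))"
        by (simp_all add: divide_inverse)
      have "inner (\<delta> s) z = pi * inner \<beta>0 z - pi * inner (\<beta>0 * s) z"
        by (simp add: \<delta>_def inner_complex_def algebra_simps)
      then have cis: "cis (inner (\<delta> s) z) = h * e s"
        by (simp add: cis_conv_exp h_def half_angle_def e_def expmode_def exp_add[symmetric])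
          (simp add: right_diff_distrib)
      have inn: "of_real (inner (\<delta> s) v) = c * (\<beta>0 * (1 - s) * cnj v + cnj \<beta>0 * (1 - inverse s) * v)"
      proof -
        have "(P * (a - a * s) * x + P * (d - d * t) * y) / 2 = P / 2 * (a * (1 - s) * x + d * (1 - t) * y)"
          for P a d t x y :: complex
          by (simp add: algebra_simps add_divide_distrib diff_divide_distrib)
        then show ?thesis using S_cnj[OF s] by (simp add: complex_inner_eq \<delta>_def c_def)
      qed
      show "h * (- \<i> * c * cnj \<beta>0 * (W s / (s * root_weight S s) * e s)) * v + h * (\<i> * c * \<beta>0 * (W s / root_weight S s * e s)) * cnj v =
        (W s / (root_weight S s * (1 - s)) * \<i> * of_real (inner (\<delta> s) v)) * cis (inner (\<delta> s) z)"
        unfolding cis inn q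
        by (rule primitive_term_identity) (use S_nz[OF s] root_weight_nz[OF s] s1 in auto)
    qed
    finally show ?thesis by simp
  qed
  show ?thesis unfolding h_def[symmetric] by (rule has_derivative_eq_rhs[OF D ext]) (rule eq)
qed

abbreviation "W \<equiv> weights S"

lemma hsl_map_cplx: "((\<lambda>z. cplx b (hsl_map \<beta>0 S Q z)) has_derivative
   (\<lambda>v. half_angle z * hol_part \<beta>0 S \<i> (W Q b) z * v + half_angle z * antihol_part \<beta>0 S \<i> (W Q b) z * cnj v)) (at z)"
  unfolding hsl_map_def cplx_of_cplx
  by (rule has_derivative_eq_rhs[OF has_derivative_diff[OF primitive_derivative has_derivative_const]]) simp

lemma hsl_map_differentiable: "hsl_map \<beta>0 S Q differentiable (at z)"
  using hsl_map_cplx by (intro differentiable_of_cplx) (auto simp: differentiable_def)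

lemma hsl_map_d_z: "chi \<i> b (d_z (hsl_map \<beta>0 S Q) z) = half_angle z * hol_part \<beta>0 S \<i> (W Q b) z"
  "chi (-\<i>) b (d_z (hsl_map \<beta>0 S Q) z) = cnj (half_angle z * antihol_part \<beta>0 S \<i> (W Q b) z)"
  using d_z_of_cplx[OF hsl_map_cplx hsl_map_differentiable] by auto

lemma smooth_primitive: "smooth (primitive \<beta>0 S V)"
  unfolding primitive_def[abs_def] by (intro smooth_sum smooth_cis)

lemma smooth_hsl_map: "smooth (hsl_map \<beta>0 S Q)"
proof -
  have "hsl_map \<beta>0 S Q = (\<lambda>z. \<Sum>b\<in>UNIV.
      of_cplx (\<lambda>b'. if b' = b then primitive \<beta>0 S (W Q b) z + - primitive \<beta>0 S (W Q b) 0 else 0))"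
    by (rule ext, rule cplx_eqI) (auto simp: hsl_map_def UNIV_bool)
  moreover have "bounded_linear (\<lambda>y. of_cplx (\<lambda>b'. if b' = b then y else 0))" for b
    by (rule linear_conv_bounded_linear[THEN iffD1]) (intro linearI cplx_eqI; simp)
  ultimately show ?thesis
    by (simp only:) (intro smooth_sum smooth_linear[where L = "\<lambda>y. of_cplx (\<lambda>b'. if b' = _ then y else 0)"] smooth_add smooth_primitive smooth_const)
qed

end

text \<open>\<open>L\<close> exchanges the \<open>i\<close>- and \<open>-i\<close>-eigenspaces of \<open>J\<close>. Of the four scalar equations, two are
  equivalent to the other two.\<close>

lemma hsl_equation_iff:
  "cmat (mexp (t *\<^sub>R matJ)) *v (cmat matL *v w) = \<i> *s w \<longleftrightarrow>
     chi (-\<i>) True w = - \<i> * exp (- \<i> * of_real t) * chi \<i> False w \<and>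
     chi (-\<i>) False w = \<i> * exp (- \<i> * of_real t) * chi \<i> True w" (is "?l = ?r \<longleftrightarrow> ?H1 \<and> ?H2")
proof -
  define E where "E = exp (\<i> * of_real t)"
  have E: "E \<noteq> 0" "exp (- \<i> * of_real t) = inverse E" by (simp_all add: E_def exp_minus)
  have 1: "chi \<i> False ?l = - E * chi (-\<i>) True w" "chi \<i> True ?l = E * chi (-\<i>) False w"
    "chi (-\<i>) False ?l = - inverse E * chi \<i> True w" "chi (-\<i>) True ?l = inverse E * chi \<i> False w"
    by (simp_all add: chi_mexp chi_L E_def exp_minus[symmetric])
  have "?l = ?r \<longleftrightarrow> (\<forall>b. chi \<i> b ?l = chi \<i> b ?r) \<and> (\<forall>b. chi (-\<i>) b ?l = chi (-\<i>) b ?r)"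
    by (metis chi_eqI)
  also have "\<dots> \<longleftrightarrow> - E * chi (-\<i>) True w = \<i> * chi \<i> False w \<and> E * chi (-\<i>) False w = \<i> * chi \<i> True w
      \<and> - inverse E * chi \<i> True w = \<i> * chi (-\<i>) False w \<and> inverse E * chi \<i> False w = \<i> * chi (-\<i>) True w"
    unfolding all_bool_eq 1 by auto
  also have "\<dots> \<longleftrightarrow> ?H1 \<and> ?H2"
    unfolding E(2) using E(1) by (auto simp: field_simps)
  finally show ?thesis .
qed

section \<open>Spectral solutions\<close>

definition chi_basis :: "complex \<Rightarrow> bool \<Rightarrow> complex ^ 4" where
  "chi_basis \<sigma> b = of_chi (\<lambda>\<sigma>' b'. if \<sigma>' = \<sigma> \<and> b' = b then 1 else 0)"

lemma i_neq [simp]: "\<i> \<noteq> - \<i>" "- \<i> \<noteq> \<i>" by (simp_all add: complex_eq_iff)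

lemma of_chi_expand: "of_chi X = X \<i> False *s chi_basis \<i> False + X (-\<i>) False *s chi_basis (-\<i>) False
   + X \<i> True *s chi_basis \<i> True + X (-\<i>) True *s chi_basis (-\<i>) True"
proof (rule chi_eqI)
  fix b
  show "chi \<i> b (of_chi X) = chi \<i> b (X \<i> False *s chi_basis \<i> False + X (-\<i>) False *s chi_basis (-\<i>) False
   + X \<i> True *s chi_basis \<i> True + X (-\<i>) True *s chi_basis (-\<i>) True)"
    by (cases b) (simp_all add: chi_basis_def)
  show "chi (-\<i>) b (of_chi X) = chi (-\<i>) b (X \<i> False *s chi_basis \<i> False + X (-\<i>) False *s chi_basis (-\<i>) False
   + X \<i> True *s chi_basis \<i> True + X (-\<i>) True *s chi_basis (-\<i>) True)"
    by (cases b) (simp_all add: chi_basis_def)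
qed

lemma bounded_linear_smult: "bounded_linear (\<lambda>c. c *s (w :: complex ^ 4))"
  by (rule linear_conv_bounded_linear[THEN iffD1])
    (intro linearI; simp add: vec_eq_iff distrib_right)

lemma has_derivative_of_chi:
  assumes "\<And>b. ((\<lambda>z. X z \<i> b) has_derivative (\<lambda>v. X' v \<i> b)) (at z)"
    and "\<And>b. ((\<lambda>z. X z (-\<i>) b) has_derivative (\<lambda>v. X' v (-\<i>) b)) (at z)"
  shows "((\<lambda>z. of_chi (X z)) has_derivative (\<lambda>v. of_chi (X' v))) (at z)"
  unfolding of_chi_expand
  by (intro has_derivative_add bounded_linear.has_derivative[OF bounded_linear_smult] assms)

lemma smooth_of_chi:
  assumes "\<And>b. smooth (\<lambda>z. X z \<i> b)" "\<And>b. smooth (\<lambda>z. X z (-\<i>) b)"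
  shows "smooth (\<lambda>z. of_chi (X z))"
  unfolding of_chi_expand
  by (intro smooth_add smooth_linear[OF bounded_linear_smult] assms)

lemma poly_as_sum:
  fixes p :: "complex poly"
  assumes "degree p \<le> n"
  shows "poly p x = (\<Sum>k\<le>n. x ^ k * coeff p k)"
proof -
  have "(\<Sum>k\<le>n. x ^ k * coeff p k) = (\<Sum>k\<le>degree p. x ^ k * coeff p k)"
    using assms by (intro sum.mono_neutral_right) (auto simp: coeff_eq_0)
  then show ?thesis by (simp add: poly_altdef mult.commute)
qed

lemma smooth_expmode:
  assumes "\<sigma> = \<i> \<or> \<sigma> = -\<i>"
  shows "smooth (\<lambda>z. K * expmode \<beta>0 \<sigma> s z)"
proof -
  define r where "r = (if \<sigma> = \<i> then - pi else pi)"
  have "expmode \<beta>0 \<sigma> s z = cis (inner (of_real r * (\<beta>0 * s)) z)" for z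
  proof -
    have "inner (of_real r * (\<beta>0 * s)) z = r * inner (\<beta>0 * s) z"
      by (simp add: inner_complex_def algebra_simps)
    then show ?thesis using assms by (auto simp: expmode_def cis_conv_exp r_def)
  qed
  then show ?thesis using smooth_cis[of K "of_real r * (\<beta>0 * s)"] by simp
qed

lemma expmode_0 [simp]: "expmode \<beta>0 \<sigma> s 0 = 1"
  by (simp add: expmode_def)

context unit_roots
begin

lemma hsl_map_equation:
  "cmat (mexp (lag_angle \<beta>0 z *\<^sub>R matJ)) *v (cmat matL *v d_z (hsl_map \<beta>0 S Q) z) = \<i> *s d_z (hsl_map \<beta>0 S Q) z"
proof -
  have "exp (- \<i> * of_real (lag_angle \<beta>0 z)) * half_angle z = cnj (half_angle z)"
    by (simp add: half_angle_def lag_angle_def exp_cnj exp_add[symmetric])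
  then have h: "exp (- \<i> * of_real (lag_angle \<beta>0 z)) * (half_angle z * y) = cnj (half_angle z) * y" for y
    by (simp add: mult.assoc[symmetric])
  have r: "c * exp (- \<i> * of_real (lag_angle \<beta>0 z)) * (half_angle z * y) = c * (cnj (half_angle z) * y)" for c y
    unfolding mult.assoc h ..
  show ?thesis unfolding hsl_equation_iff hsl_map_d_z r complex_cnj_mult hsl_relations
    by (simp add: mult_ac)
qed

lemma chi_exp_half: "\<sigma> = \<i> \<or> \<sigma> = -\<i> \<Longrightarrow>
  chi \<sigma> b (cmat (mexp (- ((lag_angle \<beta>0 z / 2) *\<^sub>R matJ))) *v w) = (if \<sigma> = \<i> then inverse (half_angle z) else half_angle z) * chi \<sigma> b w"
  using chi_mexp[of \<sigma> b "- (lag_angle \<beta>0 z / 2)" w]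
  by (auto simp: half_angle_def lag_angle_def exp_minus[symmetric])

lemma half_angle_nz [simp]: "half_angle z \<noteq> 0" by (simp add: half_angle_def)

lemma half_angle_cancel [simp]: "inverse (half_angle z) * (half_angle z * y) = y"
  "half_angle z * (inverse (half_angle z) * y) = y"
  by (simp_all add: mult.assoc[symmetric])

lemma cnj_half_angle: "cnj (half_angle z) = inverse (half_angle z)"
  by (simp add: half_angle_def exp_cnj exp_minus[symmetric])

lemma u_of_hsl_map:
  "chi \<i> b (u_of \<beta>0 (hsl_map \<beta>0 S Q) z) = hol_part \<beta>0 S \<i> (W Q b) z"
  "chi (-\<i>) b (u_of \<beta>0 (hsl_map \<beta>0 S Q) z) = hol_part \<beta>0 S (-\<i>) (conj_weights S (W Q b)) z"
  by (simp_all add: u_of_def chi_exp_half hsl_map_d_z cnj_half_angle cnj_antihol)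

text \<open>Since \<open>f\<close> is real, its derivative with respect to the conjugate variable is the complex
  conjugate of \<open>f\<^sub>z\<close>.\<close>

lemma driving_term:
  "chi \<i> b (cmat (mexp ((- (lag_angle \<beta>0 z / 2)) *\<^sub>R matJ)) *v (v *s d_z f z + (l * cnj v) *s d_zbar f z))
     = v * (inverse (half_angle z) * chi \<i> b (d_z f z)) + l * cnj v * (inverse (half_angle z) * cnj (chi (-\<i>) b (d_z f z)))"
  "chi (-\<i>) b (cmat (mexp ((- (lag_angle \<beta>0 z / 2)) *\<^sub>R matJ)) *v (v *s d_z f z + (l * cnj v) *s d_zbar f z))
     = v * (half_angle z * chi (-\<i>) b (d_z f z)) + l * cnj v * (half_angle z * cnj (chi \<i> b (d_z f z)))"
  by (simp_all add: chi_exp_half chi_d_zbar algebra_simps)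

abbreviation spectral_form where
  "spectral_form f y l z \<equiv> (\<lambda>v. poly (root_poly S) l *s
     (cmat (mexp ((- (lag_angle \<beta>0 z / 2)) *\<^sub>R matJ)) *v (v *s d_z f z + (l * cnj v) *s d_zbar f z))
     - (of_real (pi / 2) * (inverse l * cnj \<beta>0 * v + l * \<beta>0 * cnj v)) *s (cmat matJ *v y))"

lemma hsl_solution_derivative:
  assumes "l \<noteq> 0"
  shows "(hsl_solution \<beta>0 S Q l has_derivative
     spectral_form (hsl_map \<beta>0 S Q) (hsl_solution \<beta>0 S Q l z) l z)
     (at z)"
proof (rule has_derivative_eq_rhs)
  define V where "V = (\<lambda>\<sigma> b. if \<sigma> = \<i> then W Q b else conj_weights S (W Q b))"
  define X' where "X' = (\<lambda>v \<sigma> b. component_flow \<sigma> \<beta>0 S l (hol_part \<beta>0 S \<sigma> (V \<sigma> b) z) (antihol_part \<beta>0 S \<sigma> (V \<sigma> b) z)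
      (spectral_mode \<beta>0 S \<sigma> (V \<sigma> b) l z) v)"
  show "(hsl_solution \<beta>0 S Q l has_derivative (\<lambda>v. of_chi (X' v))) (at z)"
    unfolding hsl_solution_def[abs_def] X'_def V_def
    by (rule has_derivative_of_chi; rule spectral_mode_flow[OF assms])
  have V: "V \<i> b = W Q b" "V (-\<i>) b = conj_weights S (W Q b)" for b by (simp_all add: V_def)
  show "(\<lambda>v. of_chi (X' v)) = spectral_form (hsl_map \<beta>0 S Q) (hsl_solution \<beta>0 S Q l z) l z"
    by (rule ext, rule chi_eqI; unfold chi_linear driving_term)
      (simp_all add: chi_J X'_def V component_flow_def hsl_solution_def hsl_map_d_z cnj_half_angle
        cnj_antihol[symmetric] cnj_hol[symmetric])
qed

lemma hsl_solution_polynomial: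
  "\<exists>n c. (\<forall>k. smooth (c k)) \<and> (\<forall>l z. hsl_solution \<beta>0 S Q l z = (\<Sum>k\<le>n. l ^ k *s c k z))"
proof (intro exI conjI allI)
  define V where "V = (\<lambda>\<sigma> b. if \<sigma> = \<i> then W Q b else conj_weights S (W Q b))"
  define c where "c = (\<lambda>k z. of_chi (\<lambda>\<sigma> b. \<Sum>s\<in>S. V \<sigma> b s * coeff (pCons 0 (lagrange_basis S s)) k * expmode \<beta>0 \<sigma> s z))"
  show "smooth (c k)" for k
    unfolding c_def by (rule smooth_of_chi; intro smooth_sum smooth_expmode) auto
  fix l z
  have m: "spectral_mode \<beta>0 S \<sigma> U l z = (\<Sum>k\<le>card S. l ^ k * (\<Sum>s\<in>S. U s * coeff (pCons 0 (lagrange_basis S s)) k * expmode \<beta>0 \<sigma> s z))"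
    for \<sigma> U
  proof -
    have "spectral_mode \<beta>0 S \<sigma> U l z = (\<Sum>s\<in>S. U s * poly (pCons 0 (lagrange_basis S s)) l * expmode \<beta>0 \<sigma> s z)"
      by (simp add: spectral_mode_def sum_distrib_left mult_ac)
    also have "\<dots> = (\<Sum>s\<in>S. U s * (\<Sum>k\<le>card S. l ^ k * coeff (pCons 0 (lagrange_basis S s)) k) * expmode \<beta>0 \<sigma> s z)"
    proof (rule sum.cong[OF refl])
      fix s assume "s \<in> S"
      then have "degree (pCons 0 (lagrange_basis S s)) \<le> card S"
        using degree_lagrange_basis[of s] degree_pCons_le[of 0 "lagrange_basis S s"] by linarith
      from poly_as_sum[OF this, of l]
      show "U s * poly (pCons 0 (lagrange_basis S s)) l * expmode \<beta>0 \<sigma> s z =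
        U s * (\<Sum>k\<le>card S. l ^ k * coeff (pCons 0 (lagrange_basis S s)) k) * expmode \<beta>0 \<sigma> s z" by (simp only:)
    qed
    also have "\<dots> = (\<Sum>s\<in>S. \<Sum>k\<le>card S. l ^ k * (U s * coeff (pCons 0 (lagrange_basis S s)) k * expmode \<beta>0 \<sigma> s z))"
      by (simp only: sum_distrib_left sum_distrib_right mult_ac)
    also have "\<dots> = (\<Sum>k\<le>card S. \<Sum>s\<in>S. l ^ k * (U s * coeff (pCons 0 (lagrange_basis S s)) k * expmode \<beta>0 \<sigma> s z))"
      by (rule sum.swap)
    finally show ?thesis by (simp only: sum_distrib_left)
  qed
  show "hsl_solution \<beta>0 S Q l z = (\<Sum>k\<le>card S. l ^ k *s c k z)"
    by (rule chi_eqI; unfold chi_sum chi_linear; simp only: c_def hsl_solution_def chi_of_chi m V_def)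
qed

lemma hsl_solution_spectral:
  assumes "spec_pts \<beta>0 (freqs_of \<Gamma> \<beta>0 (hsl_map \<beta>0 S Q)) = S"
  shows "spectral_solution \<Gamma> \<beta>0 (hsl_map \<beta>0 S Q) (hsl_solution \<beta>0 S Q)"
  unfolding spectral_solution_def assms
  using hsl_solution_polynomial hsl_solution_derivative by blast

lemma hsl_solution_at_0:
  assumes "degree q < card S"
  shows "chi \<i> False (hsl_solution \<beta>0 S (poly q) l 0) = l * poly q l"
  using lagrange[OF assms, of l] by (simp add: hsl_solution_def spectral_mode_def weights_False)

lemma spectral_component:
  assumes "spectral_solution \<Gamma> \<beta>0 f x" "spec_pts \<beta>0 (freqs_of \<Gamma> \<beta>0 f) = S"
  shows "scalar_solution \<i> \<beta>0 S (\<lambda>l z. chi \<i> False (x l z))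
     (\<lambda>z. inverse (half_angle z) * chi \<i> False (d_z f z))
     (\<lambda>z. inverse (half_angle z) * cnj (chi (-\<i>) False (d_z f z)))"
proof -
  obtain n c where c: "\<And>k. smooth (c k)" "\<And>l z. x l z = (\<Sum>k\<le>n. l ^ k *s c k z)"
    using assms(1) unfolding spectral_solution_def by blast
  have D: "(x l has_derivative spectral_form f (x l z) l z) (at z)"
    if "l \<noteq> 0" for l z
    using assms that unfolding spectral_solution_def by blast
  show ?thesis unfolding scalar_solution_def
  proof (intro exI conjI allI impI)
    show "(\<lambda>z. chi \<i> False (c k z)) differentiable (at z)" for k z
      using smooth_differentiable[OF smooth_linear[OF bounded_linear_chi c(1)]] .
    show "chi \<i> False (x l z) = (\<Sum>k\<le>n. l ^ k * chi \<i> False (c k z))" for l z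
      unfolding c(2) by simp
    fix l z :: complex assume l: "l \<noteq> 0"
    show "((\<lambda>z. chi \<i> False (x l z)) has_derivative
        component_flow \<i> \<beta>0 S l (inverse (half_angle z) * chi \<i> False (d_z f z))
          (inverse (half_angle z) * cnj (chi (-\<i>) False (d_z f z))) (chi \<i> False (x l z))) (at z)"
      by (rule has_derivative_eq_rhs[OF bounded_linear.has_derivative[OF bounded_linear_chi D[OF l]]])
        (rule ext, unfold chi_linear driving_term, simp add: component_flow_def chi_J)
  qed
qed

text \<open>The first coordinate of the two spectral solutions solves the same scalar initial value
  problem, so \<open>F\<^sub>1\<close> has the same derivatives for \<open>f\<close> and \<open>f'\<close>; the equation of a Hamiltonian
  stationary Lagrangian immersion transfers this to \<open>F\<^sub>2\<close>.\<close>

lemma hsl_unique: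
  assumes smooth: "smooth f" "smooth f'"
    and hsl: "\<And>z. cmat (mexp (lag_angle \<beta>0 z *\<^sub>R matJ)) *v (cmat matL *v d_z f z) = \<i> *s d_z f z"
      "\<And>z. cmat (mexp (lag_angle \<beta>0 z *\<^sub>R matJ)) *v (cmat matL *v d_z f' z) = \<i> *s d_z f' z"
    and sol: "spectral_solution \<Gamma> \<beta>0 f x" "spectral_solution \<Gamma> \<beta>0 f' x'"
    and S: "spec_pts \<beta>0 (freqs_of \<Gamma> \<beta>0 f) = S" "spec_pts \<beta>0 (freqs_of \<Gamma> \<beta>0 f') = S"
    and init: "\<And>l. l \<noteq> 0 \<Longrightarrow> chi \<i> False (x l 0) = chi \<i> False (x' l 0)"
    and based: "f 0 = f' 0"
  shows "f = f'"
proof -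
  note u = scalar_solution_unique[OF finS unitS \<beta>0 _
      spectral_component[OF sol(1) S(1)] spectral_component[OF sol(2) S(2)] init]
  have dz1: "chi \<i> False (d_z f z) = chi \<i> False (d_z f' z)" for z
    using u(1)[of z] by simp
  have dz2: "chi (-\<i>) False (d_z f z) = chi (-\<i>) False (d_z f' z)" for z
    using u(2)[of z] by simp
  have dz: "d_z f z = d_z f' z" for z
  proof (rule chi_eqI)
    have e: "\<i> * exp (- \<i> * of_real (lag_angle \<beta>0 z)) \<noteq> 0" by simp
    note h = hsl(1)[of z, unfolded hsl_equation_iff] hsl(2)[of z, unfolded hsl_equation_iff]
    have 1: "chi \<i> True (d_z f z) = chi \<i> True (d_z f' z)"
      using h dz2[of z] e by (metis mult_left_cancel)
    have 2: "chi (-\<i>) True (d_z f z) = chi (-\<i>) True (d_z f' z)"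
      using h dz1[of z] by simp
    show "chi \<i> b (d_z f z) = chi \<i> b (d_z f' z)" for b using 1 dz1 by (cases b) auto
    show "chi (-\<i>) b (d_z f z) = chi (-\<i>) b (d_z f' z)" for b using 2 dz2 by (cases b) auto
  qed
  have "cplx b (f z) = cplx b (f' z)" for b z
  proof -
    have "((\<lambda>z. cplx b (f z) - cplx b (f' z)) has_derivative (\<lambda>v. 0)) (at z)" for z
    proof -
      have "((\<lambda>z. cplx b (f z) - cplx b (f' z)) has_derivative
        (\<lambda>v. (chi \<i> b (d_z f z) * v + cnj (chi (-\<i>) b (d_z f z)) * cnj v) -
          (chi \<i> b (d_z f' z) * v + cnj (chi (-\<i>) b (d_z f' z)) * cnj v))) (at z)"
        by (intro has_derivative_diff cplx_has_derivative smooth_differentiable smooth)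
      then show ?thesis by (simp add: dz)
    qed
    then have "\<exists>k. \<forall>z\<in>UNIV. cplx b (f z) - cplx b (f' z) = k"
      by (intro has_derivative_zero_constant) (auto intro: has_derivative_at_withinI)
    then have "cplx b (f z) - cplx b (f' z) = cplx b (f 0) - cplx b (f' 0)" by auto
    then show ?thesis using based by simp
  qed
  then show ?thesis by (intro ext cplx_eqI)
qed

end

section \<open>Lattices and Fourier coefficients\<close>

lemma lattice_basis_separates:
  assumes "lattice_basis \<Gamma> w" "inner \<gamma> (fst w) = 0" "inner \<gamma> (snd w) = 0"
  shows "\<gamma> = 0"
proof -
  have "(UNIV :: complex set) \<subseteq> span {fst w, snd w}"
    using assms(1) by (intro card_ge_dim_independent) (auto simp: lattice_basis_def)
  then have "\<gamma> \<in> span {fst w, snd w}" by blast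
  then have "orthogonal \<gamma> \<gamma>"
    using assms by (intro orthogonal_to_span[of \<gamma> "{fst w, snd w}" \<gamma>]) (auto simp: orthogonal_def)
  then show ?thesis by (simp add: orthogonal_self)
qed

lemma lattice_basis_in:
  assumes "lattice_basis \<Gamma> w"
  shows "fst w \<in> \<Gamma>" "snd w \<in> \<Gamma>"
proof -
  have \<Gamma>: "\<Gamma> = {of_int m * fst w + of_int n * snd w | m n. True}" using assms by (simp add: lattice_basis_def)
  have "fst w = of_int 1 * fst w + of_int 0 * snd w" "snd w = of_int 0 * fst w + of_int 1 * snd w" by auto
  then show "fst w \<in> \<Gamma>" "snd w \<in> \<Gamma>" unfolding \<Gamma> by blast+
qed

lemma dual_lattice_int: "\<gamma> \<in> dual_lattice \<Gamma> \<Longrightarrow> z \<in> \<Gamma> \<Longrightarrow> inner \<gamma> z \<in> \<int>"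
  by (simp add: dual_lattice_def)

lemma dual_lattice_closed:
  "a \<in> dual_lattice \<Gamma> \<Longrightarrow> b \<in> dual_lattice \<Gamma> \<Longrightarrow> a + b \<in> dual_lattice \<Gamma>"
  "a \<in> dual_lattice \<Gamma> \<Longrightarrow> b \<in> dual_lattice \<Gamma> \<Longrightarrow> a - b \<in> dual_lattice \<Gamma>"
  by (simp_all add: dual_lattice_def inner_add_left inner_diff_left)

text \<open>The pairings with a lattice basis embed the shifted dual lattice into pairs of integers, and
  the norm condition bounds them.\<close>

lemma finite_freqs:
  assumes "is_lattice \<Gamma>"
  shows "finite (freqs \<Gamma> \<beta>0)"
proof -
  obtain w where w: "lattice_basis \<Gamma> w" using assms by (auto simp: is_lattice_def)
  define h where "h = (\<lambda>\<gamma>. (inner (\<gamma> - \<beta>0 / 2) (fst w), inner (\<gamma> - \<beta>0 / 2) (snd w)))"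
  define I where "I = (\<lambda>a :: real. {x \<in> \<int>. -a \<le> x \<and> x \<le> a})"
  have "h ` freqs \<Gamma> \<beta>0 \<subseteq> I (cmod \<beta>0 * cmod (fst w)) \<times> I (cmod \<beta>0 * cmod (snd w))"
  proof -
    have "inner (\<gamma> - \<beta>0 / 2) v \<in> I (cmod \<beta>0 * cmod v)" if "\<gamma> \<in> freqs \<Gamma> \<beta>0" "v \<in> \<Gamma>" for \<gamma> v
    proof -
      have "cmod (\<gamma> - \<beta>0 / 2) \<le> cmod \<gamma> + cmod (\<beta>0 / 2)" by (rule norm_triangle_ineq4)
      also have "\<dots> = cmod \<beta>0" using that by (simp add: freqs_def norm_divide)
      finally have "\<bar>inner (\<gamma> - \<beta>0 / 2) v\<bar> \<le> cmod \<beta>0 * cmod v"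
        using Cauchy_Schwarz_ineq2[of "\<gamma> - \<beta>0 / 2" v] by (meson mult_right_mono norm_ge_zero order_trans)
      then show ?thesis using that by (auto simp: I_def freqs_def dual_lattice_int abs_le_iff)
    qed
    then show ?thesis using lattice_basis_in[OF w] by (auto simp: h_def)
  qed
  moreover have "finite (I a)" for a unfolding I_def by (rule finite_int_segment)
  ultimately have "finite (h ` freqs \<Gamma> \<beta>0)" by (meson finite_SigmaI finite_subset)
  moreover have "inj_on h (freqs \<Gamma> \<beta>0)"
  proof (rule inj_onI)
    fix a b assume "h a = h b"
    then have "inner (a - b) (fst w) = 0" "inner (a - b) (snd w) = 0"
      by (simp_all add: h_def inner_diff_left)
    then have "a - b = 0" by (rule lattice_basis_separates[OF w])
    then show "a = b" by simp
  qed
  ultimately show ?thesis by (rule finite_imageD)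
qed

lemma cis_shift: "n \<in> \<int> \<Longrightarrow> cis (x + 2 * pi * n) = cis x"
  by (simp add: cis_mult[symmetric] cis_multiple_2pi)

lemma integral_cis_period:
  assumes "n \<in> \<int>"
  shows "integral {0..1} (\<lambda>t. cis (2 * pi * (t * n))) = (if n = 0 then 1 else 0)"
proof (cases "n = 0")
  case False
  define c where "c = \<i> * of_real (2 * pi * n)"
  have c: "c \<noteq> 0" using False by (simp add: c_def)
  have "((\<lambda>t. cis (2 * pi * (t * n))) has_integral (exp (of_real 1 * c) / c - exp (of_real 0 * c) / c)) {0..1}"
  proof (rule fundamental_theorem_of_calculus)
    fix t :: real
    have "((\<lambda>t. exp (t *\<^sub>R c)) has_vector_derivative exp (t *\<^sub>R c) * c) (at t within {0..1})"
      by (rule exp_scaleR_has_vector_derivative_right)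
    from has_vector_derivative_mult_left[OF this, of "1 / c"]
    show "((\<lambda>t. exp (of_real t * c) / c) has_vector_derivative cis (2 * pi * (t * n))) (at t within {0..1})"
      using c by (simp add: scaleR_conv_of_real c_def cis_conv_exp mult_ac)
  qed simp
  moreover have "exp c = 1"
    using cis_multiple_2pi[OF assms] by (simp add: c_def cis_conv_exp)
  ultimately show ?thesis using False by (simp add: integral_unique)
qed simp

lemma integral_cis_torus:
  assumes "m \<in> \<int>" "n \<in> \<int>"
  shows "integral (cbox (0, 0) (1, 1)) (\<lambda>t :: real \<times> real. cis (2 * pi * (fst t * m + snd t * n)))
    = (if m = 0 \<and> n = 0 then 1 else 0)"
proof -
  have cont: "continuous_on (cbox (0, 0) (1, 1)) (\<lambda>t :: real \<times> real. cis (2 * pi * (fst t * m + snd t * n)))"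
    unfolding cis_conv_exp by (intro continuous_intros)
  have "integral (cbox (0, 0) (1, 1)) (\<lambda>t :: real \<times> real. cis (2 * pi * (fst t * m + snd t * n))) =
    integral (cbox 0 1) (\<lambda>x. integral (cbox 0 1) (\<lambda>y. cis (2 * pi * (x * m)) * cis (2 * pi * (y * n))))"
    unfolding integral_prod_continuous[OF cont] by (simp add: cis_mult distrib_left)
  also have "\<dots> = (if m = 0 \<and> n = 0 then 1 else 0)"
    using integral_cis_period[OF assms(1)] integral_cis_period[OF assms(2)] by simp
  finally show ?thesis .
qed

text \<open>In lattice coordinates each exponential is a product of two characters of the circle, and the
  mean of a nontrivial character vanishes.\<close>

lemma fourier_coeff_trig:
  assumes lat: "is_lattice \<Gamma>" and \<Delta>: "finite \<Delta>" "\<And>\<gamma>. \<gamma> \<in> \<Delta> \<Longrightarrow> 2 * \<gamma> \<in> dual_lattice \<Gamma>"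
    and \<gamma>0: "2 * \<gamma>0 \<in> dual_lattice \<Gamma>"
    and u: "\<And>z. u z = (\<Sum>\<gamma>\<in>\<Delta>. cis (2 * pi * inner \<gamma> z) *s U \<gamma>)"
  shows "fourier_coeff \<Gamma> u \<gamma>0 = (if \<gamma>0 \<in> \<Delta> then U \<gamma>0 else 0)"
proof -
  define w where "w = (SOME w. lattice_basis \<Gamma> w)"
  have w: "lattice_basis \<Gamma> w" using lat unfolding is_lattice_def w_def by (rule someI_ex)
  define Z where "Z = (\<lambda>t :: real \<times> real. 2 * (of_real (fst t) * fst w + of_real (snd t) * snd w))"
  define g where "g = (\<lambda>\<gamma> t. cis (2 * pi * (fst t * inner (2 * (\<gamma> - \<gamma>0)) (fst w) + snd t * inner (2 * (\<gamma> - \<gamma>0)) (snd w))))"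
  have Zin: "inner \<gamma> (Z t) - inner \<gamma>0 (Z t) =
      fst t * inner (2 * (\<gamma> - \<gamma>0)) (fst w) + snd t * inner (2 * (\<gamma> - \<gamma>0)) (snd w)" for \<gamma> t
    by (simp add: Z_def inner_complex_def algebra_simps)
  have "cis (- 2 * pi * inner \<gamma>0 (Z t)) *s u (Z t) = (\<Sum>\<gamma>\<in>\<Delta>. g \<gamma> t *s U \<gamma>)" for t
  proof -
    have "cis (- 2 * pi * inner \<gamma>0 (Z t)) * cis (2 * pi * inner \<gamma> (Z t)) = g \<gamma> t" for \<gamma>
      unfolding cis_mult g_def Zin[symmetric] by (simp add: algebra_simps)
    then show ?thesis
      unfolding u by (simp add: vec_eq_iff sum_distrib_left mult.assoc[symmetric])
  qed
  moreover have "fourier_coeff \<Gamma> u \<gamma>0 = integral (cbox (0, 0) (1, 1)) (\<lambda>t. cis (- 2 * pi * inner \<gamma>0 (Z t)) *s u (Z t))"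
    by (simp only: fourier_coeff_def Let_def w_def Z_def)
  ultimately have "fourier_coeff \<Gamma> u \<gamma>0 = integral (cbox (0, 0) (1, 1)) (\<lambda>t. \<Sum>\<gamma>\<in>\<Delta>. g \<gamma> t *s U \<gamma>)"
    by (simp only:)
  also have "\<dots> = (\<Sum>\<gamma>\<in>\<Delta>. integral (cbox (0, 0) (1, 1)) (g \<gamma>) *s U \<gamma>)"
  proof -
    have int: "g \<gamma> integrable_on cbox (0, 0) (1, 1)" for \<gamma>
      unfolding g_def cis_conv_exp by (intro integrable_continuous continuous_intros)
    have lin: "((\<lambda>t. g \<gamma> t *s U \<gamma>) has_integral integral (cbox (0, 0) (1, 1)) (g \<gamma>) *s U \<gamma>) (cbox (0, 0) (1, 1))" for \<gamma>
      using has_integral_linear[OF integrable_integral[OF int] bounded_linear_smult] by (simp add: comp_def)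
    show ?thesis by (intro integral_unique has_integral_sum \<Delta> lin)
  qed
  also have "\<dots> = (\<Sum>\<gamma>\<in>\<Delta>. (if \<gamma> = \<gamma>0 then 1 else 0) *s U \<gamma>)"
  proof (rule sum.cong[OF refl])
    fix \<gamma> assume \<gamma>: "\<gamma> \<in> \<Delta>"
    have "2 * (\<gamma> - \<gamma>0) \<in> dual_lattice \<Gamma>"
      using dual_lattice_closed(2)[OF \<Delta>(2)[OF \<gamma>] \<gamma>0] by (simp add: algebra_simps)
    then have i: "inner (2 * (\<gamma> - \<gamma>0)) (fst w) \<in> \<int>" "inner (2 * (\<gamma> - \<gamma>0)) (snd w) \<in> \<int>"
      using lattice_basis_in[OF w] dual_lattice_int by blast+
    have "inner (2 * (\<gamma> - \<gamma>0)) (fst w) = 0 \<and> inner (2 * (\<gamma> - \<gamma>0)) (snd w) = 0 \<longleftrightarrow> \<gamma> = \<gamma>0"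
      using lattice_basis_separates[OF w, of "2 * (\<gamma> - \<gamma>0)"] by auto
    then show "integral (cbox (0, 0) (1, 1)) (g \<gamma>) *s U \<gamma> = (if \<gamma> = \<gamma>0 then 1 else 0) *s U \<gamma>"
      unfolding g_def integral_cis_torus[OF i] by simp
  qed
  also have "\<dots> = (\<Sum>\<gamma>\<in>\<Delta>. if \<gamma> = \<gamma>0 then U \<gamma> else 0)"
    by (intro sum.cong) (auto simp: vec_eq_iff)
  also have "\<dots> = (if \<gamma>0 \<in> \<Delta> then U \<gamma>0 else 0)" using \<Delta> by simp
  finally show ?thesis .
qed

locale torus_frequencies =
  fixes \<Gamma> :: "complex set" and \<beta>0 :: complex and \<Delta> :: "complex set"
  assumes lattice: "is_lattice \<Gamma>" and \<beta>0_dual: "\<beta>0 \<in> dual_lattice \<Gamma>"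
    and \<Delta>_freqs: "\<Delta> \<subseteq> freqs \<Gamma> \<beta>0" and \<Delta>_ne: "\<Delta> \<noteq> {}"
    and \<Delta>_minus: "\<And>\<gamma>. \<gamma> \<in> \<Delta> \<Longrightarrow> - \<gamma> \<in> \<Delta>"
begin

abbreviation "S \<equiv> spec_pts \<beta>0 \<Delta>"

lemma \<beta>0_nz: "\<beta>0 \<noteq> 0"
  using \<Delta>_ne \<Delta>_freqs by (auto simp: freqs_def)

lemma finite_\<Delta>: "finite \<Delta>" using finite_freqs[OF lattice] \<Delta>_freqs by (rule finite_subset[rotated])

lemma inj_spec: "inj_on (\<lambda>\<gamma>. 2 * \<gamma> / \<beta>0) A" using \<beta>0_nz by (auto simp: inj_on_def)

lemma card_S: "card S = card \<Delta>" unfolding spec_pts_def by (rule card_image[OF inj_spec])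

lemma spec_pts_inj: "spec_pts \<beta>0 A = spec_pts \<beta>0 B \<Longrightarrow> A = B"
  unfolding spec_pts_def by (rule inj_on_image_eq_iff[THEN iffD1, of _ UNIV]) (auto intro: inj_spec)

sublocale unit_roots \<beta>0 S
proof
  show "\<beta>0 \<noteq> 0" by (rule \<beta>0_nz)
  show "finite S" "S \<noteq> {}" using finite_\<Delta> \<Delta>_ne by (auto simp: spec_pts_def)
  show "S \<subseteq> {s. cmod s = 1}"
    using \<Delta>_freqs \<beta>0_nz by (auto simp: spec_pts_def freqs_def norm_mult norm_divide)
  have m: "- s \<in> S" if "s \<in> S" for s using that \<Delta>_minus by (force simp: spec_pts_def)
  then show "uminus ` S = S" by (auto simp: image_iff) (metis m add.inverse_inverse)
  show "1 \<notin> S" using \<Delta>_freqs \<beta>0_nz by (auto simp: spec_pts_def freqs_def field_simps)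
qed

lemma \<Delta>_half: "\<gamma> \<in> \<Delta> \<Longrightarrow> \<gamma> - \<beta>0 / 2 \<in> dual_lattice \<Gamma>" using \<Delta>_freqs by (auto simp: freqs_def)

lemma \<Delta>_dual: "\<gamma> \<in> \<Delta> \<Longrightarrow> 2 * \<gamma> \<in> dual_lattice \<Gamma>"
proof -
  assume "\<gamma> \<in> \<Delta>"
  from dual_lattice_closed(1)[OF dual_lattice_closed(1)[OF \<Delta>_half[OF this] \<Delta>_half[OF this]] \<beta>0_dual]
  show ?thesis by (simp add: algebra_simps)
qed

text \<open>The frequencies \<open>\<beta>\<^sub>0/2 - \<gamma>\<close> of \<open>F\<^sub>1\<close> and \<open>F\<^sub>2\<close> lie in the dual lattice, although the \<open>\<gamma>\<close>
  themselves need not.\<close>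

lemma primitive_periodic:
  assumes "w \<in> \<Gamma>"
  shows "primitive \<beta>0 S V (z + w) = primitive \<beta>0 S V z"
proof -
  have "cis (inner (of_real pi * (\<beta>0 - \<beta>0 * s)) (z + w)) = cis (inner (of_real pi * (\<beta>0 - \<beta>0 * s)) z)" if s: "s \<in> S" for s
  proof -
    obtain \<gamma> where \<gamma>: "\<gamma> \<in> \<Delta>" "s = 2 * \<gamma> / \<beta>0" using s unfolding spec_pts_def by blast
    have "\<beta>0 * s = 2 * \<gamma>" using \<gamma> \<beta>0_nz by simp
    then have "inner (of_real pi * (\<beta>0 - \<beta>0 * s)) (z + w) =
        inner (of_real pi * (\<beta>0 - \<beta>0 * s)) z + 2 * pi * (- inner (\<gamma> - \<beta>0 / 2) w)"
      by (simp add: inner_complex_def algebra_simps)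
    moreover have "- inner (\<gamma> - \<beta>0 / 2) w \<in> \<int>" using dual_lattice_int[OF \<Delta>_half[OF \<gamma>(1)] assms] by simp
    ultimately show ?thesis by (simp only: cis_shift)
  qed
  then show ?thesis unfolding primitive_def by (intro sum.cong) auto
qed

lemma hsl_map_periodic: "w \<in> \<Gamma> \<Longrightarrow> hsl_map \<beta>0 S Q (z + w) = hsl_map \<beta>0 S Q z"
  by (simp add: hsl_map_def primitive_periodic)

definition mode_coeff where
  "mode_coeff \<sigma> V s = - \<sigma> * of_real (pi / 2) * cnj \<beta>0 * (V s / (s * root_weight S s))"

text \<open>The Fourier coefficient of \<open>e\<^bsup>-J\<beta>/2\<^esup>f\<^sub>z\<close> at \<open>\<gamma>\<close>. With \<open>s = 2\<gamma>/\<beta>\<^sub>0\<close>, the coordinates with \<open>\<sigma> = i\<close> get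
  their term in \<open>e\<^bsup>2\<pi>i\<langle>\<gamma>,z\<rangle>\<^esup>\<close> from the root \<open>-s\<close>, those with \<open>\<sigma> = -i\<close> from the root \<open>s\<close>.\<close>

definition hsl_coeff :: "(complex \<Rightarrow> complex) \<Rightarrow> complex \<Rightarrow> complex ^ 4" where
  "hsl_coeff Q \<gamma> = of_chi (\<lambda>\<sigma> b. if \<sigma> = \<i> then mode_coeff \<i> (W Q b) (- (2 * \<gamma> / \<beta>0))
      else mode_coeff (-\<i>) (conj_weights S (W Q b)) (2 * \<gamma> / \<beta>0))"

lemma hol_part_minus: "hol_part \<beta>0 S (-\<i>) V z = (\<Sum>\<gamma>\<in>\<Delta>. cis (2 * pi * inner \<gamma> z) * mode_coeff (-\<i>) V (2 * \<gamma> / \<beta>0))"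
proof -
  have "hol_part \<beta>0 S (-\<i>) V z = (\<Sum>s\<in>S. expmode \<beta>0 (-\<i>) s z * mode_coeff (-\<i>) V s)"
    unfolding hol_part_def mode_coeff_def sum_distrib_left by (intro sum.cong) auto
  also have "\<dots> = (\<Sum>\<gamma>\<in>\<Delta>. expmode \<beta>0 (-\<i>) (2 * \<gamma> / \<beta>0) z * mode_coeff (-\<i>) V (2 * \<gamma> / \<beta>0))"
    unfolding spec_pts_def by (subst sum.reindex[OF inj_spec]) simp
  finally have "hol_part \<beta>0 S (-\<i>) V z = (\<Sum>\<gamma>\<in>\<Delta>. expmode \<beta>0 (-\<i>) (2 * \<gamma> / \<beta>0) z * mode_coeff (-\<i>) V (2 * \<gamma> / \<beta>0))" .
  moreover have "expmode \<beta>0 (-\<i>) (2 * \<gamma> / \<beta>0) z = cis (2 * pi * inner \<gamma> z)" for \<gamma>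
  proof -
    have "inner (2 * \<gamma>) z = 2 * inner \<gamma> z" by (simp add: inner_complex_def algebra_simps)
    then show ?thesis using \<beta>0_nz by (simp add: expmode_def cis_conv_exp mult_ac)
  qed
  ultimately show ?thesis by (simp only:)
qed

lemma hol_part_plus: "hol_part \<beta>0 S \<i> V z = (\<Sum>\<gamma>\<in>\<Delta>. cis (2 * pi * inner \<gamma> z) * mode_coeff \<i> V (- (2 * \<gamma> / \<beta>0)))"
proof -
  have "hol_part \<beta>0 S \<i> V z = (\<Sum>s\<in>S. expmode \<beta>0 \<i> s z * mode_coeff \<i> V s)"
    unfolding hol_part_def mode_coeff_def sum_distrib_left by (intro sum.cong) auto
  also have "\<dots> = (\<Sum>s\<in>S. expmode \<beta>0 \<i> (- s) z * mode_coeff \<i> V (- s))" by (rule sum_flip)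
  also have "\<dots> = (\<Sum>\<gamma>\<in>\<Delta>. expmode \<beta>0 \<i> (- (2 * \<gamma> / \<beta>0)) z * mode_coeff \<i> V (- (2 * \<gamma> / \<beta>0)))"
    unfolding spec_pts_def by (subst sum.reindex[OF inj_spec]) simp
  finally have "hol_part \<beta>0 S \<i> V z = (\<Sum>\<gamma>\<in>\<Delta>. expmode \<beta>0 \<i> (- (2 * \<gamma> / \<beta>0)) z * mode_coeff \<i> V (- (2 * \<gamma> / \<beta>0)))" .
  moreover have "expmode \<beta>0 \<i> (- (2 * \<gamma> / \<beta>0)) z = cis (2 * pi * inner \<gamma> z)" for \<gamma>
  proof -
    have "inner (2 * \<gamma>) z = 2 * inner \<gamma> z" by (simp add: inner_complex_def algebra_simps)
    then show ?thesis using \<beta>0_nz by (simp add: expmode_def cis_conv_exp mult_ac)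
  qed
  ultimately show ?thesis by (simp only:)
qed

lemma u_of_expansion:
  "u_of \<beta>0 (hsl_map \<beta>0 S Q) z = (\<Sum>\<gamma>\<in>\<Delta>. cis (2 * pi * inner \<gamma> z) *s hsl_coeff Q \<gamma>)"
  by (rule chi_eqI) (simp_all add: u_of_hsl_map hol_part_plus hol_part_minus hsl_coeff_def)

lemma fourier_hsl_map:
  "2 * \<gamma> \<in> dual_lattice \<Gamma> \<Longrightarrow>
     fourier_coeff \<Gamma> (u_of \<beta>0 (hsl_map \<beta>0 S Q)) \<gamma> = (if \<gamma> \<in> \<Delta> then hsl_coeff Q \<gamma> else 0)"
  by (rule fourier_coeff_trig[OF lattice finite_\<Delta> \<Delta>_dual _ u_of_expansion])

text \<open>Up to nonzero factors the coordinates of the coefficient with \<open>\<sigma> = i\<close> are \<open>Q(-s)\<close> and the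
  conjugate of \<open>Q(s)\<close>.\<close>

lemma hsl_coeff_nz:
  assumes "\<gamma> \<in> \<Delta>" and Q: "\<And>s. s \<in> S \<Longrightarrow> Q s \<noteq> 0 \<or> Q (- s) \<noteq> 0"
  shows "hsl_coeff Q \<gamma> \<noteq> 0"
proof
  assume 0: "hsl_coeff Q \<gamma> = 0"
  define s where "s = 2 * \<gamma> / \<beta>0"
  have s: "s \<in> S" "- s \<in> S" using assms(1) S_minus by (auto simp: s_def spec_pts_def)
  have "mode_coeff \<i> (W Q b) (- s) = 0" for b
    using arg_cong[OF 0, of "chi \<i> b"] by (simp add: hsl_coeff_def s_def)
  then have "W Q b (- s) = 0" for b
    using \<beta>0_nz S_nz[OF s(2)] root_weight_nz[OF s(2)] by (simp add: mode_coeff_def)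
  from this[of False] this[of True] have "Q (- s) = 0" "Q s = 0"
    using s S_nz[OF s(1)] root_weight_nz[OF s(1)] root_weight_nz[OF s(2)]
    by (auto simp: weights_def flip_weights_def conj_weights_def)
  then show False using Q[OF s(1)] by simp
qed

lemma freqs_of_hsl_map:
  assumes "\<And>s. s \<in> S \<Longrightarrow> Q s \<noteq> 0 \<or> Q (- s) \<noteq> 0"
  shows "freqs_of \<Gamma> \<beta>0 (hsl_map \<beta>0 S Q) = \<Delta>"
proof -
  have "hsl_coeff Q \<gamma> \<noteq> 0" if "\<gamma> \<in> \<Delta>" for \<gamma>
    using that by (rule hsl_coeff_nz) (rule assms)
  then show ?thesis using \<Delta>_dual by (auto simp: freqs_of_def fourier_hsl_map split: if_splits)
qed

lemma hsl_map_HSL: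
  assumes "\<And>s. s \<in> S \<Longrightarrow> Q s \<noteq> 0 \<or> Q (- s) \<noteq> 0"
  shows "weakly_conformal_HSL \<Gamma> \<beta>0 (hsl_map \<beta>0 S Q)"
  unfolding weakly_conformal_HSL_def
proof (intro conjI allI ballI)
  show "\<exists>z w. hsl_map \<beta>0 S Q z \<noteq> hsl_map \<beta>0 S Q w"
  proof (rule ccontr)
    assume "\<not> ?thesis"
    then have "hsl_map \<beta>0 S Q = (\<lambda>_. hsl_map \<beta>0 S Q 0)" by (intro ext) metis
    then have "frechet_derivative (hsl_map \<beta>0 S Q) (at z) = (\<lambda>_. 0)" for z
      by (metis frechet_derivative_const)
    then have "u_of \<beta>0 (hsl_map \<beta>0 S Q) z = 0" for z
      by (simp add: u_of_def d_z_def cvec_def vec_eq_iff cmat_mult)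
    then have "fourier_coeff \<Gamma> (u_of \<beta>0 (hsl_map \<beta>0 S Q)) \<gamma> = 0" for \<gamma>
      by (simp add: fourier_coeff_def Let_def)
    then have "freqs_of \<Gamma> \<beta>0 (hsl_map \<beta>0 S Q) = {}" by (simp add: freqs_of_def)
    moreover have "freqs_of \<Gamma> \<beta>0 (hsl_map \<beta>0 S Q) = \<Delta>" by (rule freqs_of_hsl_map) (rule assms)
    ultimately show False using \<Delta>_ne by simp
  qed
qed (rule hsl_map_periodic smooth_hsl_map hsl_map_equation | assumption)+

lemma hsl_map_based: "based (hsl_map \<beta>0 S Q)"
  by (simp add: based_def hsl_map_def of_cplx_def vec_eq_iff)

end

section \<open>The circle group and the proof of the theorem\<close>

text \<open>Multiplication by \<open>c\<close> on the first and by the conjugate of \<open>c\<close> on the second copy of \<open>\<complex>\<close>.\<close>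

definition phase_matrix :: "complex \<Rightarrow> real ^ 4 ^ 4" where
  "phase_matrix c = (\<chi> i j. if i = j then Re c
     else if i = 2 \<and> j = 1 \<or> i = 3 \<and> j = 4 then Im c
     else if i = 1 \<and> j = 2 \<or> i = 4 \<and> j = 3 then - Im c else 0)"

lemma cplx_phase_matrix:
  "cplx b (phase_matrix c *v x) = (if b then cnj c else c) * cplx b x"
  by (cases b) (simp_all add: cplx_def phase_matrix_def matrix_vector_mult_def sum_4 complex_eq_iff)

lemma matrix_eqI:
  fixes A B :: "'a ^ 4 ^ 4"
  assumes "\<forall>i j. A $ i $ j = B $ i $ j" shows "A = B"
  using assms by (simp add: vec_eq_iff)

lemma phase_matrix_mult: "phase_matrix (c * d) = phase_matrix c ** phase_matrix d"
  by (rule matrix_eqI, unfold forall_4)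
    (simp add: phase_matrix_def matrix_matrix_mult_def sum_4 algebra_simps)

lemma phase_matrix_orthogonal:
  assumes "cmod c = 1" shows "orthogonal_matrix (phase_matrix c)"
proof -
  have "Re c * Re c + Im c * Im c = 1" using assms by (simp add: cmod_def power2_eq_square)
  then have "transpose (phase_matrix c) ** phase_matrix c = mat 1"
    by (intro matrix_eqI, unfold forall_4)
      (simp add: phase_matrix_def matrix_matrix_mult_def transpose_def mat_def sum_4 algebra_simps)
  then show ?thesis by (simp add: orthogonal_matrix)
qed

text \<open>The determinant is \<open>1\<close> because the matrix is the square of another orthogonal matrix of the
  same kind.\<close>

lemma phase_matrix_G0:
  assumes "cmod c = 1" shows "phase_matrix c \<in> G0"
proof -
  have "cmod (csqrt c) = 1" using assms by (simp add: norm_csqrt)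
  then have "det (phase_matrix (csqrt c)) = 1 \<or> det (phase_matrix (csqrt c)) = -1"
    by (intro det_orthogonal_matrix phase_matrix_orthogonal)
  moreover have "phase_matrix c = phase_matrix (csqrt c) ** phase_matrix (csqrt c)"
    unfolding phase_matrix_mult[symmetric] by (simp add: power2_eq_square[symmetric])
  ultimately have "det (phase_matrix c) = 1" by (auto simp: det_mul)
  moreover have "phase_matrix c ** matJ = matJ ** phase_matrix c"
    by (intro matrix_eqI, unfold forall_4)
      (simp add: phase_matrix_def matrix_matrix_mult_def matJ_entries sum_4)
  moreover have "phase_matrix c ** matL = matL ** phase_matrix c"
    by (intro matrix_eqI, unfold forall_4)
      (simp add: phase_matrix_def matrix_matrix_mult_def matL_entries sum_4)
  ultimately show ?thesis using phase_matrix_orthogonal[OF assms] by (simp add: G0_def)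
qed

lemma vframe_1: "vframe 1 = of_real (1 / sqrt 2) *s (axis 1 1 - \<i> *s axis 2 1)"
  by (simp add: vframe_def)

lemma vframe_1_nth: "vframe 1 $ 1 = of_real (1 / sqrt 2)" "vframe 1 $ 2 = - \<i> * of_real (1 / sqrt 2)"
  "vframe 1 $ 3 = 0" "vframe 1 $ 4 = 0"
  by (simp_all add: vframe_1 axis_def)

lemma phase_matrix_T0:
  assumes "cmod c = 1" shows "phase_matrix c \<in> T0"
proof -
  have v: "cmat (phase_matrix c) *v vframe 1 = c *s vframe 1"
    unfolding vec_eq_iff forall_4
    by (simp add: cmat_mult sum_4 vframe_1_nth phase_matrix_def complex_eq_iff)
  have "cmat (phase_matrix c) *v (k *s vframe 1) = (k * c) *s vframe 1" for k
    using v by (simp add: matrix_vector_mult_scaleR vector_scalar_commute vector_smult_assoc)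
  then have "(\<lambda>w. cmat (phase_matrix c) *v w) ` range (\<lambda>k. k *s vframe 1) = (\<lambda>k. (k * c) *s vframe 1) ` UNIV"
    by (simp add: image_image)
  also have "\<dots> = range (\<lambda>k. k *s vframe 1)"
  proof -
    have c0: "c \<noteq> 0" using assms by auto
    have "k *s vframe 1 \<in> range (\<lambda>k. (k * c) *s vframe 1)" for k
      by (rule range_eqI[of _ _ "k / c"]) (use c0 in simp)
    then show ?thesis by blast
  qed
  finally show ?thesis using phase_matrix_G0[OF assms] by (simp add: T0_def)
qed

text \<open>Preserving the line of \<open>v\<^sub>1\<close> fixes the first two columns of \<open>g\<close>, and commuting with \<open>L\<close> the
  other two.\<close>

lemma T0_phase:
  assumes "g \<in> T0"
  obtains c where "cmod c = 1" "g = phase_matrix c"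
proof -
  have orth: "transpose g ** g = mat 1" and gL: "g ** matL = matL ** g"
    using assms by (auto simp: T0_def G0_def orthogonal_matrix_def)
  have img: "(\<lambda>w. cmat g *v w) ` range (\<lambda>c. c *s vframe 1) = range (\<lambda>c. c *s vframe 1)"
    using assms by (simp add: T0_def)
  have "vframe 1 \<in> range (\<lambda>c. c *s vframe 1)" by (rule range_eqI[of _ _ 1]) simp
  then have "cmat g *v vframe 1 \<in> range (\<lambda>c. c *s vframe 1)" using img by blast
  then obtain c where c: "cmat g *v vframe 1 = c *s vframe 1" by blast
  have "\<forall>i. of_real (g $ i $ 1) - \<i> * of_real (g $ i $ 2) = c * (if i = 1 then 1 else if i = 2 then - \<i> else 0)"
  proof
    fix i
    have "(cmat g *v vframe 1) $ i = (c *s vframe 1) $ i" using c by simp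
    then have "of_real (1 / sqrt 2) * (of_real (g $ i $ 1) - \<i> * of_real (g $ i $ 2)) =
        of_real (1 / sqrt 2) * (c * (if i = 1 then 1 else if i = 2 then - \<i> else 0))"
      using exhaust_4[of i] by (auto simp: cmat_mult sum_4 vframe_1_nth algebra_simps)
    then show "of_real (g $ i $ 1) - \<i> * of_real (g $ i $ 2) = c * (if i = 1 then 1 else if i = 2 then - \<i> else 0)"
      by (simp del: of_real_divide)
  qed
  then have e: "g $ 1 $ 1 = Re c" "g $ 1 $ 2 = - Im c" "g $ 2 $ 1 = Im c" "g $ 2 $ 2 = Re c"
    "g $ 3 $ 1 = 0" "g $ 3 $ 2 = 0" "g $ 4 $ 1 = 0" "g $ 4 $ 2 = 0"
    unfolding forall_4 by (simp_all add: complex_eq_iff)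
  have L: "(g ** matL) $ i $ j = (matL ** g) $ i $ j" for i j using gL by simp
  have f: "g $ 3 $ 3 = Re c" "g $ 4 $ 3 = - Im c" "g $ 3 $ 4 = Im c" "g $ 4 $ 4 = Re c"
    "g $ 1 $ 3 = 0" "g $ 1 $ 4 = 0" "g $ 2 $ 3 = 0" "g $ 2 $ 4 = 0"
    using L[of 3 1] L[of 4 1] L[of 3 2] L[of 4 2] L[of 1 1] L[of 1 2] L[of 2 1] L[of 2 2]
    by (simp_all add: matrix_matrix_mult_def matL_entries sum_4 e)
  have "g = phase_matrix c"
    by (rule matrix_eqI, unfold forall_4) (simp add: phase_matrix_def e f)
  moreover have "cmod c = 1"
  proof -
    have "(transpose g ** g) $ 1 $ 1 = 1" using orth by (simp add: mat_def)
    then have "Re c * Re c + Im c * Im c = 1"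
      by (simp add: matrix_matrix_mult_def transpose_def sum_4 e)
    then show ?thesis by (simp add: cmod_def power2_eq_square)
  qed
  ultimately show ?thesis using that by blast
qed

lemma conj_weights_scale: "conj_weights S (\<lambda>s. \<kappa> * Q s) = (\<lambda>s. cnj \<kappa> * conj_weights S Q s)"
  by (simp add: fun_eq_iff conj_weights_def)

lemma weights_scale:
  "weights S (\<lambda>s. \<kappa> * Q s) b = (\<lambda>s. (if b then cnj \<kappa> else \<kappa>) * weights S Q b s)"
  unfolding weights_def[abs_def] conj_weights_scale by (auto simp: flip_weights_def)

lemma primitive_scale: "primitive \<beta>0 S (\<lambda>s. \<kappa> * V s) z = \<kappa> * primitive \<beta>0 S V z"
  by (simp add: primitive_def sum_distrib_left mult_ac)

lemma hsl_map_phase: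
  "hsl_map \<beta>0 S (\<lambda>s. of_real r * c * Q s) z = r *\<^sub>R (phase_matrix c *v hsl_map \<beta>0 S Q z)"
proof (rule cplx_eqI)
  fix b
  show "cplx b (hsl_map \<beta>0 S (\<lambda>s. of_real r * c * Q s) z) = cplx b (r *\<^sub>R (phase_matrix c *v hsl_map \<beta>0 S Q z))"
    unfolding hsl_map_def cplx_of_cplx weights_scale primitive_scale
    by (simp add: cplx_phase_matrix scaleR_conv_of_real[where 'a=complex] right_diff_distrib mult_ac)
qed

definition frame_coord :: "4 \<Rightarrow> complex ^ 4 \<Rightarrow> complex" where
  "frame_coord k w = (if k = 1 then chi \<i> False w else if k = 2 then chi \<i> True w
     else if k = 3 then chi (-\<i>) False w else chi (-\<i>) True w) / of_real (sqrt 2)"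

lemma chi_vframe:
  "chi \<i> b (vframe k) = (if \<not> b \<and> k = 1 \<or> b \<and> k = 2 then of_real (sqrt 2) else 0)"
  "chi (-\<i>) b (vframe k) = (if \<not> b \<and> k = 3 \<or> b \<and> k = 4 then of_real (sqrt 2) else 0)"
proof -
  define r where "r = complex_of_real (1 / sqrt 2)"
  have "2 * (1 / sqrt 2) = sqrt 2" using real_div_sqrt[of 2] by simp
  then have r: "of_real (sqrt 2) = 2 * r" unfolding r_def by (metis of_real_mult of_real_numeral)
  have cr: "cnj r = r" "\<i> * (r * \<i>) = - r" by (simp_all add: r_def complex_eq_iff)
  have "\<forall>k. chi \<i> b (vframe k) = (if \<not> b \<and> k = 1 \<or> b \<and> k = 2 then 2 * r else 0)"
    unfolding forall_4 vframe_def r_def[symmetric] by (cases b) (simp_all add: chi_def Let_def axis_def cr)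
  moreover have "\<forall>k. chi (-\<i>) b (vframe k) = (if \<not> b \<and> k = 3 \<or> b \<and> k = 4 then 2 * r else 0)"
    unfolding forall_4 vframe_def r_def[symmetric] by (cases b) (simp_all add: chi_def Let_def axis_def cr)
  ultimately show "chi \<i> b (vframe k) = (if \<not> b \<and> k = 1 \<or> b \<and> k = 2 then of_real (sqrt 2) else 0)"
    "chi (-\<i>) b (vframe k) = (if \<not> b \<and> k = 3 \<or> b \<and> k = 4 then of_real (sqrt 2) else 0)"
    unfolding r by blast+
qed

lemma frame_expansion: "w = (\<Sum>k\<in>UNIV. frame_coord k w *s vframe k)"
proof (rule chi_eqI)
  fix b
  show "chi \<i> b w = chi \<i> b (\<Sum>k\<in>UNIV. frame_coord k w *s vframe k)"
    by (cases b) (simp_all add: sum_4 chi_vframe frame_coord_def)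
  show "chi (-\<i>) b w = chi (-\<i>) b (\<Sum>k\<in>UNIV. frame_coord k w *s vframe k)"
    by (cases b) (simp_all add: sum_4 chi_vframe frame_coord_def)
qed

text \<open>The curve remembers \<open>p\<close>, as the only possible nonzero value of \<open>Z\<^sub>1\<close> over a point.\<close>

lemma X_curve_inj:
  assumes "X_curve \<beta>0 \<Delta> = X_curve \<beta>0 \<Delta>'"
  shows "root_poly (spec_pts \<beta>0 \<Delta>) = root_poly (spec_pts \<beta>0 \<Delta>')"
proof (rule poly_eqI_cofinite[of "{0}"])
  define P where "P = (\<lambda>\<Delta>. root_poly (spec_pts \<beta>0 \<Delta>))"
  have *: "poly (P A) b * (poly (P A) b - poly (P B) b) = 0"
    if "b \<noteq> 0" "curve_pts (\<lambda>j. P A) = curve_pts (\<lambda>j. P B)" for b A B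
  proof -
    have "Aff (coords (\<lambda>j. P A) 1 b) \<in> curve_pts (\<lambda>j. P B)"
      using comp_pt_in[of "\<lambda>j. P A" 1 "Num b"] that by (simp add: comp_pt_Num)
    then have "coords (\<lambda>j. P A) 1 b \<in> affine_curve (\<lambda>j. P B)" by (auto simp: curve_pts_def)
    then have "\<forall>j. j \<noteq> 5 \<longrightarrow> coords (\<lambda>j. P A) 1 b $ j *
        (coords (\<lambda>j. P A) 1 b $ j - poly (P B) (coords (\<lambda>j. P A) 1 b $ 5)) = 0"
      unfolding affine_curve_def by blast
    from this[rule_format, of 1]
    have "coords (\<lambda>j. P A) 1 b $ 1 * (coords (\<lambda>j. P A) 1 b $ 1 - poly (P B) (coords (\<lambda>j. P A) 1 b $ 5)) = 0"
      by simp
    then show ?thesis by simp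
  qed
  have eq: "curve_pts (\<lambda>j. P \<Delta>) = curve_pts (\<lambda>j. P \<Delta>')"
    using assms by (simp add: X_curve_def curve_of_def P_def)
  fix b :: complex assume "b \<notin> {0}"
  then have "poly (P \<Delta>) b * (poly (P \<Delta>) b - poly (P \<Delta>') b) = 0" "poly (P \<Delta>') b * (poly (P \<Delta>') b - poly (P \<Delta>) b) = 0"
    using *[of b \<Delta> \<Delta>'] *[of b \<Delta>' \<Delta>] eq by auto
  then show "poly (root_poly (spec_pts \<beta>0 \<Delta>)) b = poly (root_poly (spec_pts \<beta>0 \<Delta>')) b"
    by (auto simp: P_def)
qed simp

lemma sheaf_iso_refl: "sheaf_iso X F F"
  unfolding sheaf_iso_def by (rule exI[of _ "\<lambda>U s. s"]) (auto intro: bij_betw_id[unfolded id_def])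

context torus_frequencies
begin

lemma is_unit_divisor:
  assumes "size E = card \<Delta> - 1"
  shows "unit_divisor \<beta>0 \<Delta> E"
  using assms finS neS unitS symS by unfold_locales (simp_all add: card_S)

text \<open>The immersion of the polynomial \<open>\<kappa>Q\<^sub>E\<close>. These maps form the family of solutions with
  divisor \<open>E\<close>.\<close>

definition divisor_map :: "sphere_pt multiset \<Rightarrow> complex \<Rightarrow> complex \<Rightarrow> real ^ 4" where
  "divisor_map E \<kappa> = hsl_map \<beta>0 S (poly (smult \<kappa> (div_poly E)))"

context
  fixes E assumes E: "E \<in> admissible_divisors \<beta>0 \<Delta>"
begin

lemma size_E: "size E = card \<Delta> - 1" using E by (simp add: admissible_divisors_def)

lemma degree_divisor_map: "degree (smult \<kappa> (div_poly E)) < card S"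
proof -
  have "degree (smult \<kappa> (div_poly E)) \<le> size E"
    using degree_smult_le[of \<kappa> "div_poly E"] degree_div_poly[of E] by linarith
  moreover have "card S > 0" using finS neS by (simp add: card_gt_0_iff)
  ultimately show ?thesis using size_E card_S by linarith
qed

text \<open>This is admissibility of \<open>E\<close>, stated for its polynomial.\<close>

lemma divisor_map_nonvanishing:
  assumes "\<kappa> \<noteq> 0" "s \<in> S"
  shows "poly (smult \<kappa> (div_poly E)) s \<noteq> 0 \<or> poly (smult \<kappa> (div_poly E)) (- s) \<noteq> 0"
  using assms E by (auto simp: admissible_divisors_def poly_div_poly_eq_0_iff)

lemma divisor_map_freqs: "\<kappa> \<noteq> 0 \<Longrightarrow> freqs_of \<Gamma> \<beta>0 (divisor_map E \<kappa>) = \<Delta>"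
  unfolding divisor_map_def by (rule freqs_of_hsl_map) (rule divisor_map_nonvanishing)

lemma divisor_map_solution:
  assumes "\<kappa> \<noteq> 0"
  shows "spectral_solution \<Gamma> \<beta>0 (divisor_map E \<kappa>) (hsl_solution \<beta>0 S (poly (smult \<kappa> (div_poly E))))"
  using divisor_map_freqs[OF assms] unfolding divisor_map_def by (intro hsl_solution_spectral) simp

lemma divisor_map_HSL: "\<kappa> \<noteq> 0 \<Longrightarrow> weakly_conformal_HSL \<Gamma> \<beta>0 (divisor_map E \<kappa>)"
  unfolding divisor_map_def by (rule hsl_map_HSL) (rule divisor_map_nonvanishing)

lemma divisor_map_spectral_data:
  assumes "\<kappa> \<noteq> 0"
  shows "has_spectral_data \<Gamma> \<beta>0 (divisor_map E \<kappa>) (spectral_triple \<beta>0 \<Delta> E)"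
proof -
  define q where "q = smult \<kappa> (div_poly E)"
  define x where "x = hsl_solution \<beta>0 S (poly q)"
  have "spectral_divisor \<Gamma> \<beta>0 (divisor_map E \<kappa>) E"
    unfolding spectral_divisor_def divisor_map_freqs[OF assms]
  proof (intro exI conjI allI impI)
    show "spectral_solution \<Gamma> \<beta>0 (divisor_map E \<kappa>) x" unfolding x_def q_def by (rule divisor_map_solution[OF assms])
    show "x l 0 = (\<Sum>k\<in>UNIV. (\<lambda>k l. frame_coord k (x l 0)) k l *s vframe k)" for l by (rule frame_expansion)
    show "poly (smult (1 / of_real (sqrt 2)) q) l = inverse l * (\<lambda>k l. frame_coord k (x l 0)) 1 l" if "l \<noteq> 0" for l
      using hsl_solution_at_0[of q l] degree_divisor_map[of \<kappa>] that by (simp add: frame_coord_def x_def q_def)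
    show "zero_divisor (card \<Delta> - 1) (smult (1 / of_real (sqrt 2)) q) E"
      unfolding zero_divisor_iff using size_E assms
      by (intro conjI exI[of _ "\<kappa> / of_real (sqrt 2)"]) (simp_all add: q_def)
  qed
  moreover have "same_triple (spectral_triple \<beta>0 \<Delta> E) (spectral_triple \<beta>0 \<Delta> E)"
    by (simp add: spectral_triple_def sheaf_iso_refl)
  ultimately show ?thesis unfolding has_spectral_data_def divisor_map_freqs[OF assms] by blast
qed

text \<open>The curve gives back \<open>\<Delta>\<close> and the sheaf gives back \<open>E\<close>; so the initial value of the spectral
  solution of \<open>f\<close> is that of a member of the family, with which \<open>f\<close> must coincide.\<close>

lemma spectral_data_determine:
  assumes based: "based f" and hsl: "weakly_conformal_HSL \<Gamma> \<beta>0 f"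
    and data: "has_spectral_data \<Gamma> \<beta>0 f (spectral_triple \<beta>0 \<Delta> E)"
  shows "\<exists>\<kappa>. \<kappa> \<noteq> 0 \<and> f = divisor_map E \<kappa>"
proof -
  define \<Delta>' where "\<Delta>' = freqs_of \<Gamma> \<beta>0 f"
  obtain E2 where E2: "spectral_divisor \<Gamma> \<beta>0 f E2" "X_curve \<beta>0 \<Delta> = X_curve \<beta>0 \<Delta>'"
    "sheaf_iso (X_curve \<beta>0 \<Delta>) (L_sheaf \<beta>0 \<Delta> E) (L_sheaf \<beta>0 \<Delta>' E2)"
    using data unfolding has_spectral_data_def spectral_triple_def \<Delta>'_def by auto
  have "spec_pts \<beta>0 \<Delta> = spec_pts \<beta>0 \<Delta>'"
    using root_poly_inj[OF finS neS X_curve_inj[OF E2(2)]] .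
  then have \<Delta>': "\<Delta>' = \<Delta>" using spec_pts_inj by metis
  obtain x \<chi>' q where x: "spectral_solution \<Gamma> \<beta>0 f x" "\<And>l. x l 0 = (\<Sum>k\<in>UNIV. \<chi>' k l *s vframe k)"
    "\<And>l. l \<noteq> 0 \<Longrightarrow> poly q l = inverse l * \<chi>' 1 l" "zero_divisor (card \<Delta> - 1) q E2"
    using E2(1) unfolding spectral_divisor_def \<Delta>'_def[symmetric] \<Delta>' by blast
  have "E = E2"
  proof (rule divisor_unique_of_sheaf_iso)
    show "unit_divisor \<beta>0 \<Delta> E" by (rule is_unit_divisor[OF size_E])
    show "unit_divisor \<beta>0 \<Delta> E2" using x(4) by (intro is_unit_divisor) (simp add: zero_divisor_iff)
    show "sheaf_iso (X_curve \<beta>0 \<Delta>) (L_sheaf \<beta>0 \<Delta> E) (L_sheaf \<beta>0 \<Delta> E2)" using E2(3) \<Delta>' by simp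
  qed
  then obtain c where c: "c \<noteq> 0" "q = smult c (div_poly E)" using x(4) unfolding zero_divisor_iff by blast
  \<comment> \<open>The factor \<open>\<surd>2\<close> comes from the normalisation of the vector \<open>v\<^sub>1\<close>.\<close>
  define \<kappa> where "\<kappa> = of_real (sqrt 2) * c"
  have \<kappa>: "\<kappa> \<noteq> 0" using c by (simp add: \<kappa>_def)
  have "f = divisor_map E \<kappa>"
  proof (rule hsl_unique[OF _ _ _ _ x(1) divisor_map_solution[OF \<kappa>]])
    show "smooth f" "cmat (mexp (lag_angle \<beta>0 z *\<^sub>R matJ)) *v (cmat matL *v d_z f z) = \<i> *s d_z f z" for z
      using hsl by (simp_all add: weakly_conformal_HSL_def)
    show "smooth (divisor_map E \<kappa>)"
      "cmat (mexp (lag_angle \<beta>0 z *\<^sub>R matJ)) *v (cmat matL *v d_z (divisor_map E \<kappa>) z) = \<i> *s d_z (divisor_map E \<kappa>) z" for z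
      using divisor_map_HSL[OF \<kappa>] by (simp_all add: weakly_conformal_HSL_def)
    show "spec_pts \<beta>0 (freqs_of \<Gamma> \<beta>0 f) = S" using \<Delta>' \<Delta>'_def by simp
    show "spec_pts \<beta>0 (freqs_of \<Gamma> \<beta>0 (divisor_map E \<kappa>)) = S" using divisor_map_freqs[OF \<kappa>] by simp
    show "f 0 = divisor_map E \<kappa> 0" using based hsl_map_based by (simp add: based_def divisor_map_def)
    fix l :: complex assume l: "l \<noteq> 0"
    have "chi \<i> False (x l 0) = of_real (sqrt 2) * \<chi>' 1 l"
      unfolding x(2) by (simp add: sum_4 chi_vframe)
    also have "\<dots> = l * poly (smult \<kappa> (div_poly E)) l"
      using x(3)[OF l] l unfolding c(2) \<kappa>_def by (simp add: field_simps)
    finally show "chi \<i> False (x l 0) = chi \<i> False (hsl_solution \<beta>0 S (poly (smult \<kappa> (div_poly E))) l 0)"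
      using hsl_solution_at_0[OF degree_divisor_map] by simp
  qed
  then show ?thesis using \<kappa> by blast
qed

lemma divisor_map_phase: "divisor_map E (of_real r * c) z = r *\<^sub>R (phase_matrix c *v divisor_map E 1 z)"
proof -
  have "poly (smult (of_real r * c) (div_poly E)) = (\<lambda>s. of_real r * c * poly (smult 1 (div_poly E)) s)" by auto
  then show ?thesis unfolding divisor_map_def using hsl_map_phase by metis
qed

end
end

theorem proposition5p2:
  fixes \<Gamma> :: "complex set" and \<beta>0 :: complex and \<Delta> :: "complex set"
    and E :: "sphere_pt multiset"
  assumes "is_lattice \<Gamma>"
    and "\<beta>0 \<in> dual_lattice \<Gamma>"
    and "freqs \<Gamma> \<beta>0 \<noteq> {}"
    and "\<Delta> \<subseteq> freqs \<Gamma> \<beta>0" and "\<Delta> \<noteq> {}"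
    and "\<And>\<gamma>. \<gamma> \<in> \<Delta> \<Longrightarrow> - \<gamma> \<in> \<Delta>"
    and "E \<in> admissible_divisors \<beta>0 \<Delta>"
  shows "\<exists>f. based f \<and> weakly_conformal_HSL \<Gamma> \<beta>0 f \<and>
             has_spectral_data \<Gamma> \<beta>0 f (spectral_triple \<beta>0 \<Delta> E) \<and>
             (\<forall>f'. based f' \<and> weakly_conformal_HSL \<Gamma> \<beta>0 f' \<and>
                   has_spectral_data \<Gamma> \<beta>0 f' (spectral_triple \<beta>0 \<Delta> E) \<longleftrightarrow>
                   (\<exists>r>0. \<exists>g\<in>T0. f' = (\<lambda>z. r *\<^sub>R (g *v f z))))"
proof -
  interpret torus_frequencies \<Gamma> \<beta>0 \<Delta> using assms by unfold_locales auto
  note E = assms(7)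
  have good: "based (divisor_map E \<kappa>) \<and> weakly_conformal_HSL \<Gamma> \<beta>0 (divisor_map E \<kappa>) \<and>
      has_spectral_data \<Gamma> \<beta>0 (divisor_map E \<kappa>) (spectral_triple \<beta>0 \<Delta> E)" if "\<kappa> \<noteq> 0" for \<kappa>
    using divisor_map_HSL[OF E that] divisor_map_spectral_data[OF E that] hsl_map_based by (simp add: divisor_map_def)
  have "(based f' \<and> weakly_conformal_HSL \<Gamma> \<beta>0 f' \<and> has_spectral_data \<Gamma> \<beta>0 f' (spectral_triple \<beta>0 \<Delta> E))
     \<longleftrightarrow> (\<exists>r>0. \<exists>g\<in>T0. f' = (\<lambda>z. r *\<^sub>R (g *v divisor_map E 1 z)))" (is "?l \<longleftrightarrow> ?r") for f'
  proof
    assume ?l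
    then obtain \<kappa> where \<kappa>: "\<kappa> \<noteq> 0" "f' = divisor_map E \<kappa>" using spectral_data_determine[OF E] by blast
    have s: "of_real (cmod \<kappa>) * sgn \<kappa> = \<kappa>" "cmod (sgn \<kappa>) = 1"
      using \<kappa>(1) by (simp add: sgn_eq, simp add: norm_sgn)
    have "f' = (\<lambda>z. cmod \<kappa> *\<^sub>R (phase_matrix (sgn \<kappa>) *v divisor_map E 1 z))"
      using divisor_map_phase[OF E, of "cmod \<kappa>" "sgn \<kappa>"] \<kappa>(2) s(1) by (simp add: fun_eq_iff)
    then show ?r using phase_matrix_T0[OF s(2)] \<kappa>(1) by (metis zero_less_norm_iff)
  next
    assume ?r
    then obtain r g where r: "r > 0" "g \<in> T0" "f' = (\<lambda>z. r *\<^sub>R (g *v divisor_map E 1 z))" by blast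
    obtain c where c: "cmod c = 1" "g = phase_matrix c" using r(2) by (rule T0_phase)
    have "f' = divisor_map E (of_real r * c)" using divisor_map_phase[OF E] r c by (simp add: fun_eq_iff)
    moreover have "of_real r * c \<noteq> 0" using r(1) c(1) by auto
    ultimately show ?l using good by simp
  qed
  then show ?thesis using good[of 1] by (intro exI[of _ "divisor_map E 1"]) simp
qed

end
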